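(* Let $p>5$ be a prime. There is no transitive group $G\le S_{2p}$ satisfying both of the following conditions: (A) the derived subgroup $G'$ is transitive on $\{1,\ldots,2p\}$; (B) $\langle Z(G_1)^G\rangle=G$.
   Context: $S_{2p}$ is the symmetric group on $\{1,\dots,2p\}$, $G_1$ is the stabilizer of the point $1$ in $G$, $Z(G_1)$ is its center, and $\langle Z(G_1)^G\rangle$ is the subgroup generated by all $G$-conjugates of elements of $Z(G_1)$, i.e. the normal closure of $Z(G_1)$ in $G$. *)

theory Defs
  imports
    "HOL-Computational_Algebra.Primes"
    "HOL-Algebra.Sym_Groups"
    "HOL-Algebra.Group_Action"
begin

definition transitive_on :: "('a \<Rightarrow> 'a) set \<Rightarrow> 'a set \<Rightarrow> bool"
  where "transitive_on H \<Omega> \<longleftrightarrow> (\<forall>x\<in>\<Omega>. \<forall>y\<in>\<Omega>. \<exists>h\<in>H. h x = y)"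

(* The action of a permutation group on points is given by evaluation, h acting on x as h x.
   The library locale group_action is not used: it wants permutations that are extensional
   on the set, whereas the elements of sym_group n are the identity outside {1..n}. *)
definition point_stabilizer :: "('a \<Rightarrow> 'a, 'b) monoid_scheme \<Rightarrow> ('a \<Rightarrow> 'a) set \<Rightarrow> 'a \<Rightarrow> ('a \<Rightarrow> 'a) set"
  where "point_stabilizer S H x = stabilizer (S \<lparr> carrier := H \<rparr>) (\<lambda>h. h) x"

(* Subgroups are carrier sets inside an ambient group S, as for the library's derived. *)
definition center :: "('a, 'b) monoid_scheme \<Rightarrow> 'a set \<Rightarrow> 'a set"
  where "center S H = {z \<in> H. \<forall>h\<in>H. z \<otimes>\<^bsub>S\<^esub> h = h \<otimes>\<^bsub>S\<^esub> z}"

definition normal_closure :: "('a, 'b) monoid_scheme \<Rightarrow> 'a set \<Rightarrow> 'a set \<Rightarrow> 'a set"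
  where "normal_closure S H A =
    generate S {g \<otimes>\<^bsub>S\<^esub> a \<otimes>\<^bsub>S\<^esub> inv\<^bsub>S\<^esub> g | g a. g \<in> H \<and> a \<in> A}"

end

theory Submission
  imports
    Defs
    "HOL-Number_Theory.Cong"
begin

text \<open>
  A central element \<open>w\<close> of the stabilizer \<open>G\<^sub>1\<close> spreads to a family of permutations \<open>z\<^sub>i \<in> G\<close> with
  \<open>z\<^sub>i i = i\<close> and \<open>g z\<^sub>i g\<inverse> = z\<^bsub>g i\<^esub>\<close>. The matrix \<open>M\<close> whose entry at \<open>(j, k)\<close> is the number of \<open>i\<close> with
  \<open>z\<^sub>i j = k\<close> is \<open>G\<close>-invariant and commutes with every \<open>G\<close>-invariant matrix. An element \<open>a\<close> of order \<open>p\<close> has no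
  fixed points, so it has two orbits and invariant matrices become \<open>2 \<times> 2\<close> matrices over the group ring of
  the integers modulo \<open>p\<close>. A Frobenius argument shows that the traces of \<open>M\<close> and \<open>M\<^sup>2\<close> in this group ring are
  constant away from \<open>0\<close>; say the trace of \<open>M\<close> has the value \<open>c\<close> there. By Cayley-Hamilton \<open>M\<close> satisfies a
  quadratic identity modulo the all-one matrix.

  The pairs of points which no element of \<open>G\<close> moves into a common orbit of \<open>a\<close> either form a perfect
  matching centralised by \<open>G\<close> or do not exist. In the first case all \<open>z\<^sub>i\<close> are even permutations,
  hence so is every element of \<open>G\<close>, but an element swapping two matched points is odd. In the second
  case the quadratic identity and the nonnegativity of \<open>M\<close> force \<open>c = 1\<close> or \<open>c = 2\<close>.
  If \<open>c = 1\<close>, the sets \<open>{i, j, z\<^sub>i j}\<close> behave like lines, and nine points forming an affine plane of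
  order three contradict the count of points commuting with them. If \<open>c = 2\<close>, then \<open>M\<close> minus the
  all-one matrix is a multiple of the projection to an eigenspace which is irreducible over the rationals; the
  relation \<open>z\<^sub>j k = k\<close> acts on it by a scalar, and the vanishing of a \<open>2 \<times> 2\<close> determinant over the group
  ring makes \<open>p\<close> divide \<open>3\<close>, \<open>4\<close> or \<open>5\<close>.
\<close>

section \<open>Congruences from cyclic actions\<close>

text \<open>Condition (A) serves to exclude a set \<open>S\<close> that every element of
  \<open>G\<close> fixes or swaps with its complement. Condition (B) becomes an induction principle:
  a part of \<open>G\<close> that contains \<open>id\<close> and all \<open>z i\<close> and is
  closed under composition is \<open>G\<close>.

  The obstacle is rationality. The group ring of the integers modulo \<open>p\<close> splits over
  the complex numbers, and one would like to apply Galois automorphisms of a cyclotomic field to the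
  eigenvalues of \<open>M\<close>. Everything here stays over the integers: the \<open>q\<close>-th
  power for a large prime \<open>q\<close> imitates such an automorphism modulo \<open>q\<close>,
  and size bounds turn congruences into equalities. The automorphism has to move \<open>p\<close>-th
  roots of unity in a prescribed way and to fix those belonging to the orders of the
  \<open>z i\<close>; this is possible because these orders are coprime to \<open>p\<close>.

  The bound on \<open>p\<close> is sharp at \<open>5\<close>: the symmetric group on five letters,
  acting on its ten transpositions, satisfies both conditions. It falls under \<open>c = 1\<close>,
  where no tenth of the set is left over to start the affine plane.\<close>

lemma funpow_mod_id:
  assumes "(h ^^ q) x = x" shows "(h ^^ k) x = (h ^^ (k mod q)) x"
proof -
  have "(h ^^ (q * m)) x = x" for m
    using assms by (induction m) (auto simp: funpow_add)
  then have "(h ^^ (k mod q + q * (k div q))) x = (h ^^ (k mod q)) x"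
    by (simp only: funpow_add comp_apply)
  then show ?thesis by simp
qed

lemma funpow_coprime_fixed:
  assumes q: "(h ^^ q) x = x" and k: "(h ^^ k) x = x" and co: "coprime k q"
  shows "h x = x"
proof (cases "k = 0")
  case True
  with co have "q = 1" by simp
  with q show ?thesis by simp
next
  case False
  then obtain u v where "k * u = q * v + 1"
    using co bezout_nat[of k q] by auto
  then have "(h ^^ (k * u)) x = (h ^^ (1 + q * v)) x" by simp
  moreover have "(h ^^ (k * u)) x = x"
    using funpow_mod_id[OF k, of "k * u"] by simp
  moreover have "(h ^^ (1 + q * v)) x = h x"
    using funpow_mod_id[OF q, of "q * v"] by (simp add: funpow_add)
  ultimately show ?thesis by simp
qed

text \<open>As \<open>q\<close> is prime, a nontrivial orbit of \<open>h\<close> has exactly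
  \<open>q\<close> elements, and \<open>w\<close> is constant on it, so it contributes a multiple of
  \<open>q\<close>. The induction removes one such orbit at a time.\<close>

lemma sum_cong_fixed_points:
  fixes w :: "'a \<Rightarrow> int"
  assumes q: "prime q" and "finite S"
    and "\<And>x. x \<in> S \<Longrightarrow> h x \<in> S" and "\<And>x. x \<in> S \<Longrightarrow> (h ^^ q) x = x"
    and "\<And>x. x \<in> S \<Longrightarrow> w (h x) = w x"
  shows "[(\<Sum>x\<in>S. w x) = (\<Sum>x | x \<in> S \<and> h x = x. w x)] (mod int q)"
  using assms(2-)
proof (induction S rule: finite_psubset_induct)
  case (psubset S)
  show ?case
  proof (cases "\<exists>x\<in>S. h x \<noteq> x")
    case False
    then have "{x. x \<in> S \<and> h x = x} = S" by auto
    then show ?thesis by simp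
  next
    case True
    then obtain x where x: "x \<in> S" "h x \<noteq> x" by blast
    define Orb where "Orb = (\<lambda>k. (h ^^ k) x) ` {..<q}"
    have inS: "(h ^^ k) x \<in> S" for k
      using x psubset.prems(1) by (induction k) auto
    have q0: "q > 0" using q prime_gt_0_nat by blast
    have inj: "inj_on (\<lambda>k. (h ^^ k) x) {..<q}"
    proof (rule linorder_inj_onI')
      fix i j assume ij: "i \<in> {..<q}" "j \<in> {..<q}" "i < j"
      show "(h ^^ i) x \<noteq> (h ^^ j) x"
      proof
        assume "(h ^^ i) x = (h ^^ j) x"
        then have "(h ^^ (q - i)) ((h ^^ i) x) = (h ^^ (q - i)) ((h ^^ j) x)" by simp
        then have "(h ^^ (q - i + i)) x = (h ^^ (q - i + j)) x" by (simp add: funpow_add)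
        moreover have "q - i + i = q" "q - i + j = q + (j - i)" using ij by auto
        ultimately have "(h ^^ q) x = (h ^^ q) ((h ^^ (j - i)) x)"
          by (metis comp_apply funpow_add)
        then have "(h ^^ (j - i)) x = x"
          using psubset.prems(2)[OF x(1)] psubset.prems(2)[OF inS[of "j - i"]] by metis
        moreover have "coprime (j - i) q"
        proof -
          have "\<not> q dvd j - i" using ij by (intro nat_dvd_not_less) auto
          then show ?thesis using q prime_imp_coprime coprime_commute by blast
        qed
        ultimately show False
          using funpow_coprime_fixed psubset.prems(2)[OF x(1)] x(2) by metis
      qed
    qed
    have cardO: "card Orb = q" unfolding Orb_def using card_image[OF inj] by simp
    have hO: "h y \<in> Orb \<longleftrightarrow> y \<in> Orb" if "y \<in> S" for y
    proof
      have mem: "(h ^^ k) x \<in> Orb" for k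
        unfolding Orb_def using funpow_mod_id[OF psubset.prems(2)[OF x(1)], of k] q0
        by (auto simp: image_iff intro!: bexI[of _ "k mod q"])
      { assume "y \<in> Orb"
        then obtain k where "y = (h ^^ k) x" unfolding Orb_def by auto
        then have "h y = (h ^^ Suc k) x" by simp
        then show "h y \<in> Orb" using mem by metis }
      { assume "h y \<in> Orb"
        then obtain k where k: "h y = (h ^^ k) x" unfolding Orb_def by auto
        have "y = (h ^^ (q - 1)) (h y)"
          using psubset.prems(2)[OF that] q0 by (metis Suc_diff_1 comp_apply funpow_Suc_right)
        also have "\<dots> = (h ^^ (q - 1 + k)) x" by (simp add: k funpow_add)
        finally show "y \<in> Orb" using mem by metis }
    qed
    have OS: "Orb \<subseteq> S" unfolding Orb_def using inS by auto
    have xO: "x \<in> Orb" unfolding Orb_def using q0 by force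
    have wO: "w y = w x" if "y \<in> Orb" for y
    proof -
      have "w ((h ^^ k) x) = w x" for k
        by (induction k) (use psubset.prems(3) inS in auto)
      then show ?thesis using that unfolding Orb_def by auto
    qed
    have nf: "h y \<noteq> y" if "y \<in> Orb" for y
    proof
      assume hy: "h y = y"
      obtain k where k: "y = (h ^^ k) x" "k < q" using \<open>y \<in> Orb\<close> unfolding Orb_def by auto
      have "(h ^^ n) y = y" for n using hy by (induction n) auto
      then have "(h ^^ (q - k)) y = y" "(h ^^ (Suc (q - k))) y = y" by blast+
      then have "(h ^^ (q - k + k)) x = y" "(h ^^ (Suc (q - k) + k)) x = y"
        unfolding k(1) by (auto simp: funpow_add)
      moreover have "q - k + k = q" using k(2) by simp
      ultimately show False using x psubset.prems(2)[OF x(1)] by simp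
    qed
    let ?S' = "S - Orb"
    have "[(\<Sum>x\<in>?S'. w x) = (\<Sum>x | x \<in> ?S' \<and> h x = x. w x)] (mod int q)"
    proof (rule psubset.IH)
      show "?S' \<subset> S" using x xO by blast
      show "h y \<in> ?S'" if "y \<in> ?S'" for y using that psubset.prems(1) hO by blast
      show "(h ^^ q) y = y" if "y \<in> ?S'" for y using that psubset.prems(2) by blast
      show "w (h y) = w y" if "y \<in> ?S'" for y using that psubset.prems(3) by blast
    qed
    moreover have "{x. x \<in> ?S' \<and> h x = x} = {x. x \<in> S \<and> h x = x}" using nf by auto
    moreover have "(\<Sum>x\<in>S. w x) = (\<Sum>x\<in>?S'. w x) + int q * w x"
    proof -
      have "(\<Sum>x\<in>S. w x) = (\<Sum>x\<in>?S'. w x) + (\<Sum>x\<in>Orb. w x)"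
        using sum.subset_diff[OF OS psubset.hyps(1)] by simp
      moreover have "(\<Sum>x\<in>Orb. w x) = (\<Sum>y\<in>Orb. w x)" using wO by (intro sum.cong) auto
      ultimately show ?thesis by (simp add: cardO)
    qed
    ultimately have "[(\<Sum>x\<in>S. w x) = (\<Sum>x | x \<in> S \<and> h x = x. w x) + int q * w x] (mod int q)"
      using cong_add[OF _ cong_refl] by metis
    then show ?thesis unfolding cong_def mod_mult_self2 .
  qed
qed

lemma card_cong_fixed_points:
  assumes "prime q" and "finite S" and "\<And>x. x \<in> S \<Longrightarrow> h x \<in> S" and "\<And>x. x \<in> S \<Longrightarrow> (h ^^ q) x = x"
  shows "[card S = card {x \<in> S. h x = x}] (mod q)"
proof -
  have "[(\<Sum>x\<in>S. 1) = (\<Sum>x | x \<in> S \<and> h x = x. 1)] (mod int q)"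
    using sum_cong_fixed_points[OF assms, of "\<lambda>_. 1"] by simp
  then have "[int (card S) = int (card {x \<in> S. h x = x})] (mod int q)" by simp
  then show ?thesis by (simp add: cong_int_iff)
qed

lemma rotate1_eq_self_iff:
  assumes "length xs = Suc n"
  shows "rotate1 xs = xs \<longleftrightarrow> (\<exists>x. xs = replicate (Suc n) x)"
proof
  assume r: "rotate1 xs = xs"
  have "xs ! i = xs ! 0" if "i < length xs" for i
    using that
  proof (induction i)
    case (Suc i)
    have "rotate1 xs ! i = xs ! Suc i" using Suc.prems nth_rotate1[of i xs] by simp
    then show ?case using Suc r by (metis Suc_lessD)
  qed simp
  then have "xs = replicate (Suc n) (xs ! 0)"
    using assms by (metis length_replicate nth_equalityI nth_replicate)
  then show "\<exists>x. xs = replicate (Suc n) x" by blast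
next
  assume "\<exists>x. xs = replicate (Suc n) x"
  then show "rotate1 xs = xs" by (auto simp: replicate_append_same)
qed

text \<open>Rotation has order dividing \<open>q\<close> on words of length \<open>q\<close> and
  fixes only the constant ones. This one principle yields Fermat's congruence, Cauchy's theorem, the
  trace of a \<open>q\<close>-th power, and the Frobenius map in the group algebra of
  \<open>G\<close> and in the group ring of the integers modulo \<open>p\<close>.\<close>

lemma sum_lists_cong_constant:
  fixes w :: "'a list \<Rightarrow> int"
  assumes q: "prime q" and X: "finite X"
    and w: "\<And>xs. set xs \<subseteq> X \<Longrightarrow> length xs = q \<Longrightarrow> w (rotate1 xs) = w xs"
  shows "[(\<Sum>xs | set xs \<subseteq> X \<and> length xs = q. w xs) = (\<Sum>x\<in>X. w (replicate q x))] (mod int q)"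
proof -
  let ?S = "{xs. set xs \<subseteq> X \<and> length xs = q}"
  obtain n where n: "q = Suc n" using q prime_gt_0_nat gr0_implies_Suc by blast
  have rot: "(rotate1 ^^ q) xs = xs" if "xs \<in> ?S" for xs
    using that rotate_id[of q xs] unfolding rotate_def by simp
  have "[(\<Sum>xs\<in>?S. w xs) = (\<Sum>xs | xs \<in> ?S \<and> rotate1 xs = xs. w xs)] (mod int q)"
    using finite_lists_length_eq[OF X] w rot by (intro sum_cong_fixed_points[OF q]) auto
  moreover have "{xs. xs \<in> ?S \<and> rotate1 xs = xs} = (\<lambda>x. replicate q x) ` X"
  proof -
    have "xs \<in> ?S \<and> rotate1 xs = xs \<longleftrightarrow> xs \<in> (\<lambda>x. replicate q x) ` X" for xs
      using rotate1_eq_self_iff[of xs n] n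
      by (auto simp: replicate_append_same simp del: replicate_Suc)
    then show ?thesis by blast
  qed
  moreover have "inj_on (\<lambda>x. replicate q x) X" using n by (auto intro: inj_onI)
  ultimately show ?thesis by (simp add: sum.reindex)
qed

lemma fermat_int: "prime q \<Longrightarrow> [(x::int) ^ q = x] (mod int q)"
proof -
  assume q: "prime q"
  have nat: "[int y ^ q = int y] (mod int q)" for y
  proof -
    have "[(\<Sum>xs | set xs \<subseteq> {..<y} \<and> length xs = q. 1) = (\<Sum>x\<in>{..<y}. 1)] (mod int q)"
      using sum_lists_cong_constant[OF q finite_lessThan[of y], of "\<lambda>_. 1"] by blast
    moreover have "(\<Sum>xs | set xs \<subseteq> {..<y} \<and> length xs = q. 1) = int y ^ q"
      using card_lists_length_eq[of "{..<y}" q] by simp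
    moreover have "(\<Sum>x\<in>{..<y}. 1) = int y" by simp
    ultimately show ?thesis by metis
  qed
  have "[x = int (nat (x mod int q))] (mod int q)"
    using q prime_gt_0_nat[OF q] by (simp add: cong_def)
  then have x: "[x = int y] (mod int q)" if "y = nat (x mod int q)" for y using that by simp
  show ?thesis
    using cong_trans[OF cong_trans[OF cong_pow[OF x[OF refl]] nat] cong_sym[OF x[OF refl]]] .
qed

text \<open>Takes the place of Dirichlet's theorem on primes in progressions. The number
  \<open>t\<close> need not be prime, but a statement can be carried along its prime factors, all of
  which exceed \<open>B\<close>. The Chinese remainder theorem suffices, as \<open>t\<close> is also
  made \<open>1\<close> modulo every small prime.\<close>

lemma residue_with_large_prime_factors:
  fixes p m x B :: nat
  assumes p: "prime p" and m: "coprime m p" and x: "\<not> p dvd x"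
  obtains t where "t > 0" "[t = 1] (mod m)" "[t = x] (mod p)" "\<And>q. prime q \<Longrightarrow> q dvd t \<Longrightarrow> q > B"
proof -
  \<comment> \<open>\<open>p\<close> is left out because the residue of \<open>t\<close> modulo
    \<open>p\<close> is prescribed by \<open>x\<close>, which already keeps \<open>p\<close> from
    dividing \<open>t\<close>.\<close>
  define P where "P = (\<Prod>q | prime q \<and> q \<le> B \<and> q \<noteq> p. q)"
  have fin: "finite {q. prime q \<and> q \<le> B \<and> q \<noteq> p}" by (rule finite_subset[of _ "{..B}"]) auto
  have cP: "coprime P p"
    unfolding P_def by (rule prod_coprime_left) (use p primes_coprime in blast)
  have "coprime (m * P) p" using m cP by simp
  then obtain t where t: "[t = 1] (mod m * P)" "[t = x] (mod p)"
    using binary_chinese_remainder_nat by blast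
  have nt: "q > B" if "prime q" "q dvd t" for q
  proof (rule ccontr)
    assume B: "\<not> q > B"
    show False
    proof (cases "q = p")
      case True
      with that t(2) x show False using cong_dvd_iff by blast
    next
      case False
      then have "q dvd P" unfolding P_def using B that fin by (intro dvd_prodI) auto
      then have "[t = 1] (mod q)" using t(1) cong_dvd_modulus_nat dvd_mult by blast
      then have "q dvd 1" using that cong_dvd_iff by blast
      with that show False by simp
    qed
  qed
  have "t > 0" using nt p by (metis dvd_0_right gr0I t(2) x cong_dvd_iff)
  moreover have "[t = 1] (mod m)" using t(1) cong_modulus_mult_nat by blast
  ultimately show thesis using that t(2) nt by blast
qed

lemma prime_mult_induct:
  assumes P1: "P 1" and step: "\<And>s q. P s \<Longrightarrow> prime q \<Longrightarrow> q > B \<Longrightarrow> P (s * q)"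
    and t: "t > (0::nat)" "\<And>q. prime q \<Longrightarrow> q dvd t \<Longrightarrow> q > B"
  shows "P t"
  using t
proof (induction t rule: less_induct)
  case (less t)
  show ?case
  proof (cases "t = 1")
    case False
    then obtain q where q: "prime q" "q dvd t" using prime_factor_nat by blast
    then obtain s where s: "t = s * q" by (metis dvdE mult.commute)
    have "s < t" using s less.prems(1) prime_gt_1_nat[OF q(1)] by simp
    moreover have "s > 0" using s less.prems by auto
    ultimately have "P s" using less s by auto
    then show ?thesis using step q less.prems s by auto
  qed (use P1 in simp)
qed

section \<open>Invariant matrices\<close>

definition mmul :: "'a set \<Rightarrow> ('a \<Rightarrow> 'a \<Rightarrow> int) \<Rightarrow> ('a \<Rightarrow> 'a \<Rightarrow> int) \<Rightarrow> 'a \<Rightarrow> 'a \<Rightarrow> int"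
  where "mmul X A B j k = (\<Sum>l\<in>X. A j l * B l k)"

primrec mpow :: "'a set \<Rightarrow> ('a \<Rightarrow> 'a \<Rightarrow> int) \<Rightarrow> nat \<Rightarrow> 'a \<Rightarrow> 'a \<Rightarrow> int" where
  "mpow X A 0 = (\<lambda>j k. if j = k then 1 else 0)"
| "mpow X A (Suc n) = mmul X A (mpow X A n)"

definition mtrace :: "'a set \<Rightarrow> ('a \<Rightarrow> 'a \<Rightarrow> int) \<Rightarrow> int"
  where "mtrace X A = (\<Sum>x\<in>X. A x x)"

lemma mmul_assoc: "mmul X (mmul X A B) C = mmul X A (mmul X B C)"
proof (intro ext)
  fix j k
  have "mmul X (mmul X A B) C j k = (\<Sum>l\<in>X. \<Sum>m\<in>X. A j m * B m l * C l k)"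
    by (simp add: mmul_def sum_distrib_right)
  also have "\<dots> = (\<Sum>m\<in>X. \<Sum>l\<in>X. A j m * B m l * C l k)" by (rule sum.swap)
  also have "\<dots> = mmul X A (mmul X B C) j k"
    by (simp add: mmul_def sum_distrib_left mult.assoc)
  finally show "mmul X (mmul X A B) C j k = mmul X A (mmul X B C) j k" .
qed

lemma mmul_cong:
  assumes "\<And>l. l \<in> X \<Longrightarrow> A j l = A' j' l" "\<And>l. l \<in> X \<Longrightarrow> B l k = B' l k'"
  shows "mmul X A B j k = mmul X A' B' j' k'"
  using assms by (simp add: mmul_def)

lemma mpow_cong_mod:
  assumes "\<And>j k. j \<in> X \<Longrightarrow> k \<in> X \<Longrightarrow> [A j k = B j k] (mod q)" "j \<in> X" "k \<in> X"
  shows "[mpow X A n j k = mpow X B n j k] (mod q)"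
  using assms(2)
  by (induction n arbitrary: j) (auto simp: mmul_def assms intro!: cong_sum cong_mult)

lemma mpow_add:
  assumes "finite X" "j \<in> X"
  shows "mpow X A (m + n) j k = mmul X (mpow X A m) (mpow X A n) j k"
  using assms(2)
proof (induction m arbitrary: j)
  case 0
  then show ?case using assms(1) by (simp add: mmul_def if_distrib[of "\<lambda>u. u * _"] sum.delta cong: if_cong)
next
  case (Suc m)
  have "mpow X A (Suc m + n) j k = mmul X A (mmul X (mpow X A m) (mpow X A n)) j k"
    using Suc by (auto intro!: mmul_cong)
  then show ?case by (simp add: mmul_assoc)
qed

lemma mpow_mult:
  assumes "finite X" "j \<in> X" "k \<in> X"
  shows "mpow X A (m * n) j k = mpow X (mpow X A m) n j k"
  using assms(2)
proof (induction n arbitrary: j)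
  case (Suc n)
  have "mpow X A (m * Suc n) j k = mmul X (mpow X A m) (mpow X A (m * n)) j k"
    using mpow_add[OF assms(1) Suc.prems] by simp
  then show ?case using Suc.IH by (auto intro!: mmul_cong)
qed simp

section \<open>Closed walks and the trace of a prime power\<close>

primrec walk :: "('a \<Rightarrow> 'a \<Rightarrow> int) \<Rightarrow> 'a \<Rightarrow> 'a list \<Rightarrow> 'a \<Rightarrow> int" where
  "walk A x [] y = A x y"
| "walk A x (z # zs) y = A x z * walk A z zs y"

lemma walk_snoc: "walk A x (zs @ [z]) y = walk A x zs z * A z y"
  by (induction zs arbitrary: x) (simp_all add: mult.assoc)

lemma sum_lists_Suc:
  assumes "finite X"
  shows "(\<Sum>xs | set xs \<subseteq> X \<and> length xs = Suc n. F xs) =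
    (\<Sum>x\<in>X. \<Sum>xs | set xs \<subseteq> X \<and> length xs = n. (F (x # xs) :: 'b :: comm_monoid_add))"
proof -
  let ?L = "{xs. set xs \<subseteq> X \<and> length xs = n}"
  have "{xs. set xs \<subseteq> X \<and> length xs = Suc n} = (\<lambda>(x, xs). x # xs) ` (X \<times> ?L)"
    by (auto simp: length_Suc_conv image_iff)
  moreover have "inj_on (\<lambda>(x, xs). x # xs) (X \<times> ?L)" by (auto intro: inj_onI)
  ultimately show ?thesis
    using assms finite_lists_length_eq[OF assms, of n]
    by (simp add: sum.reindex sum.cartesian_product case_prod_unfold)
qed

lemma mpow_eq_sum_walks:
  assumes X: "finite X" and "x \<in> X" "y \<in> X"
  shows "mpow X A (Suc n) x y = (\<Sum>zs | set zs \<subseteq> X \<and> length zs = n. walk A x zs y)"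
  using assms(2)
proof (induction n arbitrary: x)
  case 0
  have "mpow X A (Suc 0) x y = A x y"
    using X assms(3) by (simp add: mmul_def if_distrib[of "\<lambda>u. _ * u"] sum.delta cong: if_cong)
  moreover have "{zs. set zs \<subseteq> X \<and> length zs = 0} = {[]}" by auto
  ultimately show ?case by simp
next
  case (Suc n)
  have "mpow X A (Suc (Suc n)) x y = (\<Sum>l\<in>X. A x l * mpow X A (Suc n) l y)"
    by (simp add: mmul_def)
  also have "\<dots> = (\<Sum>l\<in>X. A x l * (\<Sum>zs | set zs \<subseteq> X \<and> length zs = n. walk A l zs y))"
    using Suc.IH by (intro sum.cong) (auto simp del: mpow.simps)
  finally show ?case unfolding sum_lists_Suc[OF X] by (simp add: sum_distrib_left)
qed

text \<open>The trace of the \<open>q\<close>-th power is the total weight of the closed walks of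
  length \<open>q\<close>. Rotating a walk keeps its weight, and the constant walk at
  \<open>x\<close> weighs \<open>A x x ^ q\<close>, which is \<open>A x x\<close> modulo
  \<open>q\<close>.\<close>

lemma trace_mpow_prime:
  assumes q: "prime q" and X: "finite X"
  shows "[mtrace X (mpow X A q) = mtrace X A] (mod int q)"
proof -
  obtain n where n: "q = Suc n" using q prime_gt_0_nat gr0_implies_Suc by blast
  define w where "w xs = walk A (hd xs) (tl xs) (hd xs)" for xs
  have "mtrace X (mpow X A q) = (\<Sum>x\<in>X. mpow X A (Suc n) x x)" by (simp only: mtrace_def n)
  also have "\<dots> = (\<Sum>x\<in>X. \<Sum>zs | set zs \<subseteq> X \<and> length zs = n. walk A x zs x)"
    using mpow_eq_sum_walks[OF X] by (intro sum.cong) auto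
  also have "\<dots> = (\<Sum>xs | set xs \<subseteq> X \<and> length xs = q. w xs)"
    unfolding n sum_lists_Suc[OF X] by (simp add: w_def)
  finally have "mtrace X (mpow X A q) = (\<Sum>xs | set xs \<subseteq> X \<and> length xs = q. w xs)" .
  moreover have "[(\<Sum>xs | set xs \<subseteq> X \<and> length xs = q. w xs) = (\<Sum>x\<in>X. w (replicate q x))] (mod int q)"
  proof (rule sum_lists_cong_constant[OF q X])
    fix xs assume "set xs \<subseteq> X" "length xs = q"
    then obtain y ys where xs: "xs = y # ys" using n by (cases xs) auto
    show "w (rotate1 xs) = w xs"
      by (cases ys) (auto simp: xs w_def walk_snoc)
  qed
  moreover have "w (replicate q x) = A x x ^ q" for x
  proof -
    have "walk A x (replicate m x) x = A x x ^ Suc m" for m by (induction m) auto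
    then show ?thesis by (simp add: n w_def del: power_Suc)
  qed
  moreover have "[(\<Sum>x\<in>X. A x x ^ q) = mtrace X A] (mod int q)"
    unfolding mtrace_def using fermat_int[OF q] by (intro cong_sum)
  ultimately show ?thesis by (metis (no_types, lifting) cong_trans sum.cong)
qed

section \<open>Equivariant families and invariant matrices of a permutation group\<close>

locale perm_group =
  fixes X :: "'a set" and G :: "('a \<Rightarrow> 'a) set"
  assumes finX: "finite X"
    and perm: "g \<in> G \<Longrightarrow> g permutes X"
    and id_mem: "id \<in> G"
    and comp_mem: "g \<in> G \<Longrightarrow> h \<in> G \<Longrightarrow> g \<circ> h \<in> G"
    and inv_mem: "g \<in> G \<Longrightarrow> inv' g \<in> G"
begin

text \<open>Conjugation by \<open>g\<close> takes \<open>z i\<close> to \<open>z (g i)\<close>;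
  written without inverses, the condition passes directly to powers.\<close>

definition conj_fam :: "('a \<Rightarrow> 'a \<Rightarrow> 'a) \<Rightarrow> bool"
  where "conj_fam z \<longleftrightarrow> (\<forall>i\<in>X. z i \<in> G) \<and> (\<forall>g\<in>G. \<forall>i\<in>X. g \<circ> z i = z (g i) \<circ> g)"

text \<open>Equivalently, \<open>A\<close> commutes with the permutation matrices of
  \<open>G\<close>: these matrices form the centralizer algebra of the action.\<close>

definition ginv :: "('a \<Rightarrow> 'a \<Rightarrow> int) \<Rightarrow> bool"
  where "ginv A \<longleftrightarrow> (\<forall>g\<in>G. \<forall>j\<in>X. \<forall>k\<in>X. A (g j) (g k) = A j k)"

text \<open>The sum of the permutation matrices of all \<open>z i\<close>. It is invariant because
  \<open>G\<close> permutes the family, and it commutes with every invariant matrix because each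
  \<open>z i\<close> lies in \<open>G\<close>.\<close>

definition cmat :: "('a \<Rightarrow> 'a \<Rightarrow> 'a) \<Rightarrow> 'a \<Rightarrow> 'a \<Rightarrow> int"
  where "cmat z j k = int (card {i \<in> X. z i j = k})"

lemma finG: "finite G"
  by (rule finite_subset[OF _ finite_permutations[OF finX]]) (use perm in blast)

lemma mem_X: "g \<in> G \<Longrightarrow> j \<in> X \<Longrightarrow> g j \<in> X"
  using permutes_in_image[OF perm] by blast

lemma mem_X_iff: "g \<in> G \<Longrightarrow> g j \<in> X \<longleftrightarrow> j \<in> X"
  using permutes_in_image[OF perm] by blast

lemma inv_apply [simp]: "g \<in> G \<Longrightarrow> inv' g (g j) = j" "g \<in> G \<Longrightarrow> g (inv' g j) = j"
  using permutes_inverses[OF perm] by auto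

lemma inv_comp [simp]: "g \<in> G \<Longrightarrow> inv' g \<circ> g = id" "g \<in> G \<Longrightarrow> g \<circ> inv' g = id"
  by auto

lemma inj_G: "g \<in> G \<Longrightarrow> g j = g k \<longleftrightarrow> j = k"
  using inv_apply(1)[of g j] inv_apply(1)[of g k] by metis

lemma bij_X: "g \<in> G \<Longrightarrow> bij_betw g X X"
  by (rule permutes_imp_bij[OF perm])

lemma funpow_mem: "g \<in> G \<Longrightarrow> g ^^ n \<in> G"
  using id_mem comp_mem by (induction n) simp_all

lemma sum_reindex_G: "g \<in> G \<Longrightarrow> (\<Sum>j\<in>X. f (g j)) = (\<Sum>j\<in>X. f j)"
  using sum.reindex_bij_betw[OF bij_X] by blast

lemma eq_id_iff: "g \<in> G \<Longrightarrow> g = id \<longleftrightarrow> (\<forall>j\<in>X. g j = j)"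
  using permutes_not_in[OF perm[of g]] by (auto simp: fun_eq_iff)

lemma ginvD: "ginv A \<Longrightarrow> g \<in> G \<Longrightarrow> j \<in> X \<Longrightarrow> k \<in> X \<Longrightarrow> A (g j) (g k) = A j k"
  unfolding ginv_def by blast

lemma conj_fam_mem: "conj_fam z \<Longrightarrow> i \<in> X \<Longrightarrow> z i \<in> G"
  unfolding conj_fam_def by blast

lemma conj_fam_comp: "conj_fam z \<Longrightarrow> g \<in> G \<Longrightarrow> i \<in> X \<Longrightarrow> g \<circ> z i = z (g i) \<circ> g"
  unfolding conj_fam_def by blast

lemma conj_fam_apply: "conj_fam z \<Longrightarrow> g \<in> G \<Longrightarrow> i \<in> X \<Longrightarrow> g (z i j) = z (g i) (g j)"
  using conj_fam_comp[of z g i] by (metis comp_apply)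

lemma conj_fam_funpow:
  assumes "conj_fam z" shows "conj_fam (\<lambda>i. z i ^^ n)"
proof -
  have "g \<circ> z i ^^ n = z (g i) ^^ n \<circ> g" if "g \<in> G" "i \<in> X" for g i
  proof (induction n)
    case (Suc n)
    have "g ((z i ^^ Suc n) j) = (z (g i) ^^ Suc n) (g j)" for j
      using Suc conj_fam_apply[OF assms that] by (simp add: fun_eq_iff)
    then show ?case by (simp add: fun_eq_iff)
  qed auto
  moreover have "z i ^^ n \<in> G" if "i \<in> X" for i
    using funpow_mem[OF conj_fam_mem[OF assms that]] .
  ultimately show ?thesis unfolding conj_fam_def by simp
qed

lemma ginv_mmul: "ginv A \<Longrightarrow> ginv B \<Longrightarrow> ginv (mmul X A B)"
proof -
  assume AB: "ginv A" "ginv B"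
  have "mmul X A B (g j) (g k) = mmul X A B j k" if "g \<in> G" "j \<in> X" "k \<in> X" for g j k
  proof -
    have "mmul X A B (g j) (g k) = (\<Sum>l\<in>X. A (g j) (g l) * B (g l) (g k))"
      unfolding mmul_def using sum_reindex_G[OF that(1), of "\<lambda>l. A (g j) l * B l (g k)"] by simp
    also have "\<dots> = mmul X A B j k"
      unfolding mmul_def using AB that by (intro sum.cong) (auto simp: ginvD)
    finally show ?thesis .
  qed
  then show ?thesis unfolding ginv_def by blast
qed

lemma ginv_mpow: "ginv A \<Longrightarrow> ginv (mpow X A n)"
proof (induction n)
  case 0
  then show ?case by (auto simp: ginv_def inj_G)
qed (simp add: ginv_mmul)

lemma ginv_cmat:
  assumes "conj_fam z" shows "ginv (cmat z)"
proof -
  have "card {i \<in> X. z i (g j) = g k} = card {i \<in> X. z i j = k}" if "g \<in> G" "j \<in> X" "k \<in> X" for g j k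
  proof (rule bij_betw_same_card[symmetric])
    have eq: "z (g i) (g j) = g k \<longleftrightarrow> z i j = k" if "i \<in> X" for i
      using conj_fam_apply[OF assms \<open>g \<in> G\<close> that] inj_G[OF \<open>g \<in> G\<close>] by metis
    have "{i \<in> X. z i (g j) = g k} \<subseteq> g ` {i \<in> X. z i j = k}"
    proof
      fix i assume i: "i \<in> {i \<in> X. z i (g j) = g k}"
      have "i = g (inv' g i)" "inv' g i \<in> X" using that i inv_mem mem_X by auto
      with i eq[of "inv' g i"] show "i \<in> g ` {i \<in> X. z i j = k}" by auto
    qed
    moreover have "g ` {i \<in> X. z i j = k} \<subseteq> {i \<in> X. z i (g j) = g k}" using eq mem_X that by auto
    ultimately show "bij_betw g {i \<in> X. z i j = k} {i \<in> X. z i (g j) = g k}"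
      using inj_G[OF that(1)] unfolding bij_betw_def by (auto intro: inj_onI)
  qed
  then show ?thesis unfolding ginv_def cmat_def by simp
qed

lemma cmat_mmul:
  assumes "\<And>i. i \<in> X \<Longrightarrow> z i \<in> G" "j \<in> X"
  shows "mmul X (cmat z) A j k = (\<Sum>i\<in>X. A (z i j) k)"
proof -
  have "mmul X (cmat z) A j k = (\<Sum>l\<in>X. \<Sum>i | i \<in> X \<and> z i j = l. A l k)"
    unfolding mmul_def cmat_def by simp
  also have "\<dots> = (\<Sum>l\<in>X. \<Sum>i | i \<in> X \<and> z i j = l. A (z i j) k)"
    by (intro sum.cong) auto
  also have "\<dots> = (\<Sum>i\<in>X. A (z i j) k)"
    using assms mem_X finX by (intro sum.group) auto
  finally show ?thesis .
qed

section \<open>The Frobenius map for equivariant families\<close>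

lemma fold_mem: "conj_fam z \<Longrightarrow> set xs \<subseteq> X \<Longrightarrow> fold z xs \<in> G"
proof (induction xs)
  case Nil
  then show ?case using id_mem by (simp add: id_def)
next
  case (Cons x xs)
  then show ?case using comp_mem[of "fold z xs" "z x"] conj_fam_mem[of z x] by (simp add: comp_def)
qed

lemma fold_conj: 
  assumes "conj_fam z" "g \<in> G" "set xs \<subseteq> X" 
  shows "fold z (map g xs) = g \<circ> fold z xs \<circ> inv' g"
  using assms(3)
proof (induction xs)
  case Nil
  then show ?case using assms(2) by (simp add: fun_eq_iff)
next
  case (Cons x xs)
  have "z (g x) \<circ> g = g \<circ> z x" using conj_fam_comp[OF assms(1,2)] Cons.prems by simp
  then have "z (g x) = g \<circ> z x \<circ> inv' g" using assms(2) by (metis comp_assoc comp_id inv_comp(2))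
  then show ?case using Cons assms(2) by (simp add: fun_eq_iff)
qed

lemma mpow_cmat:
  assumes z: "conj_fam z" and "j \<in> X"
  shows "mpow X (cmat z) n j k = (\<Sum>xs | set xs \<subseteq> X \<and> length xs = n. if fold z xs j = k then 1 else 0)"
  using assms(2)
proof (induction n arbitrary: j)
  case 0
  have "{xs. set xs \<subseteq> X \<and> length xs = 0} = {[]}" by auto
  then show ?case by simp
next
  case (Suc n)
  have "mpow X (cmat z) (Suc n) j k = (\<Sum>i\<in>X. mpow X (cmat z) n (z i j) k)"
    using cmat_mmul[OF conj_fam_mem[OF z] Suc.prems] by simp
  also have "\<dots> = (\<Sum>i\<in>X. \<Sum>xs | set xs \<subseteq> X \<and> length xs = n. if fold z xs (z i j) = k then 1 else 0)"
    using Suc.IH Suc.prems conj_fam_mem[OF z] mem_X by (intro sum.cong) auto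
  finally show ?case unfolding sum_lists_Suc[OF finX] by simp
qed

text \<open>In the group algebra of \<open>G\<close> this compares the \<open>q\<close>-th power of
  the sum of all \<open>z i\<close> with the sum of all \<open>z i ^^ q\<close>. Rotating a word
  conjugates its product, so the rotation argument applies to whole conjugacy classes. Both
  coefficients are class functions, and the class size is invertible modulo \<open>q\<close> because
  \<open>card G < q\<close>.\<close>

lemma card_fold_eq_cong:
  assumes z: "conj_fam z" and q: "prime q" "card G < q" and g: "g \<in> G"
  shows "[(\<Sum>xs | set xs \<subseteq> X \<and> length xs = q. if fold z xs = g then 1 else 0)
    = (\<Sum>i\<in>X. if z i ^^ q = g then 1 else 0)] (mod int q)"
proof -
  define C where "C = (\<lambda>h. h \<circ> g \<circ> inv' h) ` G"
  let ?L = "{xs. set xs \<subseteq> X \<and> length xs = q}"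
  let ?N = "\<lambda>c. \<Sum>xs\<in>?L. if fold z xs = c then 1 else (0::int)"
  let ?N' = "\<lambda>c. \<Sum>i\<in>X. if z i ^^ q = c then 1 else (0::int)"
  have finC: "finite C" unfolding C_def using finG by simp
  have conjC: "k \<circ> c \<circ> inv' k \<in> C \<longleftrightarrow> c \<in> C" if k: "k \<in> G" for k c
  proof -
    have *: "k \<circ> c \<circ> inv' k \<in> C" if c: "c \<in> C" and k: "k \<in> G" for k c
    proof -
      obtain h where h: "h \<in> G" "c = h \<circ> g \<circ> inv' h" using c unfolding C_def by blast
      have "inv' (k \<circ> h) = inv' h \<circ> inv' k"
        using permutes_bij[OF perm[OF k]] permutes_bij[OF perm[OF h(1)]] by (rule o_inv_distrib)
      then have "k \<circ> c \<circ> inv' k = (k \<circ> h) \<circ> g \<circ> inv' (k \<circ> h)" using h by (simp add: comp_assoc)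
      then show ?thesis unfolding C_def using comp_mem[OF k h(1)] by blast
    qed
    have "inv' (inv' k) = k" using k perm permutes_inv_inv by blast
    then have "inv' k \<circ> (k \<circ> c \<circ> inv' k) \<circ> inv' (inv' k) = c" using k by (simp add: fun_eq_iff)
    then show ?thesis using *[of c k] *[of "k \<circ> c \<circ> inv' k" "inv' k"] k inv_mem by auto
  qed
  have NC: "?N c = ?N g" if c: "c \<in> C" for c
  proof -
    obtain h where h: "h \<in> G" "c = h \<circ> g \<circ> inv' h" using c unfolding C_def by blast
    have "bij_betw (map h) ?L ?L"
    proof (rule bij_betw_byWitness[where f' = "map (inv' h)"])
    qed (use h(1) inv_mem mem_X in \<open>auto simp: map_idI subset_iff\<close>)
    then have "?N c = (\<Sum>xs\<in>?L. if fold z (map h xs) = c then 1 else 0)"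
      by (rule sum.reindex_bij_betw[symmetric])
    also have "\<dots> = ?N g"
    proof (rule sum.cong)
      fix xs assume xs: "xs \<in> ?L"
      have "fold z (map h xs) = c \<longleftrightarrow> fold z xs = g"
      proof
        assume "fold z (map h xs) = c"
        then have "h \<circ> fold z xs \<circ> inv' h = h \<circ> g \<circ> inv' h" using fold_conj[OF z h(1)] xs h(2) by simp
        then have "inv' h \<circ> (h \<circ> fold z xs \<circ> inv' h) \<circ> h = inv' h \<circ> (h \<circ> g \<circ> inv' h) \<circ> h" by simp
        then show "fold z xs = g" using h(1) by (simp add: fun_eq_iff)
      qed (use fold_conj[OF z h(1)] xs h(2) in simp)
      then show "(if fold z (map h xs) = c then 1 else 0) = (if fold z xs = g then 1 else (0::int))" by simp
    qed simp
    finally show ?thesis .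
  qed
  have N'C: "?N' c = ?N' g" if c: "c \<in> C" for c
  proof -
    obtain h where h: "h \<in> G" "c = h \<circ> g \<circ> inv' h" using c unfolding C_def by blast
    have "?N' c = (\<Sum>i\<in>X. if z (h i) ^^ q = c then 1 else 0)"
      by (rule sum_reindex_G[OF h(1), symmetric])
    also have "\<dots> = ?N' g"
    proof (rule sum.cong)
      fix i assume i: "i \<in> X"
      have e: "h \<circ> z i ^^ q = z (h i) ^^ q \<circ> h"
        using conj_fam_comp[OF conj_fam_funpow[OF z] h(1) i] .
      have "z (h i) ^^ q = c \<longleftrightarrow> z i ^^ q = g"
      proof
        assume "z (h i) ^^ q = c"
        then have "h \<circ> z i ^^ q = h \<circ> g" using e h by (simp add: comp_assoc)
        then show "z i ^^ q = g" using inj_G[OF h(1)] by (simp add: fun_eq_iff)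
      next
        assume "z i ^^ q = g"
        then have "h \<circ> g \<circ> inv' h = z (h i) ^^ q \<circ> h \<circ> inv' h" using e by simp
        then show "z (h i) ^^ q = c" using h by (simp add: comp_assoc)
      qed
      then show "(if z (h i) ^^ q = c then 1 else 0) = (if z i ^^ q = g then 1 else (0::int))" by simp
    qed simp
    finally show ?thesis .
  qed
  define w where "w xs = (if fold z xs \<in> C then 1 else (0::int))" for xs
  have "[(\<Sum>xs\<in>?L. w xs) = (\<Sum>i\<in>X. w (replicate q i))] (mod int q)"
  proof (rule sum_lists_cong_constant[OF q(1) finX])
    fix xs assume xs: "set xs \<subseteq> X" "length xs = q"
    then obtain y ys where y: "xs = y # ys" using q(1) prime_gt_0_nat by (cases xs) auto
    then have yG: "z y \<in> G" using xs conj_fam_mem[OF z] by auto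
    have "fold z (rotate1 xs) = z y \<circ> fold z xs \<circ> inv' (z y)"
      using yG by (simp add: y fun_eq_iff)
    then show "w (rotate1 xs) = w xs" unfolding w_def using conjC[OF yG] by simp
  qed
  moreover have "(\<Sum>xs\<in>?L. w xs) = (\<Sum>c\<in>C. ?N c)"
    unfolding w_def using finC by (subst sum.swap) (simp add: sum.delta)
  moreover have "fold z (replicate n i) = z i ^^ n" for n i
    by (induction n) (auto simp: funpow_swap1 fun_eq_iff)
  then have "(\<Sum>i\<in>X. w (replicate q i)) = (\<Sum>c\<in>C. ?N' c)"
    unfolding w_def using finC by (subst sum.swap) (simp add: sum.delta)
  moreover have "(\<Sum>c\<in>C. ?N c) = int (card C) * ?N g" "(\<Sum>c\<in>C. ?N' c) = int (card C) * ?N' g"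
    using NC N'C by simp_all
  ultimately have "[int (card C) * ?N g = int (card C) * ?N' g] (mod int q)" by simp
  moreover have "card C \<le> card G" unfolding C_def using card_image_le finG by blast
  moreover have "C \<noteq> {}" unfolding C_def using g by blast
  ultimately show ?thesis
  proof -
    assume a: "[int (card C) * ?N g = int (card C) * ?N' g] (mod int q)" "card C \<le> card G" "C \<noteq> {}"
    have "0 < card C" using a(3) finC by (simp add: card_gt_0_iff)
    then have "\<not> q dvd card C" using a(2) q(2) by (intro nat_dvd_not_less) auto
    then have "coprime (int (card C)) (int q)" 
      using q(1) prime_imp_coprime coprime_commute coprime_int_iff by metis
    then show ?thesis using a(1) cong_mult_lcancel by blast
  qed
qed

text \<open>The coefficient congruence summed over all \<open>g\<close> with
  \<open>g j = k\<close>.\<close>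

lemma mpow_cmat_prime:
  assumes z: "conj_fam z" and q: "prime q" "card G < q" and jk: "j \<in> X" "k \<in> X"
  shows "[mpow X (cmat z) q j k = cmat (\<lambda>i. z i ^^ q) j k] (mod int q)"
proof -
  let ?L = "{xs. set xs \<subseteq> X \<and> length xs = q}"
  have "mpow X (cmat z) q j k = (\<Sum>xs\<in>?L. if fold z xs j = k then 1 else 0)"
    by (rule mpow_cmat[OF z jk(1)])
  also have "\<dots> = (\<Sum>xs\<in>?L. \<Sum>g | g \<in> G \<and> g j = k. if fold z xs = g then 1 else 0)"
    using fold_mem[OF z] finG by (intro sum.cong) (auto simp: sum.delta)
  also have "\<dots> = (\<Sum>g | g \<in> G \<and> g j = k. \<Sum>xs\<in>?L. if fold z xs = g then 1 else 0)"
    by (rule sum.swap)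
  finally have 1: "mpow X (cmat z) q j k = \<dots>" .
  have "cmat (\<lambda>i. z i ^^ q) j k = (\<Sum>i\<in>X. if (z i ^^ q) j = k then 1 else 0)"
    unfolding cmat_def using finX by (simp add: sum.If_cases Int_def)
  also have "\<dots> = (\<Sum>i\<in>X. \<Sum>g | g \<in> G \<and> g j = k. if z i ^^ q = g then 1 else 0)"
    using funpow_mem conj_fam_mem[OF z] finG by (intro sum.cong) (auto simp: sum.delta)
  also have "\<dots> = (\<Sum>g | g \<in> G \<and> g j = k. \<Sum>i\<in>X. if z i ^^ q = g then 1 else 0)"
    by (rule sum.swap)
  finally have 2: "cmat (\<lambda>i. z i ^^ q) j k = \<dots>" .
  show ?thesis unfolding 1 2 using card_fold_eq_cong[OF z q] by (intro cong_sum) auto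
qed

text \<open>The product of \<open>A\<close> with a permutation matrix of \<open>b\<close>. For
  invariant \<open>A\<close> the two factors commute, so powers of the product split, and
  \<open>trace_mpow_prime\<close> applies to the product.\<close>

definition twist :: "('a \<Rightarrow> 'a) \<Rightarrow> ('a \<Rightarrow> 'a \<Rightarrow> int) \<Rightarrow> 'a \<Rightarrow> 'a \<Rightarrow> int"
  where "twist b A j k = A j (b k)"

lemma mpow_twist:
  assumes A: "ginv A" and b: "b \<in> G" and "j \<in> X" "k \<in> X"
  shows "mpow X (twist b A) n j k = mpow X A n j ((b ^^ n) k)"
  using assms(3,4)
proof (induction n arbitrary: j k)
  case (Suc n)
  have "mpow X (twist b A) (Suc n) j k = (\<Sum>l\<in>X. A j (b l) * mpow X A n l ((b ^^ n) k))"
    unfolding mpow.simps mmul_def using Suc.IH Suc.prems(2)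
    by (intro sum.cong refl) (simp add: twist_def[of b A j])
  also have "\<dots> = (\<Sum>l\<in>X. A j (b l) * mpow X A n (b l) ((b ^^ Suc n) k))"
  proof (intro sum.cong refl)
    fix l assume "l \<in> X"
    then show "A j (b l) * mpow X A n l ((b ^^ n) k) = A j (b l) * mpow X A n (b l) ((b ^^ Suc n) k)"
      using ginvD[OF ginv_mpow[OF A] b, of l "(b ^^ n) k"] mem_X[OF funpow_mem[OF b]] Suc.prems by simp
  qed
  also have "\<dots> = mpow X A (Suc n) j ((b ^^ Suc n) k)"
    unfolding mpow.simps mmul_def using sum_reindex_G[OF b, of "\<lambda>l. A j l * mpow X A n l ((b ^^ Suc n) k)"] by simp
  finally show ?case .
qed simp

text \<open>This replaces Galois conjugation of the eigenvalues of \<^term>\<open>cmat z\<close>: raising to the power of a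
  prime \<open>q\<close> exceeding all the numbers involved is the Frobenius map modulo \<open>q\<close>, and on traces a
  congruence modulo \<open>q\<close> is then an equality.\<close>

lemma twisted_trace_prime_step:
  assumes z: "conj_fam z" and q: "prime q" "card G < q" "card X ^ Suc n < q" and b: "b \<in> G"
  shows "(\<Sum>j\<in>X. mpow X (cmat z) n j (b j)) = (\<Sum>j\<in>X. mpow X (cmat (\<lambda>i. z i ^^ q)) n j ((b ^^ q) j))"
    (is "?l = ?r")
proof -
  have z': "conj_fam (\<lambda>i. z i ^^ q)" by (rule conj_fam_funpow[OF z])
  have bX: "(b ^^ m) j \<in> X" if "j \<in> X" for m j using funpow_mem[OF b] mem_X that by blast
  have "[mtrace X (mpow X (twist b (mpow X (cmat z) n)) q) = mtrace X (twist b (mpow X (cmat z) n))] (mod int q)"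
    by (rule trace_mpow_prime[OF q(1) finX])
  moreover have "mtrace X (twist b (mpow X (cmat z) n)) = ?l"
    unfolding mtrace_def twist_def ..
  moreover have "mtrace X (mpow X (twist b (mpow X (cmat z) n)) q)
      = (\<Sum>j\<in>X. mpow X (mpow X (cmat z) n) q j ((b ^^ q) j))"
    unfolding mtrace_def using mpow_twist[OF ginv_mpow[OF ginv_cmat[OF z]] b]
    by (intro sum.cong) auto
  moreover have "\<dots> = (\<Sum>j\<in>X. mpow X (mpow X (cmat z) q) n j ((b ^^ q) j))"
    using mpow_mult[OF finX, of _ _ "cmat z" n q] mpow_mult[OF finX, of _ _ "cmat z" q n] bX
    by (intro sum.cong) (auto simp: mult.commute)
  moreover have "[\<dots> = ?r] (mod int q)"
    using mpow_cmat_prime[OF z q(1,2)] bX by (intro cong_sum mpow_cong_mod) auto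
  ultimately have c: "[?l = ?r] (mod int q)" by (metis cong_sym cong_trans)
  \<comment> \<open>Entries count words of length \<open>n\<close> over \<open>X\<close>. Both
    traces therefore lie below \<open>q\<close>, where congruent numbers are equal.\<close>
  have bd: "0 \<le> mpow X (cmat y) n j k \<and> mpow X (cmat y) n j k \<le> int (card X ^ n)"
    if "conj_fam y" "j \<in> X" for y j k
  proof -
    have "(\<Sum>xs | set xs \<subseteq> X \<and> length xs = n. if fold y xs j = k then 1 else 0)
        \<le> (\<Sum>xs | set xs \<subseteq> X \<and> length xs = n. 1 :: int)"
      by (intro sum_mono) auto
    then show ?thesis
      unfolding mpow_cmat[OF that] using card_lists_length_eq[OF finX, of n] by (auto intro: sum_nonneg)
  qed
  have bd2: "0 \<le> (\<Sum>j\<in>X. mpow X (cmat y) n j (h j)) \<and> (\<Sum>j\<in>X. mpow X (cmat y) n j (h j)) < int q"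
    if "conj_fam y" for y h
  proof -
    have "(\<Sum>j\<in>X. mpow X (cmat y) n j (h j)) \<le> (\<Sum>j\<in>X. int (card X ^ n))"
      using bd[OF that] by (intro sum_mono) auto
    also have "\<dots> = int (card X ^ Suc n)" by simp
    also have "\<dots> < int q" using q(3) by (rule of_nat_less_iff[THEN iffD2])
    finally show ?thesis using bd[OF that] by (auto intro: sum_nonneg)
  qed
  show ?thesis using c bd2[OF z] bd2[OF z'] by (simp add: cong_def)
qed

text \<open>Choose \<open>t\<close> to be \<open>1\<close> modulo the exponent \<open>m\<close> and
  \<open>x\<close> modulo \<open>p\<close>: then \<open>z i ^^ t = z i\<close> and
  \<open>b ^^ t = b ^^ x\<close>. The prime step is applied once for each prime factor of
  \<open>t\<close>, raising the family and \<open>b\<close> to the same power each time.\<close>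

lemma twisted_trace_const:
  assumes z: "conj_fam z" and p: "prime p" and b: "b \<in> G" "b ^^ p = id"
    and m: "m > 0" "coprime m p" "\<And>i. i \<in> X \<Longrightarrow> z i ^^ m = id" and x: "\<not> p dvd x"
  shows "(\<Sum>j\<in>X. mpow X (cmat z) n j ((b ^^ x) j)) = (\<Sum>j\<in>X. mpow X (cmat z) n j (b j))"
proof -
  define B where "B = max (card G) (card X ^ Suc n)"
  obtain t where t: "t > 0" "[t = 1] (mod m)" "[t = x] (mod p)" "\<And>q. prime q \<Longrightarrow> q dvd t \<Longrightarrow> q > B"
    using residue_with_large_prime_factors[OF p m(2) x] by metis
  define P where "P s \<longleftrightarrow> (\<Sum>j\<in>X. mpow X (cmat (\<lambda>i. z i ^^ s)) n j ((b ^^ s) j))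
      = (\<Sum>j\<in>X. mpow X (cmat z) n j (b j))" for s
  have "P t"
  proof (rule prime_mult_induct[of P B t])
    show "P 1" by (simp add: P_def)
    fix s q assume s: "P s" "prime q" "B < q"
    then show "P (s * q)"
      using twisted_trace_prime_step[OF conj_fam_funpow[OF z, of s] s(2) _ _ funpow_mem[OF b(1), of s], of n]
      unfolding P_def B_def by (simp add: funpow_mult mult.commute)
  qed (use t in auto)
  moreover have "b ^^ t = b ^^ x"
    using funpow_mod_id[of p b _ t] funpow_mod_id[of p b _ x] b(2) t(3) by (auto simp: cong_def fun_eq_iff)
  moreover have "z i ^^ t = z i" if "i \<in> X" for i
  proof -
    have "(z i ^^ t) j = (z i ^^ 1) j" for j
      using funpow_mod_id[of m "z i" j t] funpow_mod_id[of m "z i" j 1] m(3)[OF that] t(2)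
      by (simp add: cong_def)
    then show ?thesis by (simp add: fun_eq_iff)
  qed
  then have "cmat (\<lambda>i. z i ^^ t) = cmat z" unfolding cmat_def by (auto simp: fun_eq_iff intro!: arg_cong[of _ _ card])
  ultimately show ?thesis by (simp add: P_def)
qed

end

section \<open>Elements of prime order with fixed points\<close>

lemma dvd_two_times_prime:
  fixes d p :: nat
  assumes "prime p" "d dvd 2 * p"
  shows "d = 1 \<or> d = 2 \<or> d = p \<or> d = 2 * p"
proof -
  have two: "e = 1 \<or> e = 2" if "e dvd 2" for e :: nat
    using that dvd_imp_le[OF that] by (cases "e = 0") auto
  show ?thesis
  proof (cases "p dvd d")
    case True
    then obtain e where e: "d = p * e" by blast
    then have "e dvd 2" using assms prime_gt_0_nat[OF assms(1)] by (simp add: mult.commute)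
    then show ?thesis using two e by auto
  next
    case False
    then have "coprime d p" using assms(1) prime_imp_coprime coprime_commute by blast
    then have "d dvd 2" using assms(2) coprime_dvd_mult_left_iff by blast
    then show ?thesis using two by auto
  qed
qed

lemma multiple_less_double:
  fixes n p :: nat
  assumes "p dvd n" "n < 2 * p" "n \<noteq> 0"
  shows "n = p"
proof -
  obtain e where e: "n = p * e" using assms(1) by blast
  then have "e < 2" using assms(2) by (simp add: mult.commute)
  then show ?thesis using e assms(3) by (auto simp: less_2_cases_iff)
qed

context perm_group
begin

definition fixing_fam :: "('a \<Rightarrow> 'a \<Rightarrow> 'a) \<Rightarrow> bool"
  where "fixing_fam z \<longleftrightarrow> conj_fam z \<and> (\<forall>i\<in>X. z i i = i)"

lemma funpow_comm:
  assumes "\<And>j. w (c j) = c (w j)" shows "w ((c ^^ k) j) = (c ^^ k) (w j)"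
  by (induction k) (auto simp: assms)

lemma inj_orbit:
  assumes c: "c \<in> G" "c ^^ q = id" and q: "prime q" and x: "c x \<noteq> x"
  shows "inj_on (\<lambda>k. (c ^^ k) x) {..<q}"
proof (rule linorder_inj_onI')
  fix i j assume ij: "i \<in> {..<q}" "j \<in> {..<q}" "i < j"
  show "(c ^^ i) x \<noteq> (c ^^ j) x"
  proof
    assume "(c ^^ i) x = (c ^^ j) x"
    also have "(c ^^ j) x = (c ^^ i) ((c ^^ (j - i)) x)"
      using ij(3) by (metis comp_apply funpow_add le_add_diff_inverse less_imp_le)
    finally have "(c ^^ (j - i)) x = x" using inj_G[OF funpow_mem[OF c(1)]] by metis
    moreover have "\<not> q dvd j - i" using ij by (intro nat_dvd_not_less) auto
    then have "coprime (j - i) q" using q prime_imp_coprime coprime_commute by blast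
    ultimately show False using funpow_coprime_fixed[of q c x "j - i"] c(2) x by auto
  qed
qed

lemma funpow_p_mod: "c ^^ q = id \<Longrightarrow> c ^^ k = c ^^ (k mod q)"
  using funpow_mod_id[of q c] by (auto simp: fun_eq_iff)

end

text \<open>\<open>no_split\<close> is what transitivity of the derived subgroup provides: if every
  element kept \<open>S\<close> or swapped it with its complement, all commutators would keep
  \<open>S\<close>.\<close>

locale deg2p = perm_group +
  fixes p :: nat
  assumes p: "prime p" "p > 5"
    and cardX: "card X = 2 * p"
    and transitive: "x \<in> X \<Longrightarrow> y \<in> X \<Longrightarrow> \<exists>g\<in>G. g x = y"
    and no_split: "S \<subseteq> X \<Longrightarrow> S \<noteq> {} \<Longrightarrow> S \<noteq> X \<Longrightarrow> (\<And>g. g \<in> G \<Longrightarrow> g ` S = S \<or> g ` S = X - S) \<Longrightarrow> False"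
begin

lemma p_pos: "p > 0" using p by simp

text \<open>The classes are blocks of equal size, which divides \<open>2 * p\<close>. Blocks of size
  \<open>p\<close> would come as a complementary pair, which \<open>no_split\<close>
  forbids.\<close>

lemma class_card:
  assumes refl: "\<And>j. j \<in> X \<Longrightarrow> R j j"
    and sym: "\<And>j k. j \<in> X \<Longrightarrow> k \<in> X \<Longrightarrow> R j k \<Longrightarrow> R k j"
    and trans: "\<And>j k l. j \<in> X \<Longrightarrow> k \<in> X \<Longrightarrow> l \<in> X \<Longrightarrow> R j k \<Longrightarrow> R k l \<Longrightarrow> R j l"
    and R_inv: "\<And>g j k. g \<in> G \<Longrightarrow> j \<in> X \<Longrightarrow> k \<in> X \<Longrightarrow> R j k \<Longrightarrow> R (g j) (g k)"
  shows "(\<forall>j\<in>X. card {k \<in> X. R j k} = 1) \<or> (\<forall>j\<in>X. card {k \<in> X. R j k} = 2) \<or> (\<forall>j\<in>X. \<forall>k\<in>X. R j k)"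
proof -
  define cl where "cl j = {k \<in> X. R j k}" for j
  have cl_img: "g ` cl j = cl (g j)" if "g \<in> G" "j \<in> X" for g j
  proof
    show "g ` cl j \<subseteq> cl (g j)" unfolding cl_def using R_inv that mem_X by auto
    show "cl (g j) \<subseteq> g ` cl j"
    proof
      fix k assume "k \<in> cl (g j)"
      then have k: "k \<in> X" "R (g j) k" unfolding cl_def by auto
      have "inv' g k \<in> cl j" unfolding cl_def
        using R_inv[of "inv' g" "g j" k] that k inv_mem mem_X by auto
      moreover have "k = g (inv' g k)" using that by simp
      ultimately show "k \<in> g ` cl j" by blast
    qed
  qed
  have cards: "card (cl j) = card (cl k)" if jk: "j \<in> X" "k \<in> X" for j k
  proof -
    obtain g where g: "g \<in> G" "g j = k" using transitive jk by blast
    then have "cl k = g ` cl j" using cl_img jk by auto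
    moreover have "inj_on g (cl j)" using inj_G[OF g(1)] by (auto intro: inj_onI)
    ultimately show ?thesis using card_image by metis
  qed
  obtain x where x: "x \<in> X" using cardX p_pos by fastforce
  define r where "r = {(j, k). j \<in> X \<and> k \<in> X \<and> R j k}"
  have "equiv X r"
    unfolding equiv_def refl_on_def sym_def trans_def r_def using refl sym trans by blast
  moreover have "r `` {j} = cl j" if "j \<in> X" for j using that by (auto simp: r_def cl_def)
  then have "\<forall>C\<in>X // r. card (cl x) dvd card C"
    using cards[OF x] by (auto simp: quotient_def)
  ultimately have "card (cl x) dvd 2 * p" using equiv_imp_dvd_card[OF finX] cardX by metis
  then consider "card (cl x) = 1" | "card (cl x) = 2" | "card (cl x) = p" | "card (cl x) = 2 * p"
    using dvd_two_times_prime[OF p(1)] by blast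
  then show ?thesis
  proof cases
    case 3
    have "g ` cl x = cl x \<or> g ` cl x = X - cl x" if g: "g \<in> G" for g
    proof (cases "R x (g x)")
      case True
      then have "cl (g x) = cl x" unfolding cl_def using x g mem_X sym trans by blast
      then show ?thesis using cl_img[OF g x] by simp
    next
      case False
      then have "cl (g x) \<inter> cl x = {}" unfolding cl_def using x g mem_X sym trans by blast
      then have "card (cl (g x) \<union> cl x) = 2 * p"
        using cards[OF x mem_X[OF g x]] 3 finX card_Un_disjoint[of "cl (g x)" "cl x"]
        by (simp add: cl_def)
      then have "cl (g x) \<union> cl x = X" using cardX finX
        by (intro card_subset_eq) (auto simp: cl_def)
      then show ?thesis using cl_img[OF g x] \<open>cl (g x) \<inter> cl x = {}\<close> by auto
    qed
    moreover have "cl x \<subseteq> X" unfolding cl_def by blast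
    moreover have "cl x \<noteq> {}" using x refl unfolding cl_def by blast
    moreover have "card (cl x) \<noteq> card X" using 3 p_pos cardX by linarith
    then have "cl x \<noteq> X" by blast
    ultimately have False using no_split by blast
    then show ?thesis ..
  next
    case 4
    then have "cl x = X" using cardX finX by (intro card_subset_eq) (auto simp: cl_def)
    then have Rx: "R x k" if "k \<in> X" for k using that unfolding cl_def by blast
    have "R j k" if "j \<in> X" "k \<in> X" for j k
      using trans[OF that(1) x that(2) sym[OF x that(1) Rx[OF that(1)]] Rx[OF that(2)]] .
    then show ?thesis by blast
  next
    case 1
    then have "card (cl j) = 1" if "j \<in> X" for j using cards[OF that x] by simp
    then show ?thesis unfolding cl_def by blast
  next
    case 2
    then have "card (cl j) = 2" if "j \<in> X" for j using cards[OF that x] by simp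
    then show ?thesis unfolding cl_def by blast
  qed
qed

text \<open>A nontrivial \<open>c\<close> of order \<open>p\<close> with a fixed point is a single
  \<open>p\<close>-cycle. If it fixes \<open>i\<close>, then \<open>z i\<close> commutes with it and
  fixes all or none of the points of its support. The union \<open>Y i\<close> of the supports of
  such cycles fixing \<open>i\<close> either has size \<open>p\<close>, which produces a split, or
  is the complement of a block. Blocks of size one make \<open>z i\<close> trivial, and blocks of
  size two make \<open>p\<close> even.\<close>

lemma no_fixed_point_order_p:
  assumes z: "fixing_fam z" and nontriv: "i0 \<in> X" "z i0 \<noteq> id"
    and c: "c \<in> G" "c ^^ p = id" "x \<in> X" "c x = x"
  shows "c = id"
proof (rule ccontr)
  assume "c \<noteq> id"
  define Cs where "Cs = {c \<in> G. c \<noteq> id \<and> c ^^ p = id \<and> (\<exists>x\<in>X. c x = x)}"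
  define mv where "mv c = {x \<in> X. c x \<noteq> x}" for c :: "'a \<Rightarrow> 'a"
  have zc: "conj_fam z" and zi: "\<And>i. i \<in> X \<Longrightarrow> z i i = i" using z unfolding fixing_fam_def by auto
  have zG: "z i \<in> G" if "i \<in> X" for i using conj_fam_mem[OF zc that] .
  have cCs: "c \<in> Cs" using c \<open>c \<noteq> id\<close> unfolding Cs_def by blast
  have mvX: "mv c \<subseteq> X" for c unfolding mv_def by blast
  then have fin: "finite (mv c)" for c using finX finite_subset by blast
  have mv_stable: "c x \<in> mv c" if "c \<in> G" "x \<in> mv c" for c x
    using that mem_X inj_G unfolding mv_def by blast
  have cardmv: "card (mv c) = p" if "c \<in> Cs" for c
  proof -
    have cG: "c \<in> G" "c ^^ p = id" "c \<noteq> id" using that unfolding Cs_def by auto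
    have "[card (mv c) = card {x \<in> mv c. c x = x}] (mod p)"
      using cG mv_stable by (intro card_cong_fixed_points p fin) auto
    moreover have "{x \<in> mv c. c x = x} = {}" unfolding mv_def by blast
    ultimately have "p dvd card (mv c)" by (simp only: card.empty cong_0_iff)
    moreover have "card (mv c) < 2 * p"
      using that psubset_card_mono[OF finX, of "mv c"] cardX unfolding Cs_def mv_def by auto
    moreover have "card (mv c) \<noteq> 0" using cG eq_id_iff[of c] fin unfolding mv_def by auto
    ultimately show ?thesis by (rule multiple_less_double)
  qed
  have orb: "\<exists>k. (c ^^ k) x = y" if "c \<in> Cs" "x \<in> mv c" "y \<in> mv c" for c x y
  proof -
    have cG: "c \<in> G" "c ^^ p = id" using that unfolding Cs_def by auto
    have "inj_on (\<lambda>k. (c ^^ k) x) {..<p}" using inj_orbit[OF cG p(1)] that(2) unfolding mv_def by blast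
    then have "card ((\<lambda>k. (c ^^ k) x) ` {..<p}) = p" using card_image by fastforce
    moreover have "(c ^^ k) x \<in> mv c" for k using that(2) mv_stable[OF cG(1)] by (induction k) auto
    ultimately have "(\<lambda>k. (c ^^ k) x) ` {..<p} = mv c"
      using cardmv[OF that(1)] fin by (intro card_subset_eq) auto
    then have "y \<in> (\<lambda>k. (c ^^ k) x) ` {..<p}" using that(3) by simp
    then show ?thesis by auto
  qed
  have comm: "z i (c j) = c (z i j)" if "c \<in> G" "i \<in> X" "c i = i" for c i j
    using conj_fam_apply[OF zc that(1,2), of j] that(3) by simp
  have fixall: "z i y = y" if "c \<in> Cs" "i \<in> X" "c i = i" "x \<in> mv c" "z i x = x" and y: "y \<in> mv c" for c i x y
  proof -
    obtain k where k: "(c ^^ k) x = y" using orb[OF _ _ y] \<open>c \<in> Cs\<close> \<open>x \<in> mv c\<close> by blast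
    have "c \<in> G" using that unfolding Cs_def by blast
    then show ?thesis using funpow_comm[of "z i" c k x] comm that k by metis
  qed
  define Y where "Y i = \<Union>(mv ` {c \<in> Cs. c i = i})" for i
  have YX: "Y i \<subseteq> X" for i unfolding Y_def using mvX by blast
  have finY: "finite (Y i)" for i using finite_subset[OF YX finX] .
  have iY: "i \<notin> Y i" for i unfolding Y_def mv_def by auto
  have conjCs: "g \<circ> c \<circ> inv' g \<in> Cs \<and> mv (g \<circ> c \<circ> inv' g) = g ` mv c" if "g \<in> G" "c \<in> Cs" for g c
  proof -
    have cG: "c \<in> G" "c ^^ p = id" "c \<noteq> id" "\<exists>x\<in>X. c x = x" using that unfolding Cs_def by auto
    have "(g \<circ> c \<circ> inv' g) ^^ k = g \<circ> c ^^ k \<circ> inv' g" for k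
      using that(1) by (induction k) (auto simp: fun_eq_iff)
    then have "(g \<circ> c \<circ> inv' g) ^^ p = id" using that(1) cG by (auto simp: fun_eq_iff)
    moreover have "g \<circ> c \<circ> inv' g \<in> G" using that(1) cG comp_mem inv_mem by blast
    moreover have "g \<circ> c \<circ> inv' g \<noteq> id"
    proof
      assume "g \<circ> c \<circ> inv' g = id"
      then have "g (c (inv' g (g j))) = g j" for j by (metis comp_apply id_apply)
      then show False using cG(3) that(1) inj_G by (auto simp: fun_eq_iff)
    qed
    moreover obtain x where "x \<in> X" "c x = x" using cG(4) by blast
    then have "(g \<circ> c \<circ> inv' g) (g x) = g x" "g x \<in> X" using that(1) mem_X by auto
    moreover have "mv (g \<circ> c \<circ> inv' g) = g ` mv c"
    proof -
      have "y \<in> mv (g \<circ> c \<circ> inv' g) \<longleftrightarrow> y \<in> g ` mv c" for y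
      proof
        assume y: "y \<in> mv (g \<circ> c \<circ> inv' g)"
        then have "inv' g y \<in> mv c" unfolding mv_def using that(1) inv_mem mem_X by auto
        moreover have "y = g (inv' g y)" using that(1) by simp
        ultimately show "y \<in> g ` mv c" by blast
      next
        assume "y \<in> g ` mv c"
        then show "y \<in> mv (g \<circ> c \<circ> inv' g)" unfolding mv_def using that(1) mem_X inj_G[OF that(1)] by auto
      qed
      then show ?thesis by blast
    qed
    ultimately show ?thesis unfolding Cs_def by blast
  qed
  have Ysub: "g ` Y i \<subseteq> Y (g i)" if "g \<in> G" "i \<in> X" for g i
  proof
    fix y assume "y \<in> g ` Y i"
    then obtain c x where c: "c \<in> Cs" "c i = i" "x \<in> mv c" "y = g x" unfolding Y_def by blast
    then have "y \<in> mv (g \<circ> c \<circ> inv' g)" "g \<circ> c \<circ> inv' g \<in> Cs" "(g \<circ> c \<circ> inv' g) (g i) = g i"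
      using conjCs[OF that(1)] that(1) by auto
    then show "y \<in> Y (g i)" unfolding Y_def by blast
  qed
  have cardY: "card (Y i) = card (Y j)" if "i \<in> X" "j \<in> X" for i j
  proof -
    have "card (Y i) \<le> card (Y j)" if ij: "i \<in> X" "j \<in> X" for i j
    proof -
      obtain g where g: "g \<in> G" "g i = j" using transitive ij by blast
      have "card (g ` Y i) = card (Y i)" using inj_G[OF g(1)] by (intro card_image) (auto intro: inj_onI)
      moreover have "card (g ` Y i) \<le> card (Y j)"
        using Ysub[OF g(1) ij(1)] g(2) by (intro card_mono finY) simp
      ultimately show ?thesis by simp
    qed
    then show ?thesis using that by (simp add: order_antisym)
  qed
  have Yne: "\<exists>c\<in>Cs. c i = i" if i: "i \<in> X" for i
  proof -
    obtain g where g: "g \<in> G" "g x = i" using transitive[OF c(3) i] by blast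
    have "g \<circ> c \<circ> inv' g \<in> Cs" using conjCs[OF g(1) cCs] by blast
    moreover have "inv' g i = x" using inv_apply(1)[OF g(1), of x] g(2) by simp
    then have "(g \<circ> c \<circ> inv' g) i = i" using g(2) c(4) by simp
    ultimately show ?thesis by blast
  qed
  have mvY: "mv c \<subseteq> Y i" if "c \<in> Cs" "c i = i" for c i using that unfolding Y_def by blast
  show False
  proof (cases "card (Y i0) = p")
    case True
    have eqY: "mv c = Y i" if "c \<in> Cs" "c i = i" "i \<in> X" for c i
      using mvY[OF that(1,2)] cardmv[OF that(1)] cardY[OF that(3) nontriv(1)] True finY
      by (intro card_subset_eq) auto
    \<comment> \<open>Two supports of size \<open>p\<close> that meet cannot cover \<open>X\<close>,
      so they miss a common point \<open>i\<close>, and both equal \<open>Y i\<close>.\<close>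
    have "g ` mv c = mv c \<or> g ` mv c = X - mv c" if g: "g \<in> G" for g
    proof -
      define c' where "c' = g \<circ> c \<circ> inv' g"
      have c': "c' \<in> Cs" "mv c' = g ` mv c" unfolding c'_def using conjCs[OF g cCs] by auto
      show ?thesis
      proof (cases "mv c' \<inter> mv c = {}")
        case True
        then have "card (mv c' \<union> mv c) = 2 * p"
          using cardmv[OF c'(1)] cardmv[OF cCs] card_Un_disjoint[OF fin fin True] by simp
        then have "mv c' \<union> mv c = X" using mvX cardX by (intro card_subset_eq finX) auto
        then show ?thesis using True unfolding c'(2)[symmetric] by blast
      next
        case False
        then have "card (mv c' \<inter> mv c) > 0" using fin by (simp add: card_gt_0_iff)
        then have "card (mv c' \<union> mv c) < 2 * p"
          using card_Un_Int[OF fin fin, of c' c] cardmv[OF c'(1)] cardmv[OF cCs] by simp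
        then have "mv c' \<union> mv c \<noteq> X" using cardX by (metis less_irrefl)
        then obtain i where i: "i \<in> X" "i \<notin> mv c'" "i \<notin> mv c" using mvX by blast
        then have "c' i = i" "c i = i" unfolding mv_def by auto
        then have "mv c' = mv c" using eqY[OF c'(1) _ i(1)] eqY[OF cCs _ i(1)] by simp
        then show ?thesis using c'(2) by simp
      qed
    qed
    moreover have "card (mv c) \<noteq> 0" "card (mv c) \<noteq> card X" using cardmv[OF cCs] cardX p_pos by linarith+
    then have "mv c \<noteq> {}" "mv c \<noteq> X" by auto
    ultimately show False using no_split[OF mvX] by blast
  next
    case False
    \<comment> \<open>Any two supports inside \<open>Y i\<close> meet, since both avoid
      \<open>i\<close>. So if \<open>z i\<close> moves one point of \<open>Y i\<close>, it moves all
      of them. On each support it is a power of the cycle, so its \<open>p\<close>-th power is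
      trivial there, and \<open>p\<close> divides \<open>card (Y i)\<close>; only the excluded size
      \<open>p\<close> remains.\<close>
    have ztriv: "z i y = y" if i: "i \<in> X" and y: "y \<in> Y i" for i y
    proof (rule ccontr)
      assume "z i y \<noteq> y"
      then obtain c0 where c0: "c0 \<in> Cs" "c0 i = i" "y \<in> mv c0" using y unfolding Y_def by blast
      then have c0m: "z i x \<noteq> x" if "x \<in> mv c0" for x
        using fixall[OF c0(1) i c0(2) that _ c0(3)] \<open>z i y \<noteq> y\<close> by blast
      have allm: "z i x \<noteq> x" if "x \<in> Y i" for x
      proof
        assume zx: "z i x = x"
        obtain c1 where c1: "c1 \<in> Cs" "c1 i = i" "x \<in> mv c1" using \<open>x \<in> Y i\<close> unfolding Y_def by blast
        have "mv c0 \<inter> mv c1 \<noteq> {}"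
        proof
          assume e: "mv c0 \<inter> mv c1 = {}"
          have "i \<notin> mv c0 \<union> mv c1" using c0 c1 unfolding mv_def by simp
          then have "mv c0 \<union> mv c1 \<subset> X" using i mvX by blast
          then have "card (mv c0 \<union> mv c1) < card X" by (intro psubset_card_mono finX)
          then show False using card_Un_disjoint[OF fin fin e] cardmv[OF c0(1)] cardmv[OF c1(1)] cardX by simp
        qed
        then obtain w where w: "w \<in> mv c0" "w \<in> mv c1" by blast
        then show False using c0m fixall[OF c1(1) i c1(2,3) zx w(2)] by blast
      qed
      have "(z i ^^ p) x = x" if x: "x \<in> Y i" for x
      proof -
        obtain c1 where c1: "c1 \<in> Cs" "c1 i = i" "x \<in> mv c1" using x unfolding Y_def by blast
        have cG: "c1 \<in> G" "c1 ^^ p = id" using c1 unfolding Cs_def by auto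
        have "z i x \<in> mv c1"
          using comm[OF cG(1) i c1(2), of x] c1(3) mem_X[OF zG[OF i], of x] inj_G[OF zG[OF i], of "c1 x" x]
          unfolding mv_def by simp
        then obtain k where k: "(c1 ^^ k) x = z i x" using orb[OF c1(1,3)] by blast
        have cm: "z i ((c1 ^^ m) y) = (c1 ^^ m) (z i y)" for m y
          using funpow_comm[of "z i" c1] comm[OF cG(1) i c1(2)] by metis
        have "(z i ^^ m) x = (c1 ^^ (k * m)) x" for m
        proof (induction m)
          case (Suc m)
          have "(z i ^^ Suc m) x = z i ((c1 ^^ (k * m)) x)" using Suc by simp
          also have "\<dots> = (c1 ^^ (k * m)) ((c1 ^^ k) x)" using cm k by metis
          also have "\<dots> = (c1 ^^ (k * Suc m)) x" by (simp add: funpow_add[symmetric, THEN fun_cong, unfolded comp_apply] add.commute)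
          finally show ?case .
        qed simp
        then show ?thesis using funpow_p_mod[OF cG(2), of "k * p"] by simp
      qed
      moreover have "z i x \<in> Y i" if "x \<in> Y i" for x
        using Ysub[OF zG[OF i] i] that zi[OF i] by auto
      ultimately have "[card (Y i) = card {x \<in> Y i. z i x = x}] (mod p)"
        by (intro card_cong_fixed_points p finY) auto
      moreover have "{x \<in> Y i. z i x = x} = {}" using allm by blast
      ultimately have "p dvd card (Y i)" by (simp only: card.empty cong_0_iff)
      moreover have "Y i \<subset> X" using YX iY i by blast
      then have "card (Y i) < 2 * p"
        using psubset_card_mono[OF finX] cardX by metis
      moreover have "card (Y i) \<noteq> 0" using y finY card_0_eq by blast
      ultimately have "card (Y i) = p" by (rule multiple_less_double)
      then show False using False cardY[OF i nontriv(1)] by simp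
    qed
    \<comment> \<open>An equivalence relation: if \<open>j\<close> is outside \<open>Y i\<close>,
      each of the cycles fixing \<open>i\<close> fixes \<open>j\<close>, so \<open>Y i\<close> is
      contained in \<open>Y j\<close>, and the sizes agree.\<close>
    define R where "R i j \<longleftrightarrow> j \<notin> Y i" for i j
    have Rimp: "Y j \<subseteq> Y i" if "i \<in> X" "j \<in> X" "R i j" for i j
    proof -
      have Rc: "c j = j" if "c \<in> Cs" "c i = i" for c
        using \<open>R i j\<close> that \<open>j \<in> X\<close> unfolding R_def Y_def mv_def by blast
      have sub: "Y i \<subseteq> Y j"
        unfolding Y_def using Rc by blast
      then have "Y i = Y j" using cardY[OF that(1,2)] by (intro card_subset_eq finY) auto
      then show ?thesis by simp
    qed
    have trichotomy: "(\<forall>j\<in>X. card {k \<in> X. R j k} = 1) \<or> (\<forall>j\<in>X. card {k \<in> X. R j k} = 2) \<or> (\<forall>j\<in>X. \<forall>k\<in>X. R j k)"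
    proof (rule class_card)
      show "R j j" for j using iY unfolding R_def by blast
      have Yeq: "Y j = Y i" if "i \<in> X" "j \<in> X" "R i j" for i j
        using Rimp[OF that] cardY[OF that(1,2)] by (intro card_subset_eq finY) auto
      show "R k j" if "j \<in> X" "k \<in> X" "R j k" for j k using Yeq[OF that] iY unfolding R_def by metis
      show "R j l" if "j \<in> X" "k \<in> X" "l \<in> X" "R j k" "R k l" for j k l
        using Yeq[OF that(1,2,4)] that(5) unfolding R_def by metis
      show "R (g j) (g k)" if g: "g \<in> G" and jk: "j \<in> X" "k \<in> X" "R j k" for g j k
      proof -
        have "g ` Y j = Y (g j)"
        proof (rule card_subset_eq[OF finY Ysub[OF g jk(1)]])
          have "card (g ` Y j) = card (Y j)" using inj_G[OF g] by (intro card_image) (auto intro: inj_onI)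
          then show "card (g ` Y j) = card (Y (g j))" using cardY[OF jk(1) mem_X[OF g jk(1)]] by simp
        qed
        then show ?thesis using jk(3) inj_G[OF g] unfolding R_def by (metis image_iff)
      qed
    qed
    have Yge: "card (Y j) \<ge> p" if j: "j \<in> X" for j
    proof -
      obtain c1 where "c1 \<in> Cs" "c1 j = j" using Yne[OF j] by blast
      then show ?thesis using mvY cardmv card_mono[OF finY] by metis
    qed
    have not1: "\<not> (\<forall>j\<in>X. card {k \<in> X. R j k} = 1)"
    proof
      assume a: "\<forall>j\<in>X. card {k \<in> X. R j k} = 1"
      have "z i0 j = j" if "j \<in> X" for j
      proof (cases "j \<in> Y i0")
        case False
        have "{k \<in> X. R i0 k} = {i0}"
        proof -
          have "i0 \<in> {k \<in> X. R i0 k}" using nontriv(1) iY unfolding R_def by blast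
          then show ?thesis using a nontriv(1) by (metis card_1_singletonE singletonD)
        qed
        then have "j = i0" using False that unfolding R_def by blast
        then show ?thesis using zi that by blast
      qed (use ztriv nontriv in blast)
      then show False using nontriv eq_id_iff[OF zG] by blast
    qed
    have "\<not> (\<forall>j\<in>X. \<forall>k\<in>X. R j k)"
    proof
      assume "\<forall>j\<in>X. \<forall>k\<in>X. R j k"
      then have "Y i0 = {}" using nontriv(1) YX unfolding R_def by blast
      then show False using Yge[OF nontriv(1)] p_pos by simp
    qed
    then have two: "\<forall>j\<in>X. card {k \<in> X. R j k} = 2" using trichotomy not1 by blast
    have closed: "R j k \<Longrightarrow> j \<in> mv c \<Longrightarrow> k \<in> X \<Longrightarrow> k \<in> mv c" for j k
    proof (rule ccontr)
      assume a: "R j k" "j \<in> mv c" "k \<in> X" "k \<notin> mv c"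
      then have "c k = k" "j \<in> X" unfolding mv_def by auto
      then have "j \<in> Y k" using cCs a(2) unfolding Y_def by blast
      moreover have "Y k \<subseteq> Y j" using Rimp a \<open>j \<in> X\<close> by blast
      ultimately show False using iY by blast
    qed
    \<comment> \<open>By \<open>closed\<close> the support is a union of classes, all of size two;
      but its size is the odd prime \<open>p\<close>.\<close>
    have "2 dvd card (mv c)"
    proof -
      define r where "r = {(j, k). j \<in> mv c \<and> k \<in> mv c \<and> R j k}"
      have Yeq: "Y j = Y i" if "i \<in> X" "j \<in> X" "R i j" for i j
        using Rimp[OF that] cardY[OF that(1,2)] by (intro card_subset_eq finY) auto
      have "equiv (mv c) r"
      proof (rule equivI)
        show "refl_on (mv c) r" unfolding refl_on_def r_def using iY R_def by auto
        show "sym r" unfolding sym_def r_def using Yeq iY mvX unfolding R_def by (metis (no_types, lifting) case_prodD case_prodI mem_Collect_eq subsetD)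
        show "trans r" unfolding trans_def r_def using Yeq mvX unfolding R_def by (metis (no_types, lifting) case_prodD case_prodI mem_Collect_eq subsetD)
      qed (auto simp: r_def)
      moreover have "r `` {j} = {k \<in> X. R j k}" if "j \<in> mv c" for j
        using that closed mvX unfolding r_def by auto
      then have "card (r `` {j}) = 2" if "j \<in> mv c" for j
        using two[rule_format, OF subsetD[OF mvX that]] that by simp
      then have "\<forall>C\<in>mv c // r. 2 dvd card C" unfolding quotient_def by fastforce
      ultimately show ?thesis using equiv_imp_dvd_card[OF fin] by blast
    qed
    then show False using cardmv[OF cCs] p primes_dvd_imp_eq[of 2 p] two_is_prime_nat by auto
  qed
qed

end

section \<open>Periodic functions and convolution\<close>

text \<open>The group ring of the integers modulo \<open>p\<close> is modelled by
  \<open>p\<close>-periodic functions on \<open>int\<close>, so that arguments can be added and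
  negated freely; \<open>conv\<close> is its product.\<close>

definition periodic :: "nat \<Rightarrow> (int \<Rightarrow> 'b) \<Rightarrow> bool"
  where "periodic p f \<longleftrightarrow> (\<forall>x. f (x mod int p) = f x)"

definition conv :: "nat \<Rightarrow> (int \<Rightarrow> int) \<Rightarrow> (int \<Rightarrow> int) \<Rightarrow> int \<Rightarrow> int"
  where "conv p f g x = (\<Sum>y\<in>{0..<int p}. f y * g (x - y))"

lemma periodic_cong: "periodic p f \<Longrightarrow> x mod int p = y mod int p \<Longrightarrow> f x = f y"
  unfolding periodic_def by metis

lemma periodicI: "(\<And>x y. x mod int p = y mod int p \<Longrightarrow> f x = f y) \<Longrightarrow> periodic p f"
  unfolding periodic_def by (blast intro: mod_mod_trivial)

lemma periodic_compose:
  assumes "periodic p f" "\<And>x y. x mod int p = y mod int p \<Longrightarrow> h x mod int p = h y mod int p"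
  shows "periodic p (\<lambda>x. f (h x))"
  by (rule periodicI) (rule periodic_cong[OF assms(1) assms(2)])

lemma periodic_sub: "periodic p f \<Longrightarrow> periodic p (\<lambda>y. f (x - y))"
  by (erule periodic_compose) (rule mod_diff_cong[OF refl])

lemma sum_reflect:
  assumes "p > 0" "periodic p f"
  shows "(\<Sum>y\<in>{0..<int p}. f (x - y)) = (\<Sum>y\<in>{0..<int p}. f y)"
proof -
  have twice: "(x - (x - y) mod int p) mod int p = y" if "y \<in> {0..<int p}" for y
    using that by (simp add: mod_diff_right_eq)
  have "bij_betw (\<lambda>y. (x - y) mod int p) {0..<int p} {0..<int p}"
    by (rule bij_betw_byWitness[where f' = "\<lambda>y. (x - y) mod int p"]) (use assms twice in auto)
  then have "(\<Sum>y\<in>{0..<int p}. f ((x - y) mod int p)) = (\<Sum>y\<in>{0..<int p}. f y)"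
    by (rule sum.reindex_bij_betw)
  then show ?thesis using assms(2) unfolding periodic_def by simp
qed

lemma sum_shift:
  assumes "p > 0" "periodic p f"
  shows "(\<Sum>y\<in>{0..<int p}. f (y - x)) = (\<Sum>y\<in>{0..<int p}. f y)"
proof -
  have per: "periodic p (\<lambda>y. f (- y))"
    by (rule periodic_compose[OF assms(2)]) (rule mod_minus_cong)
  have "(\<Sum>y\<in>{0..<int p}. f (y - x)) = (\<Sum>y\<in>{0..<int p}. f (- (x - y)))" by simp
  also have "\<dots> = (\<Sum>y\<in>{0..<int p}. f (- y))" by (rule sum_reflect[OF assms(1) per])
  also have "\<dots> = (\<Sum>y\<in>{0..<int p}. f y)" using sum_reflect[OF assms, of 0] by simp
  finally show ?thesis .
qed

lemma periodic_conv:
  assumes "periodic p g" shows "periodic p (conv p f g)"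
  unfolding conv_def
  by (rule periodicI, intro sum.cong refl arg_cong2[of _ _ _ _ "(*)"] periodic_cong[OF assms] mod_diff_cong)

lemma periodic_times: "periodic p f \<Longrightarrow> periodic p g \<Longrightarrow> periodic p (\<lambda>y. (f y * g y :: int))"
  unfolding periodic_def by simp

lemma conv_commute:
  assumes "p > 0" "periodic p f" "periodic p g"
  shows "conv p f g x = conv p g f x"
proof -
  have "conv p f g x = (\<Sum>y\<in>{0..<int p}. f (x - y) * g (x - (x - y)))"
    unfolding conv_def
    by (rule sum_reflect[OF assms(1) periodic_times[OF assms(2) periodic_sub[OF assms(3)]], symmetric])
  then show ?thesis unfolding conv_def by (simp add: mult.commute)
qed

lemma conv_assoc:
  assumes "p > 0" "periodic p f" "periodic p g" "periodic p h"
  shows "conv p (conv p f g) h x = conv p f (conv p g h) x"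
proof -
  have "conv p (conv p f g) h x = (\<Sum>y\<in>{0..<int p}. \<Sum>u\<in>{0..<int p}. f u * (g (y - u) * h (x - y)))"
    unfolding conv_def by (simp add: sum_distrib_right mult.assoc)
  also have "\<dots> = (\<Sum>u\<in>{0..<int p}. \<Sum>y\<in>{0..<int p}. f u * (g (y - u) * h (x - y)))"
    by (rule sum.swap)
  also have "\<dots> = (\<Sum>u\<in>{0..<int p}. f u * (\<Sum>y\<in>{0..<int p}. g (y - u) * h (x - u - (y - u))))"
    by (simp add: sum_distrib_left)
  also have "\<dots> = (\<Sum>u\<in>{0..<int p}. f u * (\<Sum>y\<in>{0..<int p}. g y * h (x - u - y)))"
    by (simp only: sum_shift[OF assms(1) periodic_times[OF assms(3) periodic_sub[OF assms(4)]]])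
  finally show ?thesis unfolding conv_def by simp
qed

lemma conv_cong:
  assumes "\<And>y. f y = f' y" "\<And>y. g y = g' y" shows "conv p f g x = conv p f' g' x"
  using assms by (simp add: conv_def)

lemma conv_add_left: "conv p (\<lambda>x. f x + g x) h x = conv p f h x + conv p g h x"
  unfolding conv_def by (simp add: distrib_right sum.distrib)

lemma conv_diff_left: "conv p (\<lambda>x. f x - g x) h x = conv p f h x - conv p g h x"
  unfolding conv_def by (simp add: left_diff_distrib sum_subtractf)

lemma conv_scale_left: "conv p (\<lambda>x. e * f x) h x = e * conv p f h x"
  unfolding conv_def by (simp add: sum_distrib_left mult.assoc)

lemma conv_scale_right: "conv p h (\<lambda>x. e * f x) x = e * conv p h f x"
  unfolding conv_def by (simp add: sum_distrib_left mult.left_commute)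

lemma conv_add_right: "conv p h (\<lambda>x. f x + g x) x = conv p h f x + conv p h g x"
  unfolding conv_def by (simp add: distrib_left sum.distrib)

text \<open>The left factor is \<open>e\<close> times the unit plus \<open>c\<close> times the sum
  of all group elements. Traces that are constant away from \<open>0\<close> have this shape, which
  makes them act almost as scalars.\<close>

lemma conv_delta_const_left:
  assumes "p > 0" "periodic p f"
  shows "conv p (\<lambda>x. e * (if int p dvd x then 1 else 0) + c) f x = e * f x + c * (\<Sum>y\<in>{0..<int p}. f y)"
proof -
  have "conv p (\<lambda>x. e * (if int p dvd x then 1 else 0) + c) f x
      = (\<Sum>y\<in>{0..<int p}. (if int p dvd y then e * f (x - y) else 0) + c * f (x - y))"
    unfolding conv_def by (intro sum.cong) (auto simp: distrib_right)
  also have "\<dots> = (\<Sum>y\<in>{0..<int p}. if int p dvd y then e * f (x - y) else 0) + c * (\<Sum>y\<in>{0..<int p}. f (x - y))"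
    by (simp add: sum.distrib sum_distrib_left)
  also have "(\<Sum>y\<in>{0..<int p}. if int p dvd y then e * f (x - y) else 0) = (\<Sum>y\<in>{0..<int p}. if y = 0 then e * f (x - y) else 0)"
    by (intro sum.cong refl) (auto dest: zdvd_imp_le)
  also have "\<dots> = e * f x" using assms(1) by (simp add: sum.delta)
  finally show ?thesis using sum_reflect[OF assms, of x] by simp
qed

lemma sum_mult_coprime:
  assumes p: "prime p" and f: "periodic p f" and x: "\<not> int p dvd x"
  shows "(\<Sum>t\<in>{0..<int p}. f (t * x)) = (\<Sum>t\<in>{0..<int p}. f t)"
proof -
  have p0: "int p > 0" using prime_gt_0_nat[OF p] by simp
  have pI: "prime (int p)" using p by simp
  have "inj_on (\<lambda>t. (t * x) mod int p) {0..<int p}"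
  proof (rule inj_onI)
    fix s t assume st: "s \<in> {0..<int p}" "t \<in> {0..<int p}" "(s * x) mod int p = (t * x) mod int p"
    then have "int p dvd (s - t) * x" by (simp add: mod_eq_dvd_iff left_diff_distrib)
    then have "int p dvd s - t" using x pI prime_dvd_mult_iff by blast
    then show "s = t" using st(1,2) by (metis atLeastLessThan_iff mod_eq_dvd_iff mod_pos_pos_trivial)
  qed
  moreover have "(\<lambda>t. (t * x) mod int p) ` {0..<int p} \<subseteq> {0..<int p}" using p0 by auto
  ultimately have "bij_betw (\<lambda>t. (t * x) mod int p) {0..<int p} {0..<int p}"
    by (simp add: bij_betw_def endo_inj_surj)
  then have "(\<Sum>t\<in>{0..<int p}. f ((t * x) mod int p)) = (\<Sum>t\<in>{0..<int p}. f t)"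
    by (rule sum.reindex_bij_betw)
  then show ?thesis using f unfolding periodic_def by simp
qed

text \<open>The product of \<open>q\<close> copies of \<open>n\<close> with \<open>w\<close>
  vanishes as well. Evaluated at \<open>q * x\<close>, the rotation argument leaves only the
  constant words, and these contribute \<open>n y * w (q * (x - y))\<close> modulo \<open>q\<close>
  by Fermat. The result is smaller than \<open>q\<close> in absolute value, hence zero.\<close>

lemma conv_zero_prime_multiplier:
  assumes p: "prime p" and w: "periodic p w" and n: "periodic p n"
    and zero: "\<And>x. conv p n w x = 0"
    and bw: "\<And>x. \<bar>w x\<bar> \<le> int B" and bn: "\<And>x. \<bar>n x\<bar> \<le> int B"
    and q: "prime q" "p * B * B < q"
  shows "conv p n (\<lambda>x. w (int q * x)) x = 0"
proof -
  let ?I = "{0..<int p}"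
  obtain m where m: "q = Suc m" using q(1) prime_gt_0_nat gr0_implies_Suc by blast
  define W where "W ys = prod_list (map n ys) * w (int q * x - sum_list ys)" for ys
  have "(\<Sum>ys | set ys \<subseteq> ?I \<and> length ys = q. W ys)
      = (\<Sum>y\<in>?I. \<Sum>ys | set ys \<subseteq> ?I \<and> length ys = m. W (y # ys))"
    unfolding m by (rule sum_lists_Suc) simp
  also have "\<dots> = (\<Sum>ys | set ys \<subseteq> ?I \<and> length ys = m. \<Sum>y\<in>?I. W (y # ys))"
    by (rule sum.swap)
  also have "\<dots> = (\<Sum>ys | set ys \<subseteq> ?I \<and> length ys = m. prod_list (map n ys) * conv p n w (int q * x - sum_list ys))"
    unfolding conv_def W_def by (intro sum.cong refl) (simp add: sum_distrib_left algebra_simps)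
  finally have "(\<Sum>ys | set ys \<subseteq> ?I \<and> length ys = q. W ys) = 0" using zero by simp
  moreover have "[(\<Sum>ys | set ys \<subseteq> ?I \<and> length ys = q. W ys) = (\<Sum>y\<in>?I. W (replicate q y))] (mod int q)"
  proof (rule sum_lists_cong_constant[OF q(1)])
    fix ys assume "set ys \<subseteq> ?I" "length ys = q"
    then obtain y zs where "ys = y # zs" using m by (cases ys) auto
    then show "W (rotate1 ys) = W ys" by (simp add: W_def algebra_simps)
  qed simp
  moreover have "W (replicate q y) = n y ^ q * w (int q * (x - y))" for y
    unfolding W_def by (simp add: sum_list_replicate prod_list_replicate algebra_simps)
  moreover have "[(\<Sum>y\<in>?I. n y ^ q * w (int q * (x - y))) = conv p n (\<lambda>x. w (int q * x)) x] (mod int q)"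
    unfolding conv_def by (intro cong_sum cong_mult fermat_int[OF q(1)]) simp
  ultimately have "[conv p n (\<lambda>x. w (int q * x)) x = 0] (mod int q)"
    by (metis (no_types, lifting) cong_sym cong_trans sum.cong)
  then have "int q dvd conv p n (\<lambda>x. w (int q * x)) x" by (simp add: cong_0_iff)
  moreover have "\<bar>conv p n (\<lambda>x. w (int q * x)) x\<bar> < int q"
  proof -
    have "\<bar>conv p n (\<lambda>x. w (int q * x)) x\<bar> \<le> (\<Sum>y\<in>?I. \<bar>n y * w (int q * (x - y))\<bar>)"
      unfolding conv_def by (rule sum_abs)
    also have "\<dots> \<le> (\<Sum>y\<in>?I. int B * int B)"
      unfolding abs_mult using bw bn by (intro sum_mono mult_mono) auto
    also have "\<dots> = int (p * B * B)" by simp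
    also have "\<dots> < int q" using q(2) by (rule of_nat_less_iff[THEN iffD2])
    finally show ?thesis .
  qed
  ultimately show ?thesis using zdvd_not_zless[of "\<bar>conv p n (\<lambda>x. w (int q * x)) x\<bar>" "int q"] by auto
qed

text \<open>An elementary substitute for the irreducibility of the \<open>p\<close>-th cyclotomic polynomial.\<close>

lemma conv_zero_imp_constant:
  assumes p: "prime p" and w: "periodic p w" and n: "periodic p n"
    and zero: "\<And>x. conv p n w x = 0" and nc: "n u \<noteq> n v"
  shows "w x = w y"
proof -
  let ?I = "{0..<int p}"
  have p0: "p > 0" using prime_gt_0_nat[OF p] .
  have bd: "\<bar>f x\<bar> \<le> (\<Sum>y\<in>?I. \<bar>f y\<bar>)" if "periodic p f" for f :: "int \<Rightarrow> int" and x
  proof -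
    have "\<bar>f (x mod int p)\<bar> \<le> (\<Sum>y\<in>?I. \<bar>f y\<bar>)" using p0 by (intro member_le_sum) auto
    then show ?thesis using that unfolding periodic_def by simp
  qed
  \<comment> \<open>The value at \<open>0\<close> is enough: translates of \<open>w\<close> are
    annihilated by \<open>n\<close> as well.\<close>
  have key: "int p * w' 0 = (\<Sum>y\<in>?I. w' y)"
    if w': "periodic p w'" and zero': "\<And>x. conv p n w' x = 0" for w'
  proof -
    define B where "B = nat (max (\<Sum>y\<in>?I. \<bar>w' y\<bar>) (\<Sum>y\<in>?I. \<bar>n y\<bar>))"
    have bw: "\<bar>w' x\<bar> \<le> int B" and bn: "\<bar>n x\<bar> \<le> int B" for x
      unfolding B_def using bd[OF w', of x] bd[OF n, of x] by auto
    have per: "periodic p (\<lambda>x. w' (int s * x))" for s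
      by (rule periodic_compose[OF w']) (rule mod_mult_cong[OF refl])
    have mult: "conv p n (\<lambda>x. w' (t * x)) x = 0" if t: "t \<in> ?I - {0}" for t x
    proof -
      have nt: "\<not> p dvd nat t" using t by (intro nat_dvd_not_less) auto
      obtain s where s: "s > 0" "[s = nat t] (mod p)" "\<And>q. prime q \<Longrightarrow> q dvd s \<Longrightarrow> q > p * B * B"
        using residue_with_large_prime_factors[OF p _ nt, of 1 "p * B * B"] by auto
      have "\<forall>x. conv p n (\<lambda>x. w' (int s * x)) x = 0"
      proof (rule prime_mult_induct[where B = "p * B * B"])
        fix r q assume r: "\<forall>x. conv p n (\<lambda>x. w' (int r * x)) x = 0" "prime q" "p * B * B < q"
        show "\<forall>x. conv p n (\<lambda>x. w' (int (r * q) * x)) x = 0"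
          using conv_zero_prime_multiplier[OF p per[of r] n _ bw bn r(2,3)] r(1)
          by (simp add: mult.assoc)
      qed (use zero' s in auto)
      moreover have "w' (int s * x) = w' (t * x)" for x
      proof (rule periodic_cong[OF w'])
        have "int s mod int p = t mod int p"
          using s(2) t unfolding cong_int_iff[symmetric] cong_def by simp
        then show "int s * x mod int p = t * x mod int p" by (rule mod_mult_cong[OF _ refl])
      qed
      ultimately show ?thesis by simp
    qed
    \<comment> \<open>Summing over all nonzero multipliers leaves a multiple of the unit plus a
      constant. As \<open>n\<close> is not constant, annihilating it forces the multiple to be
      zero.\<close>
    define W where "W x = (\<Sum>t\<in>?I - {0}. w' (t * x))" for x
    let ?S = "\<Sum>y\<in>?I. w' y"
    have "W x = (int p * w' 0 - ?S) * (if int p dvd x then 1 else 0) + (?S - w' 0)" for x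
    proof (cases "int p dvd x")
      case True
      then have "w' (t * x) = w' 0" for t by (intro periodic_cong[OF w']) auto
      then have "W x = int (card (?I - {0})) * w' 0" unfolding W_def by simp
      also have "card (?I - {0}) = p - 1" using p0 by (simp add: card_Diff_subset)
      finally show ?thesis using True p0 by (simp add: of_nat_diff algebra_simps)
    next
      case False
      have "W x = (\<Sum>t\<in>?I. w' (t * x)) - w' 0"
        unfolding W_def using p0 by (simp add: sum_diff1)
      then show ?thesis using False sum_mult_coprime[OF p w' False] by simp
    qed
    then have W: "W = (\<lambda>x. (int p * w' 0 - ?S) * (if int p dvd x then 1 else 0) + (?S - w' 0))" by blast
    have perW: "periodic p W"
      unfolding W by (rule periodicI) (simp add: dvd_eq_mod_eq_0)
    have "conv p n W x = (\<Sum>t\<in>?I - {0}. conv p n (\<lambda>x. w' (t * x)) x)" for x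
      unfolding conv_def W_def by (subst sum.swap) (simp add: sum_distrib_left)
    then have "conv p W n x = 0" for x using mult conv_commute[OF p0 perW n] by simp
    then have "(int p * w' 0 - ?S) * n x + (?S - w' 0) * (\<Sum>y\<in>?I. n y) = 0" for x
      unfolding W conv_delta_const_left[OF p0 n] .
    from this[of u] this[of v] have "(int p * w' 0 - ?S) * (n u - n v) = 0" by (simp add: algebra_simps)
    then show ?thesis using nc by simp
  qed
  have "int p * w x = (\<Sum>y\<in>?I. w y)" for x
  proof -
    have per: "periodic p (\<lambda>y. w (y + x))" by (rule periodic_compose[OF w]) (rule mod_add_cong[OF _ refl])
    moreover have "conv p n (\<lambda>y. w (y + x)) u = conv p n w (u + x)" for u
      unfolding conv_def by (simp add: algebra_simps)
    ultimately have "int p * w (0 + x) = (\<Sum>y\<in>?I. w (y + x))"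
      using key[of "\<lambda>y. w (y + x)"] zero by simp
    then show ?thesis using sum_shift[OF p0 w, of "- x"] by simp
  qed
  then have "int p * w x = int p * w y" by simp
  then show ?thesis using p0 by simp
qed

section \<open>The two orbits of an element of prime order\<close>

context perm_group
begin

lemma foldr_mem: "set gs \<subseteq> G \<Longrightarrow> foldr (\<circ>) gs id \<in> G"
  by (induction gs) (simp_all add: id_mem comp_mem)

text \<open>McKay's argument: the first entry of a word with product \<open>id\<close> is determined
  by the others, and rotation preserves the condition, so the number of solutions of
  \<open>g ^^ q = id\<close> is divisible by \<open>q\<close>.\<close>

lemma cauchy:
  assumes q: "prime q" and dvd: "q dvd card G"
  shows "\<exists>a\<in>G. a \<noteq> id \<and> a ^^ q = id"
proof -
  obtain n where n: "q = Suc n" using q prime_gt_0_nat gr0_implies_Suc by blast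
  define w where "w gs = (if foldr (\<circ>) gs id = id then 1 else 0 :: int)" for gs :: "('a \<Rightarrow> 'a) list"
  have "(\<Sum>gs | set gs \<subseteq> G \<and> length gs = q. w gs) = (\<Sum>g\<in>G. \<Sum>gs | set gs \<subseteq> G \<and> length gs = n. w (g # gs))"
    unfolding n by (rule sum_lists_Suc[OF finG])
  also have "\<dots> = (\<Sum>gs | set gs \<subseteq> G \<and> length gs = n. \<Sum>g\<in>G. w (g # gs))" by (rule sum.swap)
  also have "\<dots> = (\<Sum>gs | set gs \<subseteq> G \<and> length gs = n. 1)"
  proof (intro sum.cong refl)
    fix gs assume gs: "gs \<in> {gs. set gs \<subseteq> G \<and> length gs = n}"
    define h where "h = foldr (\<circ>) gs id"
    have hG: "h \<in> G" unfolding h_def using foldr_mem gs by blast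
    have "g \<circ> h = id \<longleftrightarrow> g = inv' h" for g
    proof
      assume "g \<circ> h = id"
      then have "g \<circ> h \<circ> inv' h = inv' h" by simp
      then show "g = inv' h" using hG by (simp add: comp_assoc)
    qed (use hG in simp)
    then have "(\<Sum>g\<in>G. w (g # gs)) = (\<Sum>g\<in>G. if g = inv' h then 1 else 0)"
      unfolding w_def h_def by simp
    then show "(\<Sum>g\<in>G. w (g # gs)) = 1" using finG inv_mem[OF hG] by simp
  qed
  also have "\<dots> = int (card G ^ n)" using card_lists_length_eq[OF finG, of n] by simp
  finally have "(\<Sum>gs | set gs \<subseteq> G \<and> length gs = q. w gs) = int (card G ^ n)" .
  moreover have "[(\<Sum>gs | set gs \<subseteq> G \<and> length gs = q. w gs) = (\<Sum>g\<in>G. w (replicate q g))] (mod int q)"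
  proof (rule sum_lists_cong_constant[OF q finG])
    fix gs assume gs: "set gs \<subseteq> G" "length gs = q"
    then obtain g hs where g: "gs = g # hs" using n by (cases gs) auto
    define h where "h = foldr (\<circ>) hs id"
    have hG: "h \<in> G" "g \<in> G" unfolding h_def using foldr_mem gs g by auto
    have e: "foldr (\<circ>) hs f = h \<circ> f" for f unfolding h_def by (induction hs) auto
    have "h \<circ> g = id \<longleftrightarrow> g \<circ> h = id"
      using hG inv_comp[OF hG(1)] inv_comp[OF hG(2)] by (metis comp_assoc comp_id id_comp)
    then show "w (rotate1 gs) = w gs" unfolding w_def g by (simp add: e)
  qed
  moreover have "foldr (\<circ>) (replicate m g) id = g ^^ m" for m and g :: "'a \<Rightarrow> 'a" by (induction m) auto
  then have "(\<Sum>g\<in>G. w (replicate q g)) = int (card {g \<in> G. g ^^ q = id})"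
    unfolding w_def using finG by (simp add: sum.If_cases Int_def)
  ultimately have "[int (card G ^ n) = int (card {g \<in> G. g ^^ q = id})] (mod int q)" by metis
  then have "[card G ^ n = card {g \<in> G. g ^^ q = id}] (mod q)" by (simp only: cong_int_iff)
  moreover have "q dvd card G ^ n" using dvd n prime_gt_1_nat[OF q] by (simp add: dvd_power_same dvd_trans[OF _ dvd_power])
  ultimately have "q dvd card {g \<in> G. g ^^ q = id}" using cong_dvd_iff by blast
  moreover have "id \<in> {g \<in> G. g ^^ q = id}" using id_mem by (simp add: id_funpow)
  then have "card {g \<in> G. g ^^ q = id} \<noteq> 0" using finG by auto
  ultimately have "card {g \<in> G. g ^^ q = id} \<ge> q" by (simp add: dvd_imp_le)
  then have "card {g \<in> G. g ^^ q = id} > 1" using prime_gt_1_nat[OF q] by simp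
  then have "{g \<in> G. g ^^ q = id} \<noteq> {id}" by auto
  then show ?thesis using \<open>id \<in> {g \<in> G. g ^^ q = id}\<close> by blast
qed

lemma finite_order:
  assumes "g \<in> G" obtains n where "n > 0" "g ^^ n = id"
proof -
  have "\<not> inj_on (\<lambda>n. g ^^ n) (UNIV :: nat set)"
    using funpow_mem[OF assms] finG by (metis finite_imageD finite_subset image_subset_iff infinite_UNIV_nat)
  then obtain m n where mn: "g ^^ m = g ^^ n" "m < n"
    unfolding inj_on_def by (metis linorder_neqE_nat)
  have "(g ^^ (n - m)) j = j" for j
  proof -
    have "(g ^^ m) ((g ^^ (n - m)) j) = (g ^^ n) j"
      using mn(2) by (metis comp_apply funpow_add le_add_diff_inverse less_imp_le)
    then show ?thesis using mn(1) inj_G[OF funpow_mem[OF assms]] by metis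
  qed
  then show thesis using that[of "n - m"] mn(2) by (auto simp: fun_eq_iff)
qed

end

context deg2p
begin

lemma card_G: "p dvd card G"
proof -
  obtain x where x: "x \<in> X" using cardX p_pos by fastforce
  define c where "c = card {g \<in> G. g x = x}"
  have "card {g \<in> G. g x = y} = c" if y: "y \<in> X" for y
  proof -
    obtain h where h: "h \<in> G" "h x = y" using transitive[OF x y] by blast
    have "bij_betw (\<lambda>g. h \<circ> g) {g \<in> G. g x = x} {g \<in> G. g x = y}"
    proof (rule bij_betw_byWitness[where f' = "\<lambda>g. inv' h \<circ> g"])
      show "\<forall>g\<in>{g \<in> G. g x = x}. inv' h \<circ> (h \<circ> g) = g" using h by (simp add: fun_eq_iff)
      show "\<forall>g\<in>{g \<in> G. g x = y}. h \<circ> (inv' h \<circ> g) = g" using h by (simp add: fun_eq_iff)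
      show "(\<lambda>g. h \<circ> g) ` {g \<in> G. g x = x} \<subseteq> {g \<in> G. g x = y}" using h comp_mem by auto
      have "inv' h y = x" using h inv_apply(1)[OF h(1), of x] by simp
      then show "(\<lambda>g. inv' h \<circ> g) ` {g \<in> G. g x = y} \<subseteq> {g \<in> G. g x = x}"
        using h comp_mem[OF inv_mem[OF h(1)]] by auto
    qed
    from bij_betw_same_card[OF this] show ?thesis unfolding c_def ..
  qed
  moreover have "card G = (\<Sum>y\<in>X. card {g \<in> G. g x = y})"
  proof -
    have "card G = (\<Sum>g\<in>G. 1)" by simp
    also have "\<dots> = (\<Sum>y\<in>X. \<Sum>g | g \<in> G \<and> g x = y. 1)"
      using mem_X[OF _ x] by (intro sum.group[symmetric] finG finX) auto
    finally show ?thesis by simp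
  qed
  ultimately have "card G = 2 * p * c" using cardX by simp
  then show ?thesis by simp
qed

lemma order_p_exists: "\<exists>a\<in>G. a \<noteq> id \<and> a ^^ p = id"
  using cauchy[OF p(1) card_G] .

text \<open>A factor \<open>p\<close> can be removed from any exponent of \<open>z x\<close>: a
  power of \<open>z x\<close> whose \<open>p\<close>-th power is trivial still fixes
  \<open>x\<close>, so it is trivial by \<open>no_fixed_point_order_p\<close>. Coprimality is what
  allows residues modulo \<open>m\<close> and \<open>p\<close> to be prescribed
  independently.\<close>

lemma coprime_order:
  assumes z: "fixing_fam z"
  obtains m where "m > 0" "coprime m p" "\<And>i. i \<in> X \<Longrightarrow> z i ^^ m = id"
proof -
  have zc: "conj_fam z" and zi: "\<And>i. i \<in> X \<Longrightarrow> z i i = i" using z unfolding fixing_fam_def by auto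
  obtain x where x: "x \<in> X" using cardX p_pos by fastforce
  have zG: "z x \<in> G" using conj_fam_mem[OF zc x] .
  obtain n where n: "n > 0" "z x ^^ n = id" using finite_order[OF zG] by blast
  have "\<exists>m>0. coprime m p \<and> z x ^^ m = id"
    using n
  proof (induction n rule: less_induct)
    case (less n)
    show ?case
    proof (cases "p dvd n")
      case False
      then show ?thesis using less.prems p(1) prime_imp_coprime coprime_commute by metis
    next
      case True
      then obtain k where k: "n = k * p" by (metis dvdE mult.commute)
      have "(z x ^^ k) ^^ p = id" using less.prems(2) k by (simp add: funpow_mult id_def)
      moreover have "(z x ^^ k) x = x" using zi[OF x] by (induction k) auto
      moreover have "z x ^^ k = id"
      proof (cases "z x = id")
        case False
        show ?thesis
          by (rule no_fixed_point_order_p[OF z x False funpow_mem[OF zG]]) (use calculation x in auto)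
      qed (simp add: id_funpow)
      moreover have "k > 0" "k < n" using less.prems(1) k p(2) by auto
      ultimately show ?thesis using less.IH by blast
    qed
  qed
  then obtain m where m: "m > 0" "coprime m p" "z x ^^ m = id" by blast
  have "z i ^^ m = id" if i: "i \<in> X" for i
  proof -
    obtain g where g: "g \<in> G" "g x = i" using transitive[OF x i] by blast
    have "z i ^^ m \<circ> g = g" using conj_fam_comp[OF conj_fam_funpow[OF zc] g(1) x, of m] m(3) g(2) by simp
    then have "z i ^^ m \<circ> (g \<circ> inv' g) = g \<circ> inv' g" by (simp add: comp_assoc[symmetric])
    then show ?thesis using g(1) by simp
  qed
  then show thesis using that m by blast
qed

end

text \<open>Without fixed points, \<open>a\<close> has exactly two orbits, each of size
  \<open>p\<close>; \<open>o0\<close> and \<open>o1\<close> are their base points.\<close>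

locale deg2p_cyclic = deg2p +
  fixes a :: "'a \<Rightarrow> 'a" and o0 o1 :: 'a
  assumes a: "a \<in> G" "a ^^ p = id" "\<And>x. x \<in> X \<Longrightarrow> a x \<noteq> x"
    and o: "o0 \<in> X" "o1 \<in> X" "\<And>k. (a ^^ k) o0 \<noteq> o1"
begin

definition pt :: "bool \<Rightarrow> int \<Rightarrow> 'a"
  where "pt b x = (a ^^ nat (x mod int p)) (if b then o1 else o0)"

text \<open>An invariant matrix commutes with \<open>a\<close>, so each of its four blocks is
  circulant and determined by its first row, an element of the group ring. Matrix products become
  products of \<open>2\<close> by \<open>2\<close> matrices of such rows.\<close>

definition blk :: "('a \<Rightarrow> 'a \<Rightarrow> int) \<Rightarrow> bool \<Rightarrow> bool \<Rightarrow> int \<Rightarrow> int"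
  where "blk A b d x = A (pt b 0) (pt d x)"

definition side :: "'a \<Rightarrow> bool"
  where "side j \<longleftrightarrow> (\<exists>x. j = pt True x)"

lemma a_pow_mod: "(a ^^ k) = a ^^ (k mod p)"
  by (rule funpow_p_mod[OF a(2)])

lemma a_mem: "a ^^ k \<in> G" by (rule funpow_mem[OF a(1)])

lemma pt_mem: "pt b x \<in> X"
  unfolding pt_def using mem_X[OF a_mem] o by simp

lemma pt_mod: "x mod int p = y mod int p \<Longrightarrow> pt b x = pt b y"
  unfolding pt_def by simp

lemma a_pt: "(a ^^ k) (pt b x) = pt b (x + int k)"
proof -
  have "(k + nat (x mod int p)) mod p = nat ((x + int k) mod int p) mod p"
  proof -
    have "int ((k + nat (x mod int p)) mod p) = (int k + x mod int p) mod int p"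
      using p_pos by (simp add: zmod_int)
    also have "\<dots> = (x + int k) mod int p" by (simp add: mod_add_right_eq add.commute)
    also have "\<dots> = int (nat ((x + int k) mod int p) mod p)" using p_pos by (simp add: zmod_int)
    finally show ?thesis by simp
  qed
  then have "a ^^ (k + nat (x mod int p)) = a ^^ nat ((x + int k) mod int p)"
    using a_pow_mod by metis
  then show ?thesis unfolding pt_def by (simp add: funpow_add fun_eq_iff)
qed

lemma a_pow_eq_iff: "j \<in> X \<Longrightarrow> (a ^^ k) j = j \<longleftrightarrow> p dvd k"
proof
  assume j: "j \<in> X" "(a ^^ k) j = j"
  show "p dvd k"
  proof (rule ccontr)
    assume "\<not> p dvd k"
    then have "coprime k p" using p(1) prime_imp_coprime coprime_commute by blast
    then show False using funpow_coprime_fixed[of p a j k] j a(2,3) by auto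
  qed
next
  assume "p dvd k"
  then show "(a ^^ k) j = j" using a_pow_mod[of k] by simp
qed

lemma pt_inj: "pt b x = pt b y \<longleftrightarrow> x mod int p = y mod int p"
proof
  assume eq: "pt b x = pt b y"
  have "(a ^^ nat ((y - x) mod int p)) (pt b x) = pt b (x + (y - x) mod int p)"
    using a_pt p_pos by simp
  also have "\<dots> = pt b y" by (rule pt_mod) (simp add: mod_add_right_eq)
  finally have "p dvd nat ((y - x) mod int p)" using a_pow_eq_iff[OF pt_mem] eq by metis
  then have "int p dvd int (nat ((y - x) mod int p))" by (simp only: int_dvd_int_iff)
  moreover have "int (nat ((y - x) mod int p)) = (y - x) mod int p" using p_pos by simp
  ultimately have "int p dvd (y - x) mod int p" by simp
  then have "int p dvd y - x" by (simp add: dvd_mod_iff)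
  then have "y mod int p = x mod int p" by (simp add: mod_eq_dvd_iff)
  then show "x mod int p = y mod int p" ..
qed (rule pt_mod)

lemma pt_ne: "pt False x \<noteq> pt True y"
proof
  assume "pt False x = pt True y"
  then have "(a ^^ nat ((- y) mod int p)) (pt False x) = (a ^^ nat ((- y) mod int p)) (pt True y)" by simp
  then have "pt False (x + (- y) mod int p) = pt True (y + (- y) mod int p)" using a_pt p_pos by simp
  moreover have "pt True (y + (- y) mod int p) = pt True 0" by (rule pt_mod) (simp add: mod_add_right_eq)
  moreover have "pt True 0 = o1" unfolding pt_def by simp
  ultimately show False using o(3) unfolding pt_def by auto
qed

lemma X_eq: "X = pt False ` {0..<int p} \<union> pt True ` {0..<int p}"
proof -
  have inj: "inj_on (pt b) {0..<int p}" for b by (rule inj_onI) (simp add: pt_inj)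
  have "card (pt False ` {0..<int p} \<union> pt True ` {0..<int p}) = 2 * p"
    using card_image[OF inj] pt_ne by (subst card_Un_disjoint) auto
  then show ?thesis using cardX pt_mem by (intro card_subset_eq[symmetric] finX) auto
qed

lemma sum_X: "(\<Sum>j\<in>X. f j) = (\<Sum>x\<in>{0..<int p}. f (pt False x)) + (\<Sum>x\<in>{0..<int p}. f (pt True x))"
proof -
  have inj: "inj_on (pt b) {0..<int p}" for b by (rule inj_onI) (simp add: pt_inj)
  show ?thesis unfolding X_eq using pt_ne
    by (subst sum.union_disjoint) (auto simp: sum.reindex[OF inj])
qed

lemma pt_cases: assumes "j \<in> X" obtains b x where "x \<in> {0..<int p}" "j = pt b x"
  using assms X_eq by blast

lemma side_pt: "side (pt b x) = b"
  unfolding side_def using pt_ne by (cases b) auto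

lemma periodic_blk: "periodic p (blk A b d)"
  unfolding blk_def by (rule periodicI) (drule pt_mod[of _ _ d], simp)

lemma blk_shift:
  assumes "ginv A" shows "A (pt b y) (pt d x) = blk A b d (x - y)"
proof -
  have "blk A b d (x - y) = A ((a ^^ nat (y mod int p)) (pt b 0)) ((a ^^ nat (y mod int p)) (pt d (x - y)))"
    unfolding blk_def using ginvD[OF assms a_mem pt_mem pt_mem] by simp
  also have "\<dots> = A (pt b (y mod int p)) (pt d (x - y + y mod int p))" using a_pt p_pos by simp
  also have "pt b (y mod int p) = pt b y" by (rule pt_mod) simp
  also have "pt d (x - y + y mod int p) = pt d x" by (rule pt_mod) (simp add: mod_add_right_eq)
  finally show ?thesis ..
qed

lemma blk_mmul:
  assumes "ginv A" "ginv B"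
  shows "blk (mmul X A B) b d x = conv p (blk A b False) (blk B False d) x + conv p (blk A b True) (blk B True d) x"
proof -
  have "blk (mmul X A B) b d x = (\<Sum>y\<in>{0..<int p}. A (pt b 0) (pt False y) * B (pt False y) (pt d x))
      + (\<Sum>y\<in>{0..<int p}. A (pt b 0) (pt True y) * B (pt True y) (pt d x))"
    unfolding blk_def mmul_def by (rule sum_X)
  then show ?thesis unfolding conv_def blk_shift[OF assms(2)] by (simp add: blk_def)
qed

definition tr :: "('a \<Rightarrow> 'a \<Rightarrow> int) \<Rightarrow> int \<Rightarrow> int"
  where "tr A x = blk A False False x + blk A True True x"

text \<open>Translates the twisted integer traces of the Frobenius argument into single coefficients
  of the trace over the group ring.\<close>

lemma sum_trace:
  assumes "ginv A" shows "(\<Sum>j\<in>X. A j ((a ^^ k) j)) = int p * tr A (int k)"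
  unfolding sum_X a_pt blk_shift[OF assms] by (simp add: tr_def distrib_left)

lemma blk_eqI:
  assumes "ginv A" "ginv B" "\<And>b d x. blk A b d x = blk B b d x" "j \<in> X" "k \<in> X"
  shows "A j k = B j k"
proof -
  obtain b y where j: "j = pt b y" using pt_cases[OF assms(4)] by blast
  obtain d x where k: "k = pt d x" using pt_cases[OF assms(5)] by blast
  show ?thesis unfolding j k blk_shift[OF assms(1)] blk_shift[OF assms(2)] assms(3) ..
qed

lemma tr_const:
  assumes z: "fixing_fam z" and x: "\<not> int p dvd x"
  shows "tr (mpow X (cmat z) n) x = tr (mpow X (cmat z) n) 1"
proof -
  have zc: "conj_fam z" using z unfolding fixing_fam_def by blast
  obtain m where m: "m > 0" "coprime m p" "\<And>i. i \<in> X \<Longrightarrow> z i ^^ m = id"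
    using coprime_order[OF z] by blast
  define k where "k = nat (x mod int p)"
  have k: "int k = x mod int p" unfolding k_def using p_pos by simp
  have "\<not> int p dvd int k" using x unfolding k by (simp add: dvd_mod_iff)
  then have "\<not> p dvd k" by simp
  then have "(\<Sum>j\<in>X. mpow X (cmat z) n j ((a ^^ k) j)) = (\<Sum>j\<in>X. mpow X (cmat z) n j ((a ^^ 1) j))"
    using twisted_trace_const[OF zc p(1) a(1,2) m] by simp
  then have "tr (mpow X (cmat z) n) (int k) = tr (mpow X (cmat z) n) 1"
    unfolding sum_trace[OF ginv_mpow[OF ginv_cmat[OF zc]]] using p_pos by simp
  moreover have "tr (mpow X (cmat z) n) (int k) = tr (mpow X (cmat z) n) x"
    unfolding tr_def k using periodic_blk unfolding periodic_def by simp
  ultimately show ?thesis by simp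
qed

lemma ginv_diag: "ginv A \<Longrightarrow> j \<in> X \<Longrightarrow> k \<in> X \<Longrightarrow> A j j = A k k"
  using transitive[of j k] ginvD[of A _ j j] by metis

end

section \<open>The quadratic identity\<close>

lemma sum_conv:
  assumes "p > 0" "periodic p g"
  shows "(\<Sum>x\<in>{0..<int p}. conv p f g x) = (\<Sum>x\<in>{0..<int p}. f x) * (\<Sum>x\<in>{0..<int p}. g x)"
proof -
  have "(\<Sum>x\<in>{0..<int p}. conv p f g x) = (\<Sum>y\<in>{0..<int p}. f y * (\<Sum>x\<in>{0..<int p}. g (x - y)))"
    unfolding conv_def by (subst sum.swap) (simp add: sum_distrib_left)
  then show ?thesis unfolding sum_shift[OF assms] by (simp add: sum_distrib_right)
qed

context perm_group
begin

lemma cmat_row_sum: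
  assumes "conj_fam z" "j \<in> X" shows "(\<Sum>k\<in>X. cmat z j k) = int (card X)"
proof -
  have "(\<Sum>k\<in>X. card {i \<in> X. z i j = k}) = (\<Sum>i\<in>X. 1)"
    unfolding card_eq_sum using mem_X[OF conj_fam_mem[OF assms(1)] assms(2)]
    by (intro sum.group[of X X] finX) auto
  then show ?thesis unfolding cmat_def by (simp flip: of_nat_sum)
qed

lemma cmat_col_sum:
  assumes "conj_fam z" "k \<in> X" shows "(\<Sum>j\<in>X. cmat z j k) = int (card X)"
proof -
  have "(\<Sum>j\<in>X. cmat z j k) = (\<Sum>j\<in>X. \<Sum>i\<in>X. if z i j = k then 1 else 0)"
    unfolding cmat_def using finX by (simp add: sum.If_cases Int_def)
  also have "\<dots> = (\<Sum>i\<in>X. \<Sum>j\<in>X. if z i j = k then 1 else 0)" by (rule sum.swap)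
  also have "\<dots> = (\<Sum>i\<in>X. 1)"
  proof (intro sum.cong refl)
    fix i assume "i \<in> X"
    then have zi: "z i \<in> G" by (rule conj_fam_mem[OF assms(1)])
    have "(\<Sum>j\<in>X. if z i j = k then 1 else 0) = (\<Sum>j\<in>X. if j = inv' (z i) k then 1 else (0::int))"
      using zi by (intro sum.cong refl if_cong) auto
    then show "(\<Sum>j\<in>X. if z i j = k then 1 else 0) = (1::int)"
      using finX mem_X[OF inv_mem[OF zi] assms(2)] by simp
  qed
  finally show ?thesis by simp
qed

lemma cmat_commute:
  assumes z: "conj_fam z" and A: "ginv A" and jk: "j \<in> X" "k \<in> X"
  shows "mmul X (cmat z) A j k = mmul X A (cmat z) j k"
proof -
  have "mmul X A (cmat z) j k = (\<Sum>l\<in>X. A j l * (\<Sum>i\<in>X. if z i l = k then 1 else 0))"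
    unfolding mmul_def cmat_def using finX by (simp add: sum.If_cases Int_def)
  also have "\<dots> = (\<Sum>l\<in>X. \<Sum>i\<in>X. if z i l = k then A j l else 0)"
    by (simp add: sum_distrib_left if_distrib[of "\<lambda>u. _ * u"] cong: if_cong)
  also have "\<dots> = (\<Sum>i\<in>X. \<Sum>l\<in>X. if z i l = k then A j l else 0)" by (rule sum.swap)
  also have "\<dots> = (\<Sum>i\<in>X. A (z i j) k)"
  proof (intro sum.cong refl)
    fix i assume i: "i \<in> X"
    have zi: "z i \<in> G" using conj_fam_mem[OF z i] .
    have "(\<Sum>l\<in>X. if z i l = k then A j l else 0) = (\<Sum>l\<in>X. if l = inv' (z i) k then A j l else 0)"
      using zi by (intro sum.cong refl if_cong) auto
    also have "\<dots> = A j (inv' (z i) k)" using finX mem_X[OF inv_mem[OF zi] jk(2)] by simp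
    also have "\<dots> = A (z i j) k"
      using ginvD[OF A zi jk(1) mem_X[OF inv_mem[OF zi] jk(2)]] zi by simp
    finally show "(\<Sum>l\<in>X. if z i l = k then A j l else 0) = A (z i j) k" .
  qed
  also have "\<dots> = mmul X (cmat z) A j k" using cmat_mmul[OF conj_fam_mem[OF z] jk(1)] by simp
  finally show ?thesis ..
qed

lemma mpow_one_two:
  assumes "j \<in> X" "k \<in> X"
  shows "mpow X A (Suc 0) j k = A j k" "mpow X A (Suc (Suc 0)) j k = mmul X A A j k"
proof -
  have 1: "mpow X A (Suc 0) j k = A j k" if "k \<in> X" for j k
    using finX that by (simp add: mmul_def if_distrib[of "\<lambda>u. _ * u"] sum.delta cong: if_cong)
  show "mpow X A (Suc 0) j k = A j k" using 1 assms by blast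
  have "mpow X A (Suc (Suc 0)) j k = (\<Sum>l\<in>X. A j l * mpow X A (Suc 0) l k)"
    by (simp only: mpow.simps(2)[of X A "Suc 0"] mmul_def)
  then show "mpow X A (Suc (Suc 0)) j k = mmul X A A j k" unfolding 1[OF assms(2)] mmul_def .
qed

end

context deg2p_cyclic
begin

lemma trace_cmat:
  assumes z: "fixing_fam z" and x: "\<not> int p dvd x"
  shows "tr (cmat z) x = tr (cmat z) 1" "tr (mmul X (cmat z) (cmat z)) x = tr (mmul X (cmat z) (cmat z)) 1"
proof -
  have e: "tr (mpow X A (Suc 0)) y = tr A y" "tr (mpow X A (Suc (Suc 0))) y = tr (mmul X A A) y" for A y
    unfolding tr_def blk_def by (simp_all only: mpow_one_two[OF pt_mem pt_mem])
  show "tr (cmat z) x = tr (cmat z) 1" using tr_const[OF z x, of "Suc 0"] unfolding e .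
  show "tr (mmul X (cmat z) (cmat z)) x = tr (mmul X (cmat z) (cmat z)) 1"
    using tr_const[OF z x, of "Suc (Suc 0)"] unfolding e .
qed

lemma blk_id: "blk (\<lambda>j k. if j = k then e else 0) b d x = (if b = d \<and> int p dvd x then e else 0)"
proof -
  have "pt b 0 = pt d x \<longleftrightarrow> b = d \<and> int p dvd x"
    using pt_ne[of 0 x] pt_ne[of x 0] pt_inj[of b 0 x] by (cases b; cases d) auto
  then show ?thesis unfolding blk_def by simp
qed

lemma tr_0: "ginv A \<Longrightarrow> int p dvd x \<Longrightarrow> tr A x = 2 * A o0 o0"
proof -
  assume A: "ginv A" and x: "int p dvd x"
  have "pt d x = pt d 0" for d using x by (intro pt_mod) auto
  then have "tr A x = A (pt False 0) (pt False 0) + A (pt True 0) (pt True 0)" unfolding tr_def blk_def by simp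
  then show ?thesis using ginv_diag[OF A pt_mem o(1)] by simp
qed

text \<open>Equal diagonal entries and equal row and column totals leave one value for the diagonal
  blocks and one for the others. If these differed, lying in the same orbit of \<open>a\<close>
  would be a \<open>G\<close>-invariant relation, and the two orbits would form a split.\<close>

lemma block_constant_imp_constant:
  assumes Y: "ginv Y" and const: "\<And>b d x. blk Y b d x = y b d"
    and rows: "\<And>j. j \<in> X \<Longrightarrow> (\<Sum>k\<in>X. Y j k) = R"
  shows "y b d = y False False"
proof -
  have Ys: "Y (pt b x) (pt d u) = y b d" for b d x u unfolding blk_shift[OF Y] const ..
  have TT: "y True True = y False False"
    using ginv_diag[OF Y pt_mem pt_mem, of True 0 False 0] Ys by simp
  have row: "int p * (y b False + y b True) = R" for b
    using rows[OF pt_mem[of b 0]] unfolding sum_X Ys by (simp add: distrib_left)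
  then have "int p * (y False False + y False True) = int p * (y True False + y True True)" by metis
  then have FT: "y False True = y True False" using TT p_pos by simp
  show ?thesis
  proof (cases "y False True = y False False")
    case True
    then show ?thesis using TT FT by (cases b; cases d) auto
  next
    case False
    have same: "Y j k = y False False \<longleftrightarrow> side j = side k" if "j \<in> X" "k \<in> X" for j k
    proof -
      obtain b x where j: "j = pt b x" using pt_cases[OF \<open>j \<in> X\<close>] by blast
      obtain d u where k: "k = pt d u" using pt_cases[OF \<open>k \<in> X\<close>] by blast
      show ?thesis unfolding j k Ys side_pt using False TT FT by (cases b; cases d) auto
    qed
    define S where "S = {j \<in> X. side j}"
    have "g ` S = S \<or> g ` S = X - S" if g: "g \<in> G" for g
    proof -
      have eq: "side (g j) = side (g k) \<longleftrightarrow> side j = side k" if "j \<in> X" "k \<in> X" for j k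
        using same[OF that] same[OF mem_X[OF g that(1)] mem_X[OF g that(2)]] ginvD[OF Y g that] by simp
      have o1: "side o1" using side_pt[of True 0] unfolding pt_def by simp
      have mem: "j \<in> g ` S \<longleftrightarrow> j \<in> X \<and> (side j \<longleftrightarrow> side (g o1))" for j
      proof
        assume "j \<in> g ` S"
        then obtain k where "k \<in> X" "side k" "j = g k" unfolding S_def by blast
        then show "j \<in> X \<and> (side j \<longleftrightarrow> side (g o1))" using eq[OF _ o(2)] o1 mem_X[OF g] by auto
      next
        assume j: "j \<in> X \<and> (side j \<longleftrightarrow> side (g o1))"
        then have k: "inv' g j \<in> X" "g (inv' g j) = j" using g inv_mem mem_X by auto
        then have "side (inv' g j)" using eq[OF k(1) o(2)] o1 j by simp
        then show "j \<in> g ` S" unfolding S_def using k by (metis (mono_tags, lifting) image_eqI mem_Collect_eq)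
      qed
      show ?thesis
      proof (cases "side (g o1)")
        case True
        then have "g ` S = S" using mem unfolding S_def by blast
        then show ?thesis ..
      next
        case False
        then have "g ` S = X - S" using mem unfolding S_def by blast
        then show ?thesis ..
      qed
    qed
    moreover have "S \<subseteq> X" unfolding S_def by blast
    moreover have "pt True 0 \<in> S" "pt False 0 \<notin> S" unfolding S_def using pt_mem side_pt by auto
    then have "S \<noteq> {}" "S \<noteq> X" using pt_mem by blast+
    ultimately have False using no_split by blast
    then show ?thesis ..
  qed
qed

text \<open>Here \<open>nu\<close> is the eigenvalue of \<open>M\<close> on the vector that is
  \<open>1\<close> on one orbit of \<open>a\<close> and \<open>-1\<close> on the other. The second
  root of the quadratic polynomial is \<open>p * (2 - c)\<close>. The identity is doubled because
  the constant matrix in it has entries \<open>(2 * p - nu) * c / 2\<close>.\<close>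

theorem quadratic_identity:
  fixes c f nu
  assumes z: "fixing_fam z"
  defines "c \<equiv> tr (cmat z) 1" and "f \<equiv> cmat z o0 o0"
  defines "nu \<equiv> 2 * f + (int p - 1) * c - 2 * int p"
  assumes jk: "j \<in> X" "k \<in> X"
  shows "2 * mmul X (cmat z) (cmat z) j k = 2 * (2 * f - c) * cmat z j k
    - (if j = k then 2 * nu * int p * (2 - c) else 0) + (2 * int p - nu) * c"
proof -
  let ?I = "{0..<int p}"
  have zc: "conj_fam z" using z unfolding fixing_fam_def by blast
  define M where "M = cmat z"
  define M2 where "M2 = mmul X M M"
  have gM: "ginv M" unfolding M_def by (rule ginv_cmat[OF zc])
  have gM2: "ginv M2" unfolding M2_def by (rule ginv_mmul[OF gM gM])
  define m where "m b d = blk M b d" for b d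
  define m2 where "m2 b d = blk M2 b d" for b d
  have per: "periodic p (m b d)" for b d unfolding m_def by (rule periodic_blk)
  have m2: "m2 b d x = conv p (m b False) (m False d) x + conv p (m b True) (m True d) x" for b d x
    unfolding m2_def M2_def m_def by (rule blk_mmul[OF gM gM])
  have comm: "conv p (m b d) (m b' d') x = conv p (m b' d') (m b d) x" for b d b' d' x
    by (rule conv_commute[OF p_pos per per])
  define t where "t x = m False False x + m True True x" for x
  have t: "t = (\<lambda>x. (2 * f - c) * (if int p dvd x then 1 else 0) + c)"
  proof
    fix x
    have "t x = tr M x" unfolding t_def tr_def m_def ..
    then show "t x = (2 * f - c) * (if int p dvd x then 1 else 0) + c"
      using trace_cmat(1)[OF z, of x] tr_0[OF gM, of x] unfolding c_def f_def M_def by auto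
  qed
  define S where "S b d = (\<Sum>x\<in>?I. m b d x)" for b d
  have convt: "conv p t (m b d) x = (2 * f - c) * m b d x + c * S b d" for b d x
    unfolding t S_def by (rule conv_delta_const_left[OF p_pos per])
  have convt': "conv p t (m b d) x = conv p (m False False) (m b d) x + conv p (m True True) (m b d) x" for b d x
    unfolding t_def by (rule conv_add_left)
  define D where "D x = conv p (m False False) (m True True) x - conv p (m False True) (m True False) x" for x
  have twoD: "2 * D x = conv p t (m False False) x + conv p t (m True True) x - tr M2 x" for x
    unfolding D_def convt' tr_def m2_def[symmetric] m2
    using comm[of False False True True x] comm[of False True True False x] by simp
  \<comment> \<open>Twice the determinant is the square of the trace minus the trace of the square,
    and both are constant away from \<open>0\<close>.\<close>
  have Dnz: "2 * D x = 2 * D 1" if "\<not> int p dvd x" for x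
  proof -
    have p1: "\<not> int p dvd 1" using p(2) by (simp add: zdvd1_eq)
    have "2 * D y = (2 * f - c) * t y + c * (S False False + S True True) - tr M2 y" for y
      unfolding twoD convt t_def by (simp add: algebra_simps)
    moreover have "t x = t 1" unfolding t using that p1 by simp
    ultimately show ?thesis using trace_cmat(2)[OF z that] unfolding M2_def M_def by simp
  qed
  have Dx: "D x = (D 0 - D 1) * (if int p dvd x then 1 else 0) + D 1" for x
  proof (cases "int p dvd x")
    case True
    have "periodic p D" unfolding D_def
      using periodic_conv[OF per, of "m False False" True True] periodic_conv[OF per, of "m False True" True False]
      unfolding periodic_def by simp
    then have "D x = D 0" by (rule periodic_cong) (use True in simp)
    then show ?thesis using True by simp
  next
    case False
    have "D x = D 1" using Dnz[OF False] by linarith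
    then show ?thesis using False by simp
  qed
  define E where "E = D 0 - D 1"
  have CH: "m2 b d x = conv p t (m b d) x - (if b = d then D x else 0)" for b d x
    unfolding m2 convt' D_def
    using comm[of False False True True x] comm[of False True True False x]
      comm[of False True True True x] comm[of True False False False x]
      comm[of True False True True x] comm[of False True False False x]
    by (cases b; cases d) simp_all
  \<comment> \<open>Only the unit parts of trace and determinant are moved to this side, so what
    remains is constant on every block.\<close>
  define Y where "Y j k = M2 j k - (2 * f - c) * M j k + (if j = k then E else 0)" for j k
  define y where "y b d = c * S b d - (if b = d then D 1 else 0)" for b d
  have blkY: "blk Y b d x = y b d" for b d x
  proof -
    have "blk Y b d x = m2 b d x - (2 * f - c) * m b d x + blk (\<lambda>j k. if j = k then E else 0) b d x"
      unfolding Y_def m2_def m_def blk_def ..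
    also have "\<dots> = y b d"
      unfolding blk_id CH convt y_def using Dx[of x] by (auto simp: E_def)
    finally show ?thesis .
  qed
  have gY: "ginv Y" using gM gM2 unfolding ginv_def Y_def by (simp add: inj_G)
  have rowM: "(\<Sum>k\<in>X. M j k) = 2 * int p" if "j \<in> X" for j
    unfolding M_def using cmat_row_sum[OF zc that] cardX by simp
  have rowM2: "(\<Sum>k\<in>X. M2 j k) = 4 * (int p)\<^sup>2" if "j \<in> X" for j
  proof -
    have "(\<Sum>k\<in>X. M2 j k) = (\<Sum>l\<in>X. M j l * (\<Sum>k\<in>X. M l k))"
      unfolding M2_def mmul_def by (subst sum.swap) (simp add: sum_distrib_left)
    also have "\<dots> = (\<Sum>l\<in>X. M j l) * (2 * int p)" using rowM by (simp add: sum_distrib_right)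
    finally show ?thesis using rowM[OF that] by (simp add: power2_eq_square)
  qed
  have rowY: "(\<Sum>k\<in>X. Y j k) = 4 * (int p)\<^sup>2 - (2 * f - c) * (2 * int p) + E" if "j \<in> X" for j
    unfolding Y_def using finX that rowM[OF that] rowM2[OF that]
    by (simp add: sum.distrib sum_subtractf sum_distrib_left[symmetric])
  define y0 where "y0 = y False False"
  have y0: "y b d = y0" for b d
    unfolding y0_def by (rule block_constant_imp_constant[OF gY blkY rowY])
  have Yc: "Y j k = y0" if jk: "j \<in> X" "k \<in> X" for j k
  proof -
    obtain b x where j: "j = pt b x" using pt_cases[OF jk(1)] by blast
    obtain d u where k: "k = pt d u" using pt_cases[OF jk(2)] by blast
    show ?thesis unfolding j k blk_shift[OF gY] blkY y0 ..
  qed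
  have R: "4 * (int p)\<^sup>2 - (2 * f - c) * (2 * int p) + E = 2 * int p * y0"
    using rowY[OF o(1)] Yc[OF o(1)] cardX by simp
  have rs: "S b False + S b True = 2 * int p" for b
    using rowM[OF pt_mem[of b 0]] unfolding sum_X S_def m_def blk_def .
  have cs: "S False d + S True d = 2 * int p" for d
  proof -
    have "(\<Sum>j\<in>X. M j (pt d 0)) = 2 * int p"
      unfolding M_def using cmat_col_sum[OF zc pt_mem] cardX by simp
    moreover have "(\<Sum>x\<in>?I. m b d (0 - x)) = S b d" for b
      unfolding S_def by (rule sum_reflect[OF p_pos per])
    ultimately show ?thesis unfolding sum_X blk_shift[OF gM] m_def[symmetric] by metis
  qed
  have S_eq: "S True True = S False False" "S True False = S False True"
    using rs[of False] rs[of True] cs[of False] cs[of True] by linarith+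
  have sum_delta: "(\<Sum>x\<in>?I. if int p dvd x then e else 0) = e" for e :: int
  proof -
    have "(\<Sum>x\<in>?I. if int p dvd x then e else 0) = (\<Sum>x\<in>?I. if x = 0 then e else 0)"
      by (intro sum.cong refl) (auto dest: zdvd_imp_le)
    then show ?thesis using p_pos by simp
  qed
  have "S False False + S True True = (\<Sum>x\<in>?I. t x)" unfolding t_def S_def by (simp add: sum.distrib)
  also have "\<dots> = (\<Sum>x\<in>?I. (if int p dvd x then 2 * f - c else 0) + c)" unfolding t by (intro sum.cong) auto
  also have "\<dots> = 2 * f - c + int p * c" by (simp only: sum.distrib sum_delta) simp
  finally have SF: "2 * S False False = 2 * f - c + int p * c" using S_eq by simp
  have nu: "nu = S False False - S False True"
    unfolding nu_def using SF rs[of False] by (simp add: algebra_simps)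
  have m2y: "m2 b d x = (2 * f - c) * m b d x + y0 - (if b = d \<and> int p dvd x then E else 0)" for b d x
    unfolding CH convt using Dx[of x] y0[of b d] unfolding y_def E_def by (auto split: if_splits)
  \<comment> \<open>Summing over blocks shows that \<open>nu\<close> is a root; the other root then
    follows from the sum of the two.\<close>
  have "(\<Sum>x\<in>?I. m2 False False x) - (\<Sum>x\<in>?I. m2 False True x) = (2 * f - c) * nu - E"
    unfolding m2y nu S_def by (simp add: sum.distrib sum_subtractf sum_delta sum_distrib_left[symmetric] algebra_simps)
  moreover have "(\<Sum>x\<in>?I. m2 b d x) = S b False * S False d + S b True * S True d" for b d
    unfolding m2 S_def by (simp add: sum.distrib sum_conv[OF p_pos per])
  ultimately have "nu * nu = (2 * f - c) * nu - E" unfolding nu using S_eq by (simp add: algebra_simps)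
  then have "E = nu * (2 * f - c - nu)" by (simp add: algebra_simps)
  moreover have mu: "2 * f - c - nu = int p * (2 - c)" unfolding nu_def by (simp add: algebra_simps)
  ultimately have E: "E = nu * int p * (2 - c)" by simp
  have "(2 * int p - nu) * (2 * int p - int p * (2 - c)) = 2 * int p * y0"
  proof -
    have T: "2 * f - c = nu + int p * (2 - c)" using mu by simp
    have "(2 * int p - nu) * (2 * int p - int p * (2 - c))
        = 4 * (int p)\<^sup>2 - (nu + int p * (2 - c)) * (2 * int p) + nu * int p * (2 - c)"
      by (simp add: algebra_simps power2_eq_square)
    then show ?thesis using R unfolding T E by simp
  qed
  then have "int p * ((2 * int p - nu) * c) = int p * (2 * y0)" by (simp add: algebra_simps)
  then have y0': "2 * y0 = (2 * int p - nu) * c" using p_pos by simp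
  have "M2 j k = (2 * f - c) * M j k - (if j = k then E else 0) + y0"
    using Yc[OF jk] unfolding Y_def by simp
  then have "2 * M2 j k = 2 * (2 * f - c) * M j k - (if j = k then 2 * E else 0) + 2 * y0"
    by (auto simp: algebra_simps)
  then show ?thesis unfolding y0' E M2_def M_def by (simp only: mult.assoc split: if_splits)
qed

section \<open>Pairs that are never moved into a common orbit\<close>

definition cross :: "'a \<Rightarrow> 'a \<Rightarrow> bool"
  where "cross j k \<longleftrightarrow> (\<forall>g\<in>G. side (g j) \<noteq> side (g k))"

text \<open>After moving the pair into one orbit of \<open>a\<close>, its entry in every invariant
  matrix is read off a diagonal block away from \<open>0\<close>, where traces are known.\<close>

lemma not_cross_in_block:
  assumes "\<not> cross j k" "j \<in> X" "k \<in> X" "j \<noteq> k"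
  obtains b x where "\<not> int p dvd x" "\<And>A. ginv A \<Longrightarrow> A j k = blk A b b x"
proof -
  obtain g where g: "g \<in> G" "side (g j) = side (g k)" using assms(1) unfolding cross_def by blast
  obtain b y where y: "g j = pt b y" using pt_cases[OF mem_X[OF g(1) assms(2)]] by blast
  obtain d x where x: "g k = pt d x" using pt_cases[OF mem_X[OF g(1) assms(3)]] by blast
  have bd: "d = b" using g(2) unfolding x y side_pt by simp
  have "\<not> int p dvd x - y"
  proof
    assume "int p dvd x - y"
    then have "x mod int p = y mod int p" by (simp add: mod_eq_dvd_iff)
    then have "g k = g j" unfolding x y bd by (rule pt_mod)
    then show False using inj_G[OF g(1)] assms(4) by simp
  qed
  moreover have "A j k = blk A b b (x - y)" if "ginv A" for A
    using ginvD[OF that g(1) assms(2,3)] blk_shift[OF that, of b y b x] unfolding x y bd by simp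
  ultimately show thesis using that by blast
qed

text \<open>\<open>class_card\<close> is applied to the equivalence relation generated by
  \<open>cross\<close>. If that were total, each \<open>g\<close> would keep all sides or reverse
  all of them, since the ends of a crossing pair lie on different sides before and after; this is a
  split. Classes of size two make \<open>cross\<close> a perfect matching.\<close>

lemma cross_dichotomy:
  obtains "\<And>j k. j \<in> X \<Longrightarrow> k \<in> X \<Longrightarrow> \<not> cross j k"
  | r where "r permutes X" "\<And>j. r (r j) = j" "\<And>j. j \<in> X \<Longrightarrow> r j \<noteq> j"
      "\<And>g j. g \<in> G \<Longrightarrow> g (r j) = r (g j)" "\<And>j k. j \<in> X \<Longrightarrow> k \<in> X \<Longrightarrow> cross j k \<longleftrightarrow> k = r j"
proof -
  define rel where "rel = {(j, k). j \<in> X \<and> k \<in> X \<and> cross j k}"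
  have cross_sym: "cross j k \<Longrightarrow> cross k j" for j k unfolding cross_def by metis
  have cross_g: "cross (g j) (g k)" if "cross j k" "g \<in> G" for g j k
    unfolding cross_def
  proof
    fix h assume h: "h \<in> G"
    have "h \<circ> g \<in> G" using comp_mem[OF h that(2)] .
    then show "side (h (g j)) \<noteq> side (h (g k))" using that(1) unfolding cross_def by fastforce
  qed
  have nc: "\<not> cross j j" for j unfolding cross_def using id_mem by blast
  define R where "R j k \<longleftrightarrow> (j, k) \<in> rel\<^sup>*" for j k
  have "sym rel" unfolding sym_def rel_def using cross_sym by blast
  then have symR: "sym (rel\<^sup>*)" by (rule sym_rtrancl)
  consider "\<forall>j\<in>X. card {k \<in> X. R j k} = 1" | "\<forall>j\<in>X. card {k \<in> X. R j k} = 2" | "\<forall>j\<in>X. \<forall>k\<in>X. R j k"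
  proof -
    have "(\<forall>j\<in>X. card {k \<in> X. R j k} = 1) \<or> (\<forall>j\<in>X. card {k \<in> X. R j k} = 2) \<or> (\<forall>j\<in>X. \<forall>k\<in>X. R j k)"
    proof (rule class_card)
      show "R (g j) (g k)" if g: "g \<in> G" and "j \<in> X" "k \<in> X" "R j k" for g j k
        using \<open>R j k\<close> unfolding R_def
      proof (induction rule: rtrancl_induct)
        case (step k l)
        then have "(g k, g l) \<in> rel" unfolding rel_def using cross_g[OF _ g] mem_X[OF g] by auto
        then show ?case using step by simp
      qed simp
      show "R k j" if "R j k" for j k using that symR unfolding R_def sym_def by blast
    qed (auto simp: R_def)
    then show thesis using that by blast
  qed
  then show thesis
  proof cases
    case 1
    have "\<not> cross j k" if "j \<in> X" "k \<in> X" for j k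
    proof
      assume c: "cross j k"
      then have "(j, k) \<in> rel" unfolding rel_def using that by blast
      then have "{j, k} \<subseteq> {k \<in> X. R j k}" using that unfolding R_def by auto
      then have "card {j, k} \<le> 1" using 1 that finX card_mono[of "{k \<in> X. R j k}" "{j, k}"] by auto
      then show False using c nc by (cases "j = k") auto
    qed
    then show thesis by (rule that(1))
  next
    case 2
    have ex: "\<exists>!k. k \<in> X \<and> cross j k" if j: "j \<in> X" for j
    proof -
      have jm: "j \<in> {k \<in> X. R j k}" using j unfolding R_def by blast
      obtain u v where uv: "{k \<in> X. R j k} = {u, v}" "u \<noteq> v" using 2 j by (metis card_2_iff)
      obtain k where k: "{k \<in> X. R j k} = {j, k}" "k \<noteq> j"
        using uv jm by (cases "j = u") auto
      have kX: "k \<in> X" "(j, k) \<in> rel\<^sup>*" using k(1) unfolding R_def by auto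
      obtain l where l: "(j, l) \<in> rel" using converse_rtranclE[OF kX(2)] k(2) by metis
      then have lX: "l \<in> X" "cross j l" unfolding rel_def by auto
      have uniq: "l = k" if "l \<in> X" "cross j l" for l
      proof -
        have "l \<in> {k \<in> X. R j k}" using that j unfolding R_def rel_def by auto
        moreover have "l \<noteq> j" using that(2) nc by metis
        ultimately show ?thesis unfolding k(1) by simp
      qed
      have "cross j k" using lX uniq[OF lX] by simp
      show ?thesis
      proof (rule ex1I[of _ k])
        show "k \<in> X \<and> cross j k" using kX(1) \<open>cross j k\<close> by blast
        show "l = k" if "l \<in> X \<and> cross j l" for l using uniq that by simp
      qed
    qed
    define r where "r j = (if j \<in> X then THE k. k \<in> X \<and> cross j k else j)" for j
    have r: "r j \<in> X" "cross j (r j)" if "j \<in> X" for j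
      using theI'[OF ex[OF that]] that unfolding r_def by auto
    have r_unique: "k = r j" if "j \<in> X" "k \<in> X" "cross j k" for j k
      using ex[OF that(1)] r[OF that(1)] that by blast
    have rr: "r (r j) = j" for j
    proof (cases "j \<in> X")
      case True
      then show ?thesis using r_unique[OF r(1) True cross_sym[OF r(2)]] by metis
    qed (simp add: r_def)
    show thesis
    proof (rule that(2))
      show "r permutes X"
      proof (rule bij_imp_permutes)
        show "bij_betw r X X"
          by (rule bij_betw_byWitness[where f' = r]) (use rr r(1) in auto)
      qed (simp add: r_def)
      show "r (r j) = j" for j by (rule rr)
      show "r j \<noteq> j" if "j \<in> X" for j using r(2)[OF that] nc by metis
      show "g (r j) = r (g j)" if "g \<in> G" for g j
      proof (cases "j \<in> X")
        case True
        then show ?thesis using r_unique[OF mem_X mem_X] r[OF True] cross_g that by blast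
      next
        case False
        then show ?thesis using mem_X_iff[OF that] by (simp add: r_def)
      qed
      show "cross j k \<longleftrightarrow> k = r j" if "j \<in> X" "k \<in> X" for j k
        using r_unique[OF that] r(2)[OF that(1)] by blast
    qed
  next
    case 3
    have const: "side j = side (g j) \<longleftrightarrow> side k = side (g k)" if "(j, k) \<in> rel\<^sup>*" and g: "g \<in> G" for j k g
      using that(1)
    proof (induction rule: rtrancl_induct)
      case (step k l)
      then have c: "cross k l" unfolding rel_def by blast
      have "side (id k) \<noteq> side (id l)" using c id_mem unfolding cross_def by blast
      moreover have "side (g k) \<noteq> side (g l)" using c g unfolding cross_def by blast
      ultimately show ?case using step.IH by auto
    qed simp
    define S where "S = {j \<in> X. side j}"
    have "g ` S = S \<or> g ` S = X - S" if g: "g \<in> G" for g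
    proof -
      define s where "s \<longleftrightarrow> (side o1 \<longleftrightarrow> side (g o1))"
      have s: "(side j \<longleftrightarrow> side (g j)) \<longleftrightarrow> s" if "j \<in> X" for j
        unfolding s_def using const[OF _ g] 3 o(2) that unfolding R_def by blast
      have mem: "j \<in> g ` S \<longleftrightarrow> j \<in> X \<and> (side j \<longleftrightarrow> s)" for j
      proof
        assume "j \<in> g ` S"
        then obtain k where "k \<in> X" "side k" "j = g k" unfolding S_def by blast
        then show "j \<in> X \<and> (side j \<longleftrightarrow> s)" using s[of k] mem_X[OF g] by auto
      next
        assume j: "j \<in> X \<and> (side j \<longleftrightarrow> s)"
        have k: "inv' g j \<in> X" "g (inv' g j) = j" using g inv_mem mem_X j by auto
        then have "side (inv' g j)" using s[OF k(1)] j by auto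
        then show "j \<in> g ` S" unfolding S_def using k by (metis (mono_tags, lifting) image_eqI mem_Collect_eq)
      qed
      show ?thesis
      proof (cases s)
        case True
        then have "g ` S = S" using mem unfolding S_def by blast
        then show ?thesis ..
      next
        case False
        then have "g ` S = X - S" using mem unfolding S_def by blast
        then show ?thesis ..
      qed
    qed
    moreover have "S \<subseteq> X" unfolding S_def by blast
    moreover have "pt True 0 \<in> S" "pt False 0 \<notin> S" unfolding S_def using pt_mem side_pt by auto
    then have "S \<noteq> {}" "S \<noteq> X" using pt_mem by blast+
    ultimately have False using no_split by blast
    then show thesis ..
  qed
qed

end

section \<open>Blocks of size two\<close>

lemma funpow_closed: "(\<And>x. x \<in> Y \<Longrightarrow> g x \<in> Y) \<Longrightarrow> x \<in> Y \<Longrightarrow> (g ^^ n) x \<in> Y"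
  by (induction n) auto

lemma permutes_restrict:
  assumes h: "h permutes X" and Y: "Y \<subseteq> X" "finite X" and closed: "\<And>x. x \<in> Y \<Longrightarrow> h x \<in> Y"
  shows "(\<lambda>x. if x \<in> Y then h x else x) permutes X"
proof -
  have "inj_on h Y" using permutes_inj_on[OF h] .
  moreover have "h ` Y \<subseteq> Y" using closed by blast
  ultimately have "bij_betw h Y Y"
    using Y finite_subset endo_inj_surj unfolding bij_betw_def by metis
  then have "bij_betw (\<lambda>x. if x \<in> Y then h x else x) Y Y"
    by (rule bij_betw_cong[THEN iffD1, rotated]) simp
  then have "(\<lambda>x. if x \<in> Y then h x else x) permutes Y" by (rule bij_imp_permutes) simp
  then show ?thesis using Y(1) by (rule permutes_subset)
qed

text \<open>Orbits of \<open>g\<close> are added to \<open>Y\<close> one by one. Since no power of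
  \<open>g\<close> takes a point to its partner, an orbit is disjoint from its image under
  \<open>r\<close>.\<close>

lemma half_invariant_set:
  assumes X: "finite X" and g: "g permutes X" and r: "\<And>j. r (r j) = j" "\<And>j. j \<in> X \<Longrightarrow> r j \<in> X"
    and comm: "\<And>j. g (r j) = r (g j)" and free: "\<And>j n. j \<in> X \<Longrightarrow> (g ^^ n) j \<noteq> r j"
  shows "\<exists>Y\<subseteq>X. (\<forall>j\<in>Y. g j \<in> Y) \<and> Y \<inter> r ` Y = {} \<and> Y \<union> r ` Y = X"
proof -
  have ext: "\<exists>Y\<subseteq>X. (\<forall>j\<in>Y. g j \<in> Y) \<and> Y \<inter> r ` Y = {} \<and> Y \<union> r ` Y = X"
    if "Y \<subseteq> X" "\<forall>j\<in>Y. g j \<in> Y" "Y \<inter> r ` Y = {}" for Y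
    using that
  proof (induction "card (X - (Y \<union> r ` Y))" arbitrary: Y rule: less_induct)
    case less
    have rYX: "r ` Y \<subseteq> X" using less.prems(1) r(2) by blast
    show ?case
    proof (cases "Y \<union> r ` Y = X")
      case False
      then obtain j where j: "j \<in> X" "j \<notin> Y" "j \<notin> r ` Y" using less.prems(1) rYX by blast
      obtain N where N: "N > 0" "g ^^ N = id"
        using perm_group.finite_order[of X "{h. h permutes X}" g] g X
        by (auto simp: perm_group_def permutes_compose permutes_inv permutes_id)
      have gmod: "g ^^ n = g ^^ (n mod N)" for n using funpow_mod_id[of N g _ n] N(2) by (auto simp: fun_eq_iff)
      define Orb where "Orb = range (\<lambda>n. (g ^^ n) j)"
      have gO: "g x \<in> Orb" if x: "x \<in> Orb" for x
      proof -
        obtain n where "x = (g ^^ n) j" using x unfolding Orb_def by blast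
        then have "g x = (g ^^ Suc n) j" by simp
        then show ?thesis unfolding Orb_def by blast
      qed
      have jO: "j \<in> Orb" unfolding Orb_def by (rule range_eqI[of _ _ 0]) simp
      have OX: "Orb \<subseteq> X" unfolding Orb_def using j(1) permutes_in_image[OF g] funpow_closed[of X g j] by auto
      have reach: "j \<in> W" if "(g ^^ n) j \<in> W" "\<And>x. x \<in> W \<Longrightarrow> g x \<in> W" for n W
      proof -
        have "(g ^^ (n * N - n)) ((g ^^ n) j) \<in> W" using funpow_closed[of W g] that by blast
        moreover have "n * N - n + n = n * N" using N(1) by (cases N) auto
        then have "(g ^^ (n * N - n)) ((g ^^ n) j) = (g ^^ (n * N)) j"
          by (metis comp_apply funpow_add)
        moreover have "g ^^ (n * N) = id" using gmod[of "n * N"] by simp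
        ultimately show ?thesis by simp
      qed
      have grY: "g x \<in> r ` Y" if "x \<in> r ` Y" for x using that less.prems(2) comm by auto
      have OrO: "Orb \<inter> r ` Orb = {}"
      proof (rule ccontr)
        assume "Orb \<inter> r ` Orb \<noteq> {}"
        then obtain x where x: "x \<in> Orb" "r x \<in> Orb" by auto
        then obtain m n where mn: "(g ^^ m) j = r ((g ^^ n) j)" unfolding Orb_def by (elim rangeE) metis
        have "j \<in> r ` Orb"
        proof (rule reach[of m])
          show "(g ^^ m) j \<in> r ` Orb" unfolding mn Orb_def by blast
          show "g x \<in> r ` Orb" if "x \<in> r ` Orb" for x using that gO comm by auto
        qed
        then obtain x where x: "x \<in> Orb" "j = r x" by (rule imageE)
        then obtain n where "x = (g ^^ n) j" unfolding Orb_def by (elim rangeE)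
        then have "j = r ((g ^^ n) j)" using x(2) by simp
        then have "(g ^^ n) j = r j" using r(1) by metis
        then show False using free[OF j(1)] by blast
      qed
      have OrY: "Orb \<inter> r ` Y = {}" using reach[of _ "r ` Y"] grY j(3) unfolding Orb_def by blast
      have YrO: "Y \<inter> r ` Orb = {}"
      proof (rule ccontr)
        assume "Y \<inter> r ` Orb \<noteq> {}"
        then obtain x where "x \<in> Orb" "r x \<in> Y" by blast
        then have "x \<in> r ` Y" using r(1) by (metis image_eqI)
        then show False using OrY \<open>x \<in> Orb\<close> by blast
      qed
      let ?Y = "Y \<union> Orb"
      show ?thesis
      proof (rule less.hyps)
        have "j \<in> X - (Y \<union> r ` Y)" "j \<notin> X - (?Y \<union> r ` ?Y)" using j jO by auto
        then have "X - (?Y \<union> r ` ?Y) \<subset> X - (Y \<union> r ` Y)" by blast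
        then show "card (X - (?Y \<union> r ` ?Y)) < card (X - (Y \<union> r ` Y))"
          by (rule psubset_card_mono[OF finite_Diff[OF X]])
        show "?Y \<subseteq> X" using less.prems(1) OX by blast
        show "\<forall>j\<in>?Y. g j \<in> ?Y" using less.prems(2) gO by blast
        show "?Y \<inter> r ` ?Y = {}" unfolding image_Un using less.prems(3) OrO OrY YrO by blast
      qed
    qed (use less.prems in blast)
  qed
  show ?thesis by (rule ext[of "{}"]) auto
qed

text \<open>Removing the transposition of \<open>e\<close> and \<open>r e\<close> leaves a
  permutation \<open>h\<close> that acts as some \<open>k\<close> on a half \<open>Y\<close> and as
  the conjugate of \<open>k\<close> by \<open>r\<close> on the other half, hence is even.\<close>

lemma sign_swapping_one_pair:
  assumes X: "finite X" and g: "g permutes X" and r: "r permutes X" "\<And>j. r (r j) = j" "\<And>j. j \<in> X \<Longrightarrow> r j \<noteq> j"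
    and comm: "\<And>j. g (r j) = r (g j)" and e: "e \<in> X" "g e = r e"
    and free: "\<And>j n. j \<in> X - {e, r e} \<Longrightarrow> (g ^^ n) j \<noteq> r j"
  shows "sign g = - 1"
proof -
  let ?X' = "X - {e, r e}"
  define h where "h = transpose e (r e) \<circ> g"
  have ginj: "g x = g y \<longleftrightarrow> x = y" for x y using permutes_inj[OF g] by (simp add: inj_eq)
  have gre: "g (r e) = e" using comm e(2) r(2) by simp
  have ree: "r e \<noteq> e" using r(3) e(1) by blast
  have he: "h e = e" "h (r e) = r e" unfolding h_def using e(2) gre by auto
  have hg: "h j = g j" if "j \<noteq> e" "j \<noteq> r e" for j
  proof -
    have "g j \<noteq> r e" "g j \<noteq> e" using that ginj e(2) gre by metis+
    then show ?thesis unfolding h_def by simp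
  qed
  have perm_r: "permutation r" "permutation g" using r(1) g X permutation_permutes by blast+
  have reX: "r e \<in> X" using permutes_in_image[OF r(1)] e(1) by blast
  have tp: "transpose e (r e) permutes X" using permutes_swap_id[OF e(1) reX] .
  have hX: "h permutes X" unfolding h_def using permutes_compose[OF g tp] .
  have hX': "h permutes ?X'"
  proof (rule permutes_superset[OF hX])
    show "h x = x" if "x \<in> X - ?X'" for x using that he by auto
  qed
  have rX': "r j \<in> ?X'" if "j \<in> ?X'" for j
    using that r(2) permutes_in_image[OF r(1)] by (metis DiffE DiffI insert_iff singletonD)
  have hcomm: "h (r j) = r (h j)" for j
  proof (cases "j = e \<or> j = r e")
    case True
    then show ?thesis using he r(2) by auto
  next
    case False
    then have "r j \<noteq> e" "r j \<noteq> r e" using r(2) by metis+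
    then show ?thesis using hg False comm by simp
  qed
  have hpow: "(h ^^ n) j = (g ^^ n) j \<and> (h ^^ n) j \<in> ?X'" if "j \<in> ?X'" for j n
  proof (induction n)
    case (Suc n)
    then have "h ((h ^^ n) j) = g ((h ^^ n) j)" by (intro hg) auto
    moreover have "h ((h ^^ n) j) \<in> ?X'" using Suc permutes_in_image[OF hX'] by blast
    ultimately show ?case using Suc by simp
  qed (use that in simp)
  have "\<exists>Y\<subseteq>?X'. (\<forall>j\<in>Y. h j \<in> Y) \<and> Y \<inter> r ` Y = {} \<and> Y \<union> r ` Y = ?X'"
    using X hX' r(2) rX' hcomm hpow free by (intro half_invariant_set) auto
  then obtain Y where Y: "Y \<subseteq> ?X'" "\<And>j. j \<in> Y \<Longrightarrow> h j \<in> Y" "Y \<inter> r ` Y = {}" "Y \<union> r ` Y = ?X'" by metis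
  define k where "k x = (if x \<in> Y then h x else x)" for x
  have kp: "k permutes X" unfolding k_def by (rule permutes_restrict[OF hX _ X Y(2)]) (use Y(1) in blast)
  have "h x = (k \<circ> (r \<circ> k \<circ> r)) x" for x
  proof -
    consider "x \<in> Y" | "x \<in> r ` Y" | "x \<notin> ?X'" using Y(4) by blast
    then show ?thesis
    proof cases
      case 1
      then have "r x \<notin> Y" using Y(3) r(2) by (metis disjoint_iff image_eqI)
      then show ?thesis using 1 by (simp add: k_def r(2))
    next
      case 2
      then obtain y where y: "y \<in> Y" "x = r y" by blast
      have "r (h y) \<notin> Y" using Y(2)[OF y(1)] Y(3) by blast
      then show ?thesis using y by (simp add: k_def r(2) hcomm)
    next
      case 3
      then have "h x = x" using permutes_not_in[OF hX'] by blast
      moreover have "x \<notin> Y" using 3 Y(1) by blast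
      moreover have "r x \<notin> Y"
      proof
        assume "r x \<in> Y"
        then have "r (r x) \<in> r ` Y" by blast
        then show False using 3 Y(4) r(2) by auto
      qed
      ultimately show ?thesis by (simp add: k_def r(2))
    qed
  qed
  then have "h = k \<circ> (r \<circ> k \<circ> r)" by blast
  moreover have pk: "permutation k" using kp X permutation_permutes by blast
  ultimately have "sign h = sign k * (sign r * sign k * sign r)"
    using perm_r(1) by (simp add: sign_compose permutation_compose)
  also have "\<dots> = (sign k * sign k) * (sign r * sign r)" by (simp only: ac_simps)
  finally have "sign h = 1" by simp
  moreover have "sign h = - sign g"
    unfolding h_def sign_compose[OF permutation_swap_id perm_r(2)] sign_swap_id using ree by simp
  ultimately show ?thesis by simp
qed

text \<open>Closure under composition is enough here, because inverses in a finite group are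
  powers.\<close>

locale deg2p_generated = deg2p_cyclic +
  assumes generated: "H \<subseteq> G \<Longrightarrow> id \<in> H \<Longrightarrow> (\<And>g h. g \<in> H \<Longrightarrow> h \<in> H \<Longrightarrow> g \<circ> h \<in> H)
    \<Longrightarrow> (\<And>z i. fixing_fam z \<Longrightarrow> i \<in> X \<Longrightarrow> z i \<in> H) \<Longrightarrow> H = G"

section \<open>Small and regular families\<close>

locale deg2p_blocks = deg2p_generated +
  fixes r :: "'a \<Rightarrow> 'a"
  assumes r_perm: "r permutes X" and rr [simp]: "r (r j) = j" and r_ne: "j \<in> X \<Longrightarrow> r j \<noteq> j"
    and r_comm: "g \<in> G \<Longrightarrow> g (r j) = r (g j)"
    and r_cross: "j \<in> X \<Longrightarrow> k \<in> X \<Longrightarrow> cross j k \<longleftrightarrow> k = r j"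
begin

lemma rX: "r j \<in> X \<longleftrightarrow> j \<in> X" using permutes_in_image[OF r_perm] by blast

lemma r_inj: "r j = r k \<longleftrightarrow> j = k" using rr by metis

definition small :: "('a \<Rightarrow> 'a \<Rightarrow> 'a) \<Rightarrow> bool"
  where "small z \<longleftrightarrow> (\<forall>i\<in>X. \<forall>j\<in>X. z i j = j \<or> z i j = r j)"

definition regular :: "('a \<Rightarrow> 'a \<Rightarrow> 'a) \<Rightarrow> bool"
  where "regular z \<longleftrightarrow> fixing_fam z \<and> (\<forall>j\<in>X. \<forall>k\<in>X. k \<noteq> j \<longrightarrow> k \<noteq> r j \<longrightarrow> (\<exists>!i. i \<in> X \<and> z i j = k))
    \<and> (\<forall>i\<in>X. \<forall>j\<in>X. z i j = j \<longleftrightarrow> i = j \<or> i = r j) \<and> (\<forall>i\<in>X. \<forall>j\<in>X. z i j \<noteq> r j)"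

lemma fixing_r:
  assumes "fixing_fam z" "i \<in> X" shows "z i (r i) = r i" "z (r i) i = i"
proof -
  have fixz: "z i i = i" "z i \<in> G" if "i \<in> X" for i
    using assms(1) that conj_fam_mem unfolding fixing_fam_def by blast+
  show "z i (r i) = r i" using r_comm[OF fixz(2)] fixz(1) assms(2) by simp
  have ri: "r i \<in> X" using rX assms(2) by blast
  have "z (r i) (r (r i)) = r (z (r i) (r i))" using r_comm[OF fixz(2)[OF ri]] by blast
  then show "z (r i) i = i" using fixz(1)[OF ri] by simp
qed

text \<open>As \<open>r\<close> commutes with \<open>G\<close>, the two diagonal blocks of
  \<open>M\<close> agree, so \<open>M\<close> has a single value \<open>c\<close>, half the trace,
  on all pairs from different blocks of size two. Rows sum to \<open>2 * p\<close>, and a diagonal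
  entry is at least \<open>2\<close>, from the indices \<open>j\<close> and \<open>r j\<close>.
  Hence \<open>c\<close> is \<open>0\<close> or \<open>1\<close>, and these are the two
  alternatives.\<close>

lemma small_or_regular:
  assumes z: "fixing_fam z" shows "small z \<or> regular z"
proof -
  have zc: "conj_fam z" and zi: "\<And>i. i \<in> X \<Longrightarrow> z i i = i" using z unfolding fixing_fam_def by auto
  define M where "M = cmat z"
  have gM: "ginv M" unfolding M_def by (rule ginv_cmat[OF zc])
  have Mr: "M (r j) (r k) = M j k" for j k
    unfolding M_def cmat_def using r_comm[OF conj_fam_mem[OF zc]] r_inj
    by (intro arg_cong[of _ _ "\<lambda>S. int (card S)"] Collect_cong conj_cong refl) metis
  have "side (id (pt False 0)) \<noteq> side (id (r (pt False 0)))"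
    using r_cross[OF pt_mem, of "r (pt False 0)" False 0] rX pt_mem id_mem unfolding cross_def by blast
  then have "side (r (pt False 0))" using side_pt[of False 0] by simp
  then obtain t where t: "r (pt False 0) = pt True t" unfolding side_def by blast
  \<comment> \<open>In the coordinates of the two orbits of \<open>a\<close>, the matching is
    translation by \<open>t\<close>.\<close>
  have rpt: "r (pt False x) = pt True (t + x)" for x
  proof -
    have "pt False x = (a ^^ nat (x mod int p)) (pt False 0)"
      unfolding a_pt by (rule pt_mod) (use p_pos in simp)
    then have "r (pt False x) = (a ^^ nat (x mod int p)) (r (pt False 0))" using r_comm[OF a_mem] by simp
    also have "\<dots> = pt True (t + x mod int p)" unfolding t a_pt using p_pos by simp
    also have "\<dots> = pt True (t + x)" by (rule pt_mod) (simp add: mod_add_right_eq)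
    finally show ?thesis .
  qed
  have TT: "blk M True True x = blk M False False x" for x
  proof -
    have "blk M True True x = M (pt True t) (pt True (t + x))" using blk_shift[OF gM, of True t True "t + x"] by simp
    also have "\<dots> = M (r (pt False 0)) (r (pt False x))" unfolding rpt by simp
    finally show ?thesis unfolding Mr by (simp add: blk_def)
  qed
  define c where "c = blk M False False 1"
  have bc: "blk M b b x = c" if "\<not> int p dvd x" for b x
  proof -
    have "2 * blk M False False x = 2 * c"
      using trace_cmat(1)[OF z that] TT unfolding tr_def M_def[symmetric] c_def by simp
    then show ?thesis using TT by (cases b) auto
  qed
  have Mc: "M j k = c" if jk: "j \<in> X" "k \<in> X" "k \<noteq> j" "k \<noteq> r j" for j k
  proof -
    have "\<not> cross j k" using r_cross[OF jk(1,2)] jk(4) by blast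
    then obtain b x where bx: "\<not> int p dvd x" "\<And>A. ginv A \<Longrightarrow> A j k = blk A b b x"
      using not_cross_in_block jk by metis
    show ?thesis unfolding bx(2)[OF gM] by (rule bc[OF bx(1)])
  qed
  have row: "M j j + M j (r j) + (2 * int p - 2) * c = 2 * int p" if j: "j \<in> X" for j
  proof -
    have "2 * int p = (\<Sum>k\<in>X. M j k)" unfolding M_def using cmat_row_sum[OF zc j] cardX by simp
    also have "\<dots> = M j j + (M j (r j) + (\<Sum>k\<in>X - {j} - {r j}. M j k))"
      using sum.remove[OF finX j, of "M j"] sum.remove[of "X - {j}" "r j" "M j"] finX j rX r_ne[OF j] by simp
    also have "(\<Sum>k\<in>X - {j} - {r j}. M j k) = (\<Sum>k\<in>X - {j} - {r j}. c)"
      using Mc[OF j] by (intro sum.cong) auto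
    also have "\<dots> = int (2 * p - 2) * c"
      using finX j rX r_ne[OF j] cardX by (simp add: numeral_2_eq_2)
    also have "int (2 * p - 2) = 2 * int p - 2" using p_pos by (simp add: of_nat_diff)
    finally show ?thesis by simp
  qed
  have Mjj: "M j j \<ge> 2" if j: "j \<in> X" for j
  proof -
    have "{j, r j} \<subseteq> {i \<in> X. z i j = j}" using j zi fixing_r(2)[OF z] rX by auto
    then have "card {j, r j} \<le> card {i \<in> X. z i j = j}" using finX by (intro card_mono) auto
    then show ?thesis unfolding M_def cmat_def using r_ne[OF j] by simp
  qed
  have M0: "M j k \<ge> 0" for j k unfolding M_def cmat_def by simp
  have x0: "pt False 0 \<in> X" by (rule pt_mem)
  have "(2 * int p - 2) * c \<le> (2 * int p - 2) * 1" using row[OF x0] Mjj[OF x0] M0[of "pt False 0" "r (pt False 0)"] by simp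
  then have "c \<le> 1" using p(2) by (simp add: mult_le_cancel_left_pos)
  moreover have "c \<ge> 0" unfolding c_def blk_def by (rule M0)
  ultimately consider "c = 0" | "c = 1" by linarith
  then show ?thesis
  proof cases
    case 1
    have "z i j = j \<or> z i j = r j" if ij: "i \<in> X" "j \<in> X" for i j
    proof (rule ccontr)
      assume a: "\<not> ?thesis"
      have zX: "z i j \<in> X" using mem_X[OF conj_fam_mem[OF zc ij(1)] ij(2)] .
      have "M j (z i j) = 0" using Mc[OF ij(2) zX] a 1 by blast
      then have "card {i' \<in> X. z i' j = z i j} = 0" unfolding M_def cmat_def by simp
      then have "{i' \<in> X. z i' j = z i j} = {}" using finX by simp
      then show False using ij(1) by blast
    qed
    then show ?thesis unfolding small_def by blast
  next
    case 2
    have d: "M j j = 2" "M j (r j) = 0" if j: "j \<in> X" for j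
      using row[OF j] Mjj[OF j] M0[of j "r j"] 2 by auto
    have "\<exists>!i. i \<in> X \<and> z i j = k" if jk: "j \<in> X" "k \<in> X" "k \<noteq> j" "k \<noteq> r j" for j k
    proof -
      have "card {i \<in> X. z i j = k} = 1" using Mc[OF jk] 2 unfolding M_def cmat_def by simp
      then obtain i where "{i \<in> X. z i j = k} = {i}" by (rule card_1_singletonE)
      then show ?thesis by (metis (mono_tags, lifting) mem_Collect_eq singletonD singletonI)
    qed
    moreover have "z i j = j \<longleftrightarrow> i = j \<or> i = r j" if ij: "i \<in> X" "j \<in> X" for i j
    proof -
      have "card {i \<in> X. z i j = j} = 2" using d(1)[OF ij(2)] unfolding M_def cmat_def by simp
      moreover have "{j, r j} \<subseteq> {i \<in> X. z i j = j}" using ij zi fixing_r(2)[OF z] rX by auto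
      moreover have "card {j, r j} = 2" using r_ne[OF ij(2)] by simp
      ultimately have "{j, r j} = {i \<in> X. z i j = j}" using finX by (intro card_subset_eq) auto
      then show ?thesis using ij(1) by blast
    qed
    moreover have "z i j \<noteq> r j" if ij: "i \<in> X" "j \<in> X" for i j
    proof -
      have "{i \<in> X. z i j = r j} = {}" using d(2)[OF ij(2)] finX unfolding M_def cmat_def by simp
      then show ?thesis using ij(1) by blast
    qed
    ultimately have "regular z" unfolding regular_def using z by blast
    then show ?thesis ..
  qed
qed

end

section \<open>Flips, the kernel of the action on the blocks\<close>

context deg2p_blocks
begin

lemma regular_unique:
  "regular z \<Longrightarrow> j \<in> X \<Longrightarrow> k \<in> X \<Longrightarrow> k \<noteq> j \<Longrightarrow> k \<noteq> r j \<Longrightarrow> i \<in> X \<Longrightarrow> i' \<in> X \<Longrightarrow> z i j = k \<Longrightarrow> z i' j = k \<Longrightarrow> i = i'"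
  unfolding regular_def by blast

lemma regular_exists:
  assumes "regular z" "j \<in> X" "k \<in> X" "k \<noteq> j" "k \<noteq> r j"
  obtains i where "i \<in> X" "z i j = k"
  using assms unfolding regular_def by blast

lemma regular_fixes: "regular z \<Longrightarrow> i \<in> X \<Longrightarrow> j \<in> X \<Longrightarrow> z i j = j \<longleftrightarrow> i = j \<or> i = r j"
  unfolding regular_def by blast

lemma regular_ne: "regular z \<Longrightarrow> i \<in> X \<Longrightarrow> j \<in> X \<Longrightarrow> z i j \<noteq> r j"
  unfolding regular_def by blast

lemma regular_fam: "regular z \<Longrightarrow> fixing_fam z"
  unfolding regular_def by blast

definition flips :: "('a \<Rightarrow> 'a) set"
  where "flips = {k \<in> G. \<forall>j\<in>X. k j = j \<or> k j = r j}"

definition fixed :: "('a \<Rightarrow> 'a) \<Rightarrow> 'a set"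
  where "fixed k = {j \<in> X. k j = j}"

lemma flip_cases: "k \<in> flips \<Longrightarrow> j \<in> X \<Longrightarrow> k j = (if j \<in> fixed k then j else r j)"
  unfolding flips_def fixed_def by auto

lemma fixed_r: "k \<in> flips \<Longrightarrow> r j \<in> fixed k \<longleftrightarrow> j \<in> fixed k"
  using r_comm[of k j] rX r_inj unfolding flips_def fixed_def by simp

lemma third_point: obtains k where "k \<in> X" "k \<noteq> j" "k \<noteq> r j"
proof -
  have "\<not> X \<subseteq> {j, r j}"
  proof
    assume "X \<subseteq> {j, r j}"
    then have "card X \<le> card {j, r j}" by (intro card_mono) auto
    also have "\<dots> \<le> 2" by (simp add: card_insert_if)
    finally show False using cardX p(2) by simp
  qed
  then show thesis using that by blast
qed

lemma fixed_sub: "fixed k \<subseteq> X" unfolding fixed_def by blast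

lemma fam_comm:
  assumes "fixing_fam z" "h \<in> G" "i \<in> X" "h i = i" shows "h (z i j) = z i (h j)"
  using conj_fam_apply[of z h i j] assms unfolding fixing_fam_def by simp

lemma regular_preserves_fixed:
  assumes z: "fixing_fam z" and k: "k \<in> flips" and i: "i \<in> fixed k" and j: "j \<in> X"
  shows "z i j \<in> fixed k \<longleftrightarrow> j \<in> fixed k"
proof -
  have iX: "i \<in> X" "k i = i" "k \<in> G" using i k unfolding fixed_def flips_def by auto
  have zG: "z i \<in> G" using z iX conj_fam_mem unfolding fixing_fam_def by blast
  have "k (z i j) = z i (k j)" using fam_comm[OF z iX(3,1,2)] .
  then show ?thesis unfolding fixed_def using j mem_X[OF zG j] inj_G[OF zG] by auto
qed

text \<open>Each point outside \<open>fixed k\<close> is \<open>z i' j\<close> for some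
  \<open>i'\<close>, and \<open>i'\<close> lies outside too, since indices in \<open>fixed k\<close>
  preserve this set. So the indices outside are mapped onto the points outside, and by finiteness
  nowhere else.\<close>

lemma regular_moves_fixed:
  assumes z: "regular z" and k: "k \<in> flips" and i: "i \<in> X" "i \<notin> fixed k" and j: "j \<in> fixed k"
  shows "z i j \<notin> fixed k"
proof -
  define A where "A = X - fixed k"
  have jX: "j \<in> X" using j fixed_sub by blast
  have "A \<subseteq> (\<lambda>i. z i j) ` A"
  proof
    fix l assume l: "l \<in> A"
    then have "l \<noteq> j" "l \<noteq> r j" using j fixed_r[OF k] unfolding A_def by auto
    then obtain i' where i': "i' \<in> X" "z i' j = l" using regular_exists[OF z jX] l unfolding A_def by blast
    have "i' \<notin> fixed k"
      using regular_preserves_fixed[OF regular_fam[OF z] k _ jX, of i'] j l i' unfolding A_def by blast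
    then show "l \<in> (\<lambda>i. z i j) ` A" using i' unfolding A_def by blast
  qed
  moreover have fin: "finite A" unfolding A_def using finX by blast
  moreover have "card ((\<lambda>i. z i j) ` A) \<le> card A" by (rule card_image_le[OF fin])
  ultimately have "A = (\<lambda>i. z i j) ` A" by (intro card_seteq) auto
  moreover have "i \<in> A" unfolding A_def using i by blast
  ultimately show ?thesis unfolding A_def by blast
qed

text \<open>A nontrivial flip \<open>k\<close> with fixed points, its conjugate \<open>k'\<close> by
  some \<open>z i\<close> and their product have fixed sets \<open>Z\<close>, \<open>Z'\<close>,
  \<open>Z2\<close> that partition \<open>X\<close>. The map from \<open>i\<close> to
  \<open>z i e\<close> injects \<open>Z'\<close> into \<open>Z2\<close> and \<open>Z2\<close> into
  \<open>Z'\<close>, so all three have equal size, and \<open>2 * p = 3 * card Z\<close>.\<close>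

lemma flip_trivial:
  assumes z: "regular z" and k: "k \<in> flips" and e: "e \<in> fixed k"
  shows "k = id"
proof (rule ccontr)
  assume "k \<noteq> id"
  have zf: "fixing_fam z" by (rule regular_fam[OF z])
  have kG: "k \<in> G" using k unfolding flips_def by blast
  obtain i where i: "i \<in> X" "i \<notin> fixed k" using \<open>k \<noteq> id\<close> eq_id_iff[OF kG] unfolding fixed_def by blast
  have zG: "z i \<in> G" if "i \<in> X" for i using zf conj_fam_mem that unfolding fixing_fam_def by blast
  define Z where "Z = fixed k"
  define Z' where "Z' = z i ` Z"
  define Z2 where "Z2 = X - (Z \<union> Z')"
  define k' where "k' = z i \<circ> k \<circ> inv' (z i)"
  have k'G: "k' \<in> G" unfolding k'_def using comp_mem inv_mem zG[OF i(1)] kG by blast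
  have ZX: "Z \<subseteq> X" unfolding Z_def by (rule fixed_sub)
  have Z'X: "Z' \<subseteq> X" unfolding Z'_def using ZX mem_X[OF zG[OF i(1)]] by blast
  have k'cases: "k' j = (if j \<in> Z' then j else r j)" if j: "j \<in> X" for j
  proof -
    define u where "u = inv' (z i) j"
    have u: "u \<in> X" "z i u = j" unfolding u_def using zG[OF i(1)] j inv_mem mem_X by auto
    have "k' j = z i (k u)" unfolding k'_def u_def by simp
    also have "\<dots> = (if u \<in> Z then j else r j)"
      unfolding flip_cases[OF k u(1)] Z_def using u(2) r_comm[OF zG[OF i(1)]] by simp
    also have "u \<in> Z \<longleftrightarrow> j \<in> Z'" unfolding Z'_def using u(2) inj_G[OF zG[OF i(1)]] by (metis image_iff)
    finally show ?thesis .
  qed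
  then have k': "k' \<in> flips" unfolding flips_def using k'G by simp
  have fk': "fixed k' = Z'" unfolding fixed_def using k'cases r_ne Z'X by (auto split: if_splits)
  have disj: "Z \<inter> Z' = {}"
    unfolding Z'_def using regular_moves_fixed[OF z k i] unfolding Z_def by blast
  define h where "h = k \<circ> k'"
  have hcases: "h j = (if j \<in> Z2 then j else r j)" if j: "j \<in> X" for j
  proof -
    have "h j = (if j \<in> Z' then k j else k (r j))" unfolding h_def using k'cases[OF j] by simp
    also have "\<dots> = (if j \<in> Z2 then j else r j)"
      using flip_cases[OF k j] flip_cases[OF k, of "r j"] rX[of j] j fixed_r[OF k, of j] disj
      unfolding Z2_def Z_def[symmetric] by auto
    finally show ?thesis .
  qed
  have hG: "h \<in> G" unfolding h_def using comp_mem kG k'G by blast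
  then have h: "h \<in> flips" unfolding flips_def using hcases by simp
  have fh: "fixed h = Z2" unfolding fixed_def using hcases r_ne unfolding Z2_def by (auto split: if_splits)
  have eZ: "e \<in> Z" using e unfolding Z_def .
  have eX: "e \<in> X" using eZ ZX by blast
  have finZ: "finite Z" "finite Z'" "finite Z2" using ZX Z'X finX finite_subset unfolding Z2_def by blast+
  have rZ: "r e \<in> Z" using fixed_r[OF k] e unfolding Z_def by blast
  have inj: "card W \<le> card W'" if "W \<subseteq> X" "finite W'" "W' \<subseteq> X" "W' \<inter> Z = {}" "\<And>i'. i' \<in> W \<Longrightarrow> z i' e \<in> W'" for W W'
  proof (rule card_inj_on_le[of "\<lambda>i. z i e"])
    show "inj_on (\<lambda>i. z i e) W"
    proof (rule inj_onI)
      fix u v assume uv: "u \<in> W" "v \<in> W" "z u e = z v e"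
      have W': "z u e \<in> W'" using that(5)[OF uv(1)] .
      then have "z u e \<notin> Z" using that(4) by (simp add: disjoint_iff)
      then have "z u e \<noteq> e" "z u e \<noteq> r e" using eZ rZ by metis+
      moreover have "z u e \<in> X" using W' that(3) by (rule subsetD[rotated])
      ultimately have "z u e \<in> X" "z u e \<noteq> e" "z u e \<noteq> r e" by simp_all
      then show "u = v"
        using regular_unique[OF z eX _ _ _ subsetD[OF that(1) uv(1)] subsetD[OF that(1) uv(2)] refl uv(3)[symmetric]] by blast
    qed
    show "(\<lambda>i. z i e) ` W \<subseteq> W'" using that(5) by (rule image_subsetI)
    show "finite W'" by (rule that(2))
  qed
  have m1: "z i' j \<in> Z'" if "i' \<in> Z2" "j \<in> Z" for i' j
  proof -
    have "z i' j \<notin> Z" using regular_moves_fixed[OF z k, of i' j] that unfolding Z_def Z2_def by blast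
    moreover have "z i' j \<notin> Z2"
      using regular_preserves_fixed[OF zf h, of i' j] that ZX unfolding fh Z2_def by blast
    moreover have "z i' j \<in> X" using mem_X[OF zG] that ZX unfolding Z2_def by blast
    ultimately show ?thesis unfolding Z2_def by blast
  qed
  have m2: "z i' j \<in> Z2" if "i' \<in> Z'" "j \<in> Z" for i' j
  proof -
    have iX: "i' \<in> X" "i' \<notin> Z" "j \<in> X" "j \<notin> Z'" using that Z'X ZX disj by blast+
    have "z i' j \<notin> Z" using regular_moves_fixed[OF z k, of i' j] that iX unfolding Z_def by blast
    moreover have "z i' j \<notin> Z'"
      using regular_preserves_fixed[OF zf k', of i' j] that iX unfolding fk' by blast
    moreover have "z i' j \<in> X" using mem_X[OF zG] iX by blast
    ultimately show ?thesis unfolding Z2_def by blast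
  qed
  have Z2X: "Z2 \<subseteq> X" unfolding Z2_def by blast
  have cZ': "card Z' = card Z" unfolding Z'_def
    using inj_G[OF zG[OF i(1)]] by (intro card_image) (auto intro: inj_onI)
  have "card Z2 \<le> card Z'" using m1 eZ disj by (intro inj[OF Z2X finZ(2) Z'X]) blast+
  moreover have "card Z' \<le> card Z2" using m2 eZ by (intro inj[OF Z'X finZ(3) Z2X]) (auto simp: Z2_def)
  moreover have "card Z + (card Z' + card Z2) = 2 * p"
  proof -
    have "Z' \<inter> Z2 = {}" "Z \<inter> (Z' \<union> Z2) = {}" "Z \<union> (Z' \<union> Z2) = X" unfolding Z2_def using ZX Z'X disj by blast+
    then show ?thesis using card_Un_disjoint[of Z "Z' \<union> Z2"] card_Un_disjoint[of Z' Z2] finZ cardX by auto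
  qed
  ultimately have "2 * p = 3 * card Z" using cZ' by simp
  then have "3 dvd 2 * p" by simp
  then have "3 dvd p" by (simp add: coprime_dvd_mult_right_iff)
  then show False using primes_dvd_imp_eq[of 3 p] p by auto
qed

section \<open>Inverses, involutions and signs\<close>

lemma regular_not_symmetric:
  assumes z: "regular z" shows "\<not> (\<forall>i\<in>X. z (r i) = z i)"
proof
  assume a: "\<forall>i\<in>X. z (r i) = z i"
  have oX: "o0 \<in> X" by (rule o(1))
  obtain k where k: "k \<in> X" "k \<noteq> o0" "k \<noteq> r o0" by (rule third_point)
  obtain i where i: "i \<in> X" "z i o0 = k" using regular_exists[OF z oX k] by blast
  have "z (r i) o0 = k" using a i by simp
  then have "r i = i" using regular_unique[OF z oX k, of "r i" i] i rX by blast
  then show False using r_ne i by blast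
qed

lemma small_trivial:
  assumes z: "regular z" and w: "fixing_fam w" "small w" and i: "i \<in> X" shows "w i = id"
proof (rule flip_trivial[OF z])
  show "w i \<in> flips" unfolding flips_def using w i conj_fam_mem unfolding fixing_fam_def small_def by blast
  show "i \<in> fixed (w i)" unfolding fixed_def using w i unfolding fixing_fam_def by blast
qed

text \<open>The products \<open>w i \<circ> w (r i)\<close> form a family that is symmetric under
  \<open>r\<close>. Such a family cannot be regular, so it is small and therefore trivial.\<close>

lemma fam_inverse:
  assumes z: "regular z" and w: "fixing_fam w" and i: "i \<in> X"
  shows "w i \<circ> w (r i) = id"
proof -
  define y where "y i = w i \<circ> w (r i)" for i
  have wc: "conj_fam w" using w unfolding fixing_fam_def by blast
  have wG: "w i \<in> G" if "i \<in> X" for i using conj_fam_mem[OF wc that] .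
  have "conj_fam y"
    unfolding conj_fam_def
  proof (intro conjI ballI)
    show "y i \<in> G" if "i \<in> X" for i unfolding y_def using comp_mem wG that rX by blast
    fix g i assume g: "g \<in> G" "i \<in> X"
    have "g (y i j) = y (g i) (g j)" for j
      unfolding y_def using conj_fam_apply[OF wc g(1)] g rX r_comm[OF g(1)] by simp
    then show "g \<circ> y i = y (g i) \<circ> g" by (simp add: fun_eq_iff)
  qed
  moreover have "y i i = i" if "i \<in> X" for i
    unfolding y_def using fixing_r(2)[OF w that] w that unfolding fixing_fam_def by simp
  ultimately have yf: "fixing_fam y" unfolding fixing_fam_def by blast
  have "y (r i) = y i" if "i \<in> X" for i
  proof -
    have "w i (w (r i) j) = w (r i) (w i j)" for j
      using conj_fam_apply[OF wc wG[OF that], of "r i" j] rX that fixing_r(1)[OF w that] by simp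
    then show ?thesis unfolding y_def by (simp add: fun_eq_iff)
  qed
  then have "\<not> regular y" using regular_not_symmetric by blast
  then have "small y" using small_or_regular[OF yf] by blast
  then show ?thesis using small_trivial[OF z yf _ i] unfolding y_def by blast
qed

text \<open>Involutivity and \<open>fam_inverse\<close> give \<open>w (r i) = w i\<close>, which
  rules out regularity.\<close>

lemma no_involutive_family:
  assumes z: "regular z" and w: "fixing_fam w" "\<And>i. i \<in> X \<Longrightarrow> w i \<circ> w i = id" and i: "i \<in> X"
  shows "w i = id"
proof (rule small_trivial[OF z w(1) _ i])
  have "w (r i) = w i" if "i \<in> X" for i
  proof -
    have "w i \<circ> w i = w i \<circ> w (r i)" using w(2)[OF that] fam_inverse[OF z w(1) that] by simp
    then show ?thesis using inj_G conj_fam_mem w(1) that unfolding fixing_fam_def by (metis comp_apply ext)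
  qed
  then show "small w" using regular_not_symmetric small_or_regular[OF w(1)] by blast
qed

lemma fixing_fam_funpow: "fixing_fam w \<Longrightarrow> fixing_fam (\<lambda>i. w i ^^ n)"
proof -
  assume w: "fixing_fam w"
  have "(w i ^^ n) i = i" if "i \<in> X" for i using w that unfolding fixing_fam_def by (induction n) auto
  then show ?thesis using w conj_fam_funpow unfolding fixing_fam_def by blast
qed

text \<open>An even exponent can be halved, as the half power is an involutive family and so
  trivial. An odd exponent makes the sign \<open>1\<close>.\<close>

lemma fam_even:
  assumes z: "regular z" and w: "fixing_fam w" and i: "i \<in> X"
  shows "sign (w i) = 1"
proof -
  obtain m where m: "m > 0" "\<And>i. i \<in> X \<Longrightarrow> w i ^^ m = id" using coprime_order[OF w] by blast
  have wG: "w i \<in> G" using w i conj_fam_mem unfolding fixing_fam_def by blast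
  have pw: "permutation (w i)" using perm[OF wG] finX permutation_permutes by blast
  from m show ?thesis
  proof (induction m rule: less_induct)
    case (less m)
    show ?case
    proof (cases "even m")
      case False
      have "sign (w i ^^ n) = sign (w i) ^ n" for n
      proof (induction n)
        case (Suc n)
        have "permutation (w i ^^ n)"
          using perm[OF funpow_mem[OF wG]] finX permutation_permutes by blast
        then have "sign (w i \<circ> w i ^^ n) = sign (w i) * sign (w i ^^ n)" by (rule sign_compose[OF pw])
        then show ?case using Suc by (simp only: funpow.simps power_Suc)
      qed (simp add: sign_id[unfolded id_def])
      then have "sign (w i) ^ m = 1" using less.prems(2)[OF i] by (metis sign_id)
      moreover have "sign (w i) = 1 \<or> sign (w i) = - 1" using sign_cases by blast
      ultimately show ?thesis using False by auto
    next
      case True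
      then obtain l where l: "m = l + l" by (metis evenE mult_2)
      have "w i ^^ l = id" if "i \<in> X" for i
      proof (rule no_involutive_family[OF z fixing_fam_funpow[OF w] _ that])
        show "w i ^^ l \<circ> w i ^^ l = id" if "i \<in> X" for i
          using less.prems(2)[OF that] unfolding l funpow_add .
      qed
      moreover have "l < m" "l > 0" using l less.prems(1) by auto
      ultimately show ?thesis using less.IH by blast
    qed
  qed
qed

text \<open>Without a regular family, all generators would be flips and \<open>G\<close> could not
  be transitive. Dividing the least exponent of a regular family by a prime gives a power that is
  not trivial, hence again regular.\<close>

lemma regular_exists_prime:
  obtains z q where "regular z" "prime q" "q \<noteq> 2" "\<And>i. i \<in> X \<Longrightarrow> z i ^^ q = id"
proof -
  have "\<exists>z. regular z"
  proof (rule ccontr)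
    assume nr: "\<not> ?thesis"
    have "flips = G"
    proof (rule generated)
      show "flips \<subseteq> G" "id \<in> flips" unfolding flips_def using id_mem by auto
      show "g \<circ> h \<in> flips" if "g \<in> flips" "h \<in> flips" for g h
      proof -
        have gh: "g \<in> G" "h \<in> G" using that unfolding flips_def by auto
        have "(g \<circ> h) j = j \<or> (g \<circ> h) j = r j" if "j \<in> X" for j
          using \<open>g \<in> flips\<close> \<open>h \<in> flips\<close> that r_comm[OF gh(1)] unfolding flips_def by fastforce
        then show ?thesis using comp_mem[OF gh] unfolding flips_def by blast
      qed
      show "w i \<in> flips" if w: "fixing_fam w" "i \<in> X" for w i
      proof -
        have "small w" using small_or_regular w nr by blast
        then show ?thesis using w conj_fam_mem unfolding flips_def small_def fixing_fam_def by blast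
      qed
    qed
    obtain k where k: "k \<in> X" "k \<noteq> o0" "k \<noteq> r o0" by (rule third_point)
    obtain g where "g \<in> G" "g o0 = k" using transitive[OF o(1) k(1)] by blast
    then show False using \<open>flips = G\<close> o(1) k unfolding flips_def by auto
  qed
  then obtain z where z: "regular z" by blast
  define P where "P m \<longleftrightarrow> m > 0 \<and> (\<forall>i\<in>X. z i ^^ m = id)" for m
  have "\<exists>m. P m" using coprime_order[OF regular_fam[OF z]] unfolding P_def by metis
  define m where "m = (LEAST m. P m)"
  have Pm: "P m" unfolding m_def using \<open>\<exists>m. P m\<close> LeastI_ex by metis
  have zne: "z i \<noteq> id" if "i \<in> X" for i
  proof
    assume a: "z i = id"
    obtain k where k: "k \<in> X" "k \<noteq> i" "k \<noteq> r i" by (rule third_point)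
    then have "i \<noteq> k" "i \<noteq> r k" using rr by metis+
    then show False using regular_fixes[OF z that k(1)] a by simp
  qed
  have "m \<noteq> 1"
  proof
    assume "m = 1"
    then have "z o0 = id" using Pm o(1) unfolding P_def by auto
    then show False using zne o(1) by blast
  qed
  then obtain q where q: "prime q" "q dvd m" using prime_factor_nat by blast
  then obtain l where l: "m = l * q" by (metis dvdE mult.commute)
  define w where "w i = z i ^^ l" for i
  have wf: "fixing_fam w" unfolding w_def by (rule fixing_fam_funpow[OF regular_fam[OF z]])
  have wq: "w i ^^ q = id" if "i \<in> X" for i
    using Pm that unfolding P_def w_def l by (simp add: funpow_mult)
  have "l > 0" "l < m" using Pm l prime_gt_1_nat[OF q(1)] unfolding P_def by auto
  then have "\<not> P l" using not_less_Least[of l P] unfolding m_def by blast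
  then obtain i where i: "i \<in> X" "w i \<noteq> id" using \<open>l > 0\<close> unfolding P_def w_def by blast
  then have "\<not> small w" using small_trivial[OF z wf] by blast
  then have "regular w" using small_or_regular[OF wf] by blast
  moreover have "q \<noteq> 2"
  proof
    assume "q = 2"
    then have "w i \<circ> w i = id" if "i \<in> X" for i using wq[OF that] by (simp add: numeral_2_eq_2)
    then show False using no_involutive_family[OF z wf _ i(1)] i(2) by blast
  qed
  ultimately show thesis using that q(1) wq by blast
qed

text \<open>All families are even, hence so is \<open>G\<close>. But no power of an element taking
  \<open>o0\<close> to \<open>r o0\<close> swaps another pair, by the count in \<open>mixed\<close>,
  so this element is odd by \<open>sign_swapping_one_pair\<close>.\<close>

theorem contradiction: False
proof -
  obtain z q where z: "regular z" and q: "prime q" "q \<noteq> 2" and zq: "\<And>i. i \<in> X \<Longrightarrow> z i ^^ q = id"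
    using regular_exists_prime by metis
  have zf: "fixing_fam z" by (rule regular_fam[OF z])
  then have zc: "conj_fam z" unfolding fixing_fam_def by blast
  have zG: "z i \<in> G" if "i \<in> X" for i using conj_fam_mem[OF zc that] .
  have even: "sign g = 1" if "g \<in> G" for g
  proof -
    have "{g \<in> G. sign g = 1} = G"
    proof (rule generated)
      show "id \<in> {g \<in> G. sign g = 1}" using id_mem by simp
      show "g \<circ> h \<in> {g \<in> G. sign g = 1}" if "g \<in> {g \<in> G. sign g = 1}" "h \<in> {g \<in> G. sign g = 1}" for g h
      proof -
        have gh: "g \<in> G" "h \<in> G" "sign g = 1" "sign h = 1" using that by auto
        have "permutation g" "permutation h" using gh perm finX permutation_permutes by blast+
        then show ?thesis using gh comp_mem by (simp add: sign_compose)
      qed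
      show "w i \<in> {g \<in> G. sign g = 1}" if "fixing_fam w" "i \<in> X" for w i
        using fam_even[OF z that] conj_fam_mem that unfolding fixing_fam_def by blast
    qed blast
    then show ?thesis using that by blast
  qed
  have rG: "h (r j) = r (h j)" if "h \<in> G" for h j using r_comm[OF that] .
  \<comment> \<open>The index \<open>i\<close> with \<open>z i j = l\<close> is unique, and
    \<open>h\<close> takes it to an index with the same property.\<close>
  have swap: "\<exists>i\<in>X. h i = i \<and> z i j = l"
    if "h \<in> G" "j \<in> X" "l \<in> X" "h j = r j" "h l = r l" and ne: "l \<noteq> j" "l \<noteq> r j" for h j l
  proof -
    obtain i where i: "i \<in> X" "z i j = l" using regular_exists[OF z \<open>j \<in> X\<close> \<open>l \<in> X\<close> ne] by blast
    have hi: "h i \<in> X" using mem_X[OF \<open>h \<in> G\<close> i(1)] .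
    have "r l = r (z (h i) j)"
      using conj_fam_apply[OF zc \<open>h \<in> G\<close> i(1), of j] i(2) that rG[OF zG[OF hi]] by simp
    then have "z (h i) j = l" using r_inj by simp
    then have "h i = i" using regular_unique[OF z \<open>j \<in> X\<close> \<open>l \<in> X\<close> ne hi i(1) _ i(2)] by blast
    then show ?thesis using i by blast
  qed
  \<comment> \<open>\<open>z i\<close> has no fixed point in \<open>N\<close> and exactly two in
    \<open>P\<close>, so \<open>card N\<close> is \<open>0\<close> and \<open>card P\<close> is
    \<open>2\<close> modulo \<open>q\<close>. On the other hand \<open>u\<close> going to
    \<open>z u j\<close> matches \<open>P\<close> with \<open>N\<close> minus one pair. Together
    \<open>4\<close> is \<open>0\<close> modulo the odd prime \<open>q\<close>.\<close>
  have mixed: False if h: "h \<in> G" and i: "i \<in> X" "h i = i" and j: "j \<in> X" "h j = r j" for h i j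
  proof -
    define P where "P = {j \<in> X. h j = j}"
    define N where "N = {j \<in> X. h j = r j}"
    have fin: "finite P" "finite N" unfolding P_def N_def using finX by auto
    have PN: "P \<inter> N = {}" unfolding P_def N_def using r_ne by auto
    have rP: "r k \<in> P \<longleftrightarrow> k \<in> P" for k
      unfolding P_def using rX rG[OF h] r_inj by simp
    have rN: "r k \<in> N \<longleftrightarrow> k \<in> N" for k
    proof -
      have "h (r k) = r (r k) \<longleftrightarrow> h k = r k" using rG[OF h] r_inj by metis
      then show ?thesis unfolding N_def using rX by blast
    qed
    have zP: "z u k \<in> P \<longleftrightarrow> k \<in> P" and zN: "z u k \<in> N \<longleftrightarrow> k \<in> N" if "u \<in> P" for u k
    proof -
      have u: "u \<in> X" "h u = u" using that unfolding P_def by auto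
      have "h (z u k) = z u (h k)" using fam_comm[OF zf h u] .
      then show "z u k \<in> P \<longleftrightarrow> k \<in> P" "z u k \<in> N \<longleftrightarrow> k \<in> N"
        unfolding P_def N_def using mem_X_iff[OF zG[OF u(1)]] inj_G[OF zG[OF u(1)]] rG[OF zG[OF u(1)], symmetric] by auto
    qed
    have iP: "i \<in> P" and jN: "j \<in> N" unfolding P_def N_def using i j by auto
    have ijr: "k \<noteq> i \<and> k \<noteq> r i" if "k \<in> N" for k using that PN iP rP by blast
    have fixN: "z i k \<noteq> k" if "k \<in> N" for k
    proof -
      have kX: "k \<in> X" using that unfolding N_def by blast
      have "i \<noteq> k" "i \<noteq> r k" using ijr[OF that] rr by metis+
      then show ?thesis using regular_fixes[OF z i(1) kX] by blast
    qed
    have cong: "[card S = card {k \<in> S. z i k = k}] (mod q)" if "S \<subseteq> X" "\<And>k. k \<in> S \<Longrightarrow> z i k \<in> S" for S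
      using that zq[OF i(1)] finX finite_subset by (intro card_cong_fixed_points q) auto
    have "[card N = card {k \<in> N. z i k = k}] (mod q)" using zN[OF iP] by (intro cong) (auto simp: N_def)
    moreover have "{k \<in> N. z i k = k} = {}" using fixN by blast
    ultimately have "[card N = card ({} :: 'a set)] (mod q)" by simp
    then have qN: "q dvd card N" by (simp add: cong_0_iff)
    have "[card P = card {k \<in> P. z i k = k}] (mod q)" using zP[OF iP] by (intro cong) (auto simp: P_def)
    moreover have "{k \<in> P. z i k = k} = {i, r i}"
    proof -
      have "z i k = k \<longleftrightarrow> k = i \<or> k = r i" if "k \<in> X" for k
        using regular_fixes[OF z i(1) that] rr by metis
      then show ?thesis using iP rP[of i] unfolding P_def by auto
    qed
    ultimately have "[card P = card {i, r i}] (mod q)" by simp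
    then have qP: "[card P = 2] (mod q)" using r_ne[OF i(1)] by (simp add: numeral_2_eq_2)
    have jX: "j \<in> X" using j by blast
    have "(\<lambda>u. z u j) ` P = N - {j, r j}"
    proof
      show "(\<lambda>u. z u j) ` P \<subseteq> N - {j, r j}"
      proof
        fix l assume "l \<in> (\<lambda>u. z u j) ` P"
        then obtain u where u: "u \<in> P" "l = z u j" by blast
        have uX: "u \<in> X" using u unfolding P_def by blast
        have "u \<noteq> j" "u \<noteq> r j" using u(1) jN rN PN by blast+
        then have "l \<noteq> j" using regular_fixes[OF z uX jX] u(2) by simp
        moreover have "l \<noteq> r j" using regular_ne[OF z uX jX] u(2) by simp
        ultimately show "l \<in> N - {j, r j}" using zN[OF u(1)] jN u(2) by simp
      qed
      show "N - {j, r j} \<subseteq> (\<lambda>u. z u j) ` P"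
      proof
        fix l assume "l \<in> N - {j, r j}"
        then have l: "l \<in> X" "h l = r l" "l \<noteq> j" "l \<noteq> r j" unfolding N_def by auto
        obtain u where "u \<in> X" "h u = u" "z u j = l" using swap[OF h jX l(1) j(2) l(2-4)] by blast
        then show "l \<in> (\<lambda>u. z u j) ` P" unfolding P_def by blast
      qed
    qed
    moreover have "inj_on (\<lambda>u. z u j) P"
    proof (rule inj_onI)
      fix u v assume uv: "u \<in> P" "v \<in> P" "z u j = z v j"
      have uX: "u \<in> X" "v \<in> X" using uv unfolding P_def by auto
      have "u \<noteq> j" "u \<noteq> r j" using uv(1) jN rN PN by blast+
      then have "z u j \<noteq> j" using regular_fixes[OF z uX(1) jX] by blast
      then show "u = v"
        using regular_unique[OF z jX mem_X[OF zG[OF uX(1)] jX] _ regular_ne[OF z uX(1) jX] uX] uv(3) by metis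
    qed
    ultimately have "card P = card (N - {j, r j})" using card_image by metis
    moreover have "{j, r j} \<subseteq> N" using jN rN by blast
    ultimately have cPN: "card P + 2 = card N"
      using r_ne[OF jX] fin card_Diff_subset[of "{j, r j}" N] card_mono[OF fin(2) \<open>{j, r j} \<subseteq> N\<close>] by auto
    have "[card P + 2 = 2 + 2] (mod q)" using qP by (rule cong_add) simp
    then have "[card N = 4] (mod q)" using cPN by simp
    then have "q dvd 2 ^ 2" using qN cong_dvd_iff by auto
    then have "q dvd 2" using q(1) prime_dvd_power by blast
    then show False using q two_is_prime_nat primes_dvd_imp_eq by blast
  qed
  obtain g where g: "g \<in> G" "g o0 = r o0" using transitive[OF o(1), of "r o0"] rX o(1) by blast
  have "sign g = - 1"
  proof (rule sign_swapping_one_pair[OF finX perm[OF g(1)] r_perm rr r_ne rG[OF g(1)] o(1) g(2)])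
    fix j n assume j: "j \<in> X - {o0, r o0}"
    show "(g ^^ n) j \<noteq> r j"
    proof
      assume gj: "(g ^^ n) j = r j"
      define h where "h = g ^^ n"
      have hG: "h \<in> G" unfolding h_def by (rule funpow_mem[OF g(1)])
      have hj: "j \<in> X" "h j = r j" using j gj unfolding h_def by auto
      have gr: "g (r o0) = o0" using rG[OF g(1)] g(2) by simp
      have "(g ^^ n) o0 = o0 \<or> (g ^^ n) o0 = r o0" by (induction n) (auto simp: g(2) gr)
      then consider "h o0 = o0" | "h o0 = r o0" unfolding h_def by blast
      then show False
      proof cases
        case 1
        then show False using mixed[OF hG o(1) _ hj] by blast
      next
        case 2
        obtain i where "i \<in> X" "h i = i" using swap[OF hG o(1) hj(1) 2 hj(2)] j by blast
        then show False using mixed[OF hG _ _ hj] by blast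
      qed
    qed
  qed
  then show False using even[OF g(1)] by simp
qed

end

section \<open>Latin squares\<close>

lemma sign_involution:
  assumes S: "finite S" and f: "f permutes S" and ff: "\<And>x. f (f x) = x" and m: "card {x \<in> S. f x \<noteq> x} = 2 * m"
  shows "sign f = (- 1) ^ m"
  using f ff m
proof (induction m arbitrary: f)
  case 0
  then have "{x \<in> S. f x \<noteq> x} = {}" using S by simp
  then have "f = id" using permutes_not_in[OF 0(1)] by (auto simp: fun_eq_iff)
  then show ?case by simp
next
  case (Suc m)
  then have "card {x \<in> S. f x \<noteq> x} \<noteq> 0" by simp
  then have "{x \<in> S. f x \<noteq> x} \<noteq> {}" by (metis card.empty)
  then obtain a where a: "a \<in> S" "f a \<noteq> a" by blast
  have faS: "f a \<in> S" using permutes_in_image[OF Suc.prems(1)] a(1) by blast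
  define t where "t = transpose a (f a)"
  define h where "h = t \<circ> f"
  have tS: "t permutes S" unfolding t_def by (rule permutes_swap_id[OF a(1) faS])
  have hS: "h permutes S" unfolding h_def by (rule permutes_compose[OF Suc.prems(1) tS])
  have finj: "f x = f y \<longleftrightarrow> x = y" for x y using Suc.prems(2) by metis
  have h: "h x = (if x = a \<or> x = f a then x else f x)" for x
  proof (cases "x = a \<or> x = f a")
    case True
    then show ?thesis unfolding h_def t_def using Suc.prems(2) by auto
  next
    case False
    then have "f x \<noteq> f a" "f x \<noteq> a" using finj Suc.prems(2) by metis+
    then show ?thesis unfolding h_def t_def using False by simp
  qed
  have "sign h = (- 1) ^ m"
  proof (rule Suc.IH[OF hS])
    show "h (h x) = x" for x
    proof (cases "x = a \<or> x = f a")
      case False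
      then have "f x \<noteq> f a" "f x \<noteq> a" using finj Suc.prems(2) by metis+
      then show ?thesis using False Suc.prems(2) by (simp add: h)
    qed (auto simp: h)
    have "{x \<in> S. h x \<noteq> x} = {x \<in> S. f x \<noteq> x} - {a, f a}" using h by auto
    moreover have "{a, f a} \<subseteq> {x \<in> S. f x \<noteq> x}" using a faS Suc.prems(2) by auto
    then have "card ({x \<in> S. f x \<noteq> x} - {a, f a}) = 2 * Suc m - card {a, f a}"
      unfolding Suc.prems(3)[symmetric] by (intro card_Diff_subset) auto
    ultimately show "card {x \<in> S. h x \<noteq> x} = 2 * m" using a by simp
  qed
  moreover have "permutation f" using Suc.prems(1) S permutation_permutes by blast
  then have "sign h = sign t * sign f"
    unfolding h_def t_def by (rule sign_compose[OF permutation_swap_id])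
  moreover have "sign t = - 1" unfolding t_def sign_swap_id using a(2) by simp
  ultimately show ?case by simp
qed

context deg2p
begin

text \<open>\<open>\<phi>\<close> is the product of its restrictions to the fibres of
  \<open>idx\<close>. Elements of \<open>G\<close> conjugate these into each other, so they have the
  same sign, and their number \<open>2 * p\<close> is even.\<close>

lemma sign_fibred:
  fixes idx :: "'a \<times> 'a \<Rightarrow> 'a"
  assumes \<phi>: "\<phi> permutes X \<times> X" and idx: "\<And>s. s \<in> X \<times> X \<Longrightarrow> idx s \<in> X"
    and idx\<phi>: "\<And>s. s \<in> X \<times> X \<Longrightarrow> idx (\<phi> s) = idx s"
    and eq: "\<And>g s. g \<in> G \<Longrightarrow> s \<in> X \<times> X \<Longrightarrow> idx (map_prod g g s) = g (idx s)"
      "\<And>g s. g \<in> G \<Longrightarrow> s \<in> X \<times> X \<Longrightarrow> \<phi> (map_prod g g s) = map_prod g g (\<phi> s)"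
  shows "sign \<phi> = 1"
proof -
  let ?S = "X \<times> X"
  have finS: "finite ?S" using finX by simp
  define part where "part I s = (if s \<in> ?S \<and> idx s \<in> I then \<phi> s else s)" for I s
  have \<phi>S: "\<phi> s \<in> ?S \<longleftrightarrow> s \<in> ?S" for s using permutes_in_image[OF \<phi>] .
  have part_perm: "part I permutes ?S" for I
  proof -
    have "(\<lambda>x. if x \<in> {s \<in> ?S. idx s \<in> I} then \<phi> x else x) permutes ?S"
      by (rule permutes_restrict[OF \<phi> _ finS]) (use \<phi>S idx\<phi> in auto)
    then show ?thesis unfolding part_def by simp
  qed
  then have part_p: "permutation (part I)" for I using finS permutation_permutes by blast
  have same: "sign (part {g i}) = sign (part {i})" if g: "g \<in> G" and i: "i \<in> X" for g i
  proof -
    define H where "H s = (if s \<in> ?S then map_prod g g s else s)" for s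
    have HS: "map_prod g g s \<in> ?S \<longleftrightarrow> s \<in> ?S" for s by (cases s) (simp add: mem_X_iff[OF g])
    have "H permutes ?S"
    proof (rule bij_imp_permutes)
      have "inj_on H ?S" unfolding H_def by (rule inj_onI) (auto simp: inj_G[OF g] split: prod.splits)
      moreover have "H ` ?S \<subseteq> ?S" unfolding H_def using mem_X[OF g] by auto
      ultimately show "bij_betw H ?S ?S" using endo_inj_surj[OF finS] unfolding bij_betw_def by blast
    qed (auto simp: H_def)
    then have Hp: "permutation H" using finS permutation_permutes by blast
    have "H (part {i} s) = part {g i} (H s)" for s
    proof (cases "s \<in> ?S")
      case True
      have "g (idx s) = g i \<longleftrightarrow> idx s = i" by (rule inj_G[OF g])
      then show ?thesis
        using True HS[of s] \<phi>S[of s] eq[OF g True] unfolding H_def part_def by auto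
    next
      case False
      then show ?thesis unfolding H_def part_def by simp
    qed
    then have "H \<circ> part {i} = part {g i} \<circ> H" by (simp add: fun_eq_iff)
    then have "sign H * sign (part {i}) = sign (part {g i}) * sign H"
      using sign_compose[OF Hp part_p] sign_compose[OF part_p Hp] by metis
    then show ?thesis by simp
  qed
  obtain x where x: "x \<in> X" using cardX p_pos by fastforce
  have "sign (part I) = sign (part {x}) ^ card I" if "I \<subseteq> X" for I
    using finite_subset[OF that finX] that
  proof (induction I rule: finite_induct)
    case empty
    have "part {} = id" unfolding part_def by auto
    then show ?case by simp
  next
    case (insert i I)
    have "part (insert i I) s = (part {i} \<circ> part I) s" for s
    proof (cases "s \<in> ?S")
      case True
      then show ?thesis using \<phi>S[of s] idx\<phi>[OF True] insert.hyps(2) by (auto simp: part_def)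
    next
      case False
      then show ?thesis unfolding part_def by simp
    qed
    then have e: "part (insert i I) = part {i} \<circ> part I" by blast
    have "i \<in> X" using insert.prems by blast
    then obtain g where "g \<in> G" "g x = i" using transitive[OF x] by blast
    then have "sign (part {i}) = sign (part {x})" using same x by blast
    then show ?case
      unfolding e sign_compose[OF part_p part_p] using insert by simp
  qed
  from this[of X] have "sign (part X) = (sign (part {x}))\<^sup>2 ^ p" using cardX by (simp add: power_mult)
  also have "\<dots> = 1" by (simp add: power2_eq_square)
  finally have "sign (part X) = 1" .
  moreover have "part X s = \<phi> s" for s
    unfolding part_def using idx permutes_not_in[OF \<phi>, of s] by auto
  then have "part X = \<phi>" by blast
  ultimately show ?thesis by simp
qed

text \<open>For a left distributive Latin square of order \<open>n\<close> with a transitive automorphism group and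
  \<open>n\<close> even, the rows, the columns and the symbols all give even permutations of the pairs, whereas
  swapping the two coordinates is a product of \<open>n(n-1)/2\<close> transpositions (cf. Stein's theorem).\<close>

lemma no_latin_family:
  assumes z: "fixing_fam z" and latin: "\<And>j k. j \<in> X \<Longrightarrow> k \<in> X \<Longrightarrow> cmat z j k = 1"
  shows False
proof -
  let ?S = "X \<times> X"
  have finS: "finite ?S" using finX by simp
  have zc: "conj_fam z" using z unfolding fixing_fam_def by blast
  have zG: "z i \<in> G" if "i \<in> X" for i using conj_fam_mem[OF zc that] .
  have uniq: "i = i'" if "i \<in> X" "i' \<in> X" "j \<in> X" "z i j = z i' j" for i i' j
  proof -
    have "card {i'' \<in> X. z i'' j = z i j} = 1"
      using latin[OF that(3) mem_X[OF zG[OF that(1)] that(3)]] unfolding cmat_def by simp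
    then obtain w where "{i'' \<in> X. z i'' j = z i j} = {w}" by (rule card_1_singletonE)
    then show ?thesis using that by (metis (mono_tags, lifting) mem_Collect_eq singletonD)
  qed
  \<comment> \<open>With \<open>z i j = k\<close>, these send \<open>(i, j)\<close> to
    \<open>(i, k)\<close>, \<open>(i, k)\<close> to \<open>(j, k)\<close> and \<open>(i, j)\<close>
    to \<open>(k, j)\<close>. They preserve the row \<open>i\<close>, the symbol \<open>k\<close>
    and the column \<open>j\<close>.\<close>
  define \<phi> where "\<phi> s = (if s \<in> ?S then (fst s, z (fst s) (snd s)) else s)" for s
  define \<theta> where "\<theta> s = (if s \<in> ?S then (inv' (z (fst s)) (snd s), snd s) else s)" for s
  define \<psi> where "\<psi> s = (if s \<in> ?S then (z (fst s) (snd s), snd s) else s)" for s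
  define sw where "sw s = (if s \<in> ?S then (snd s, fst s) else s)" for s
  have permI: "f permutes ?S" if "inj_on f ?S" "f ` ?S \<subseteq> ?S" "\<And>s. s \<notin> ?S \<Longrightarrow> f s = s" for f
    using bij_imp_permutes[of f ?S] endo_inj_surj[OF finS] that unfolding bij_betw_def by metis
  have zX: "z i j \<in> X" if "i \<in> X" "j \<in> X" for i j using mem_X[OF zG] that by blast
  have izX: "inv' (z i) j \<in> X" if "i \<in> X" "j \<in> X" for i j using mem_X[OF inv_mem[OF zG]] that by blast
  have \<phi>p: "\<phi> permutes ?S"
  proof (rule permI)
    show "inj_on \<phi> ?S" unfolding \<phi>_def by (rule inj_onI) (auto simp: inj_G[OF zG])
  qed (auto simp: \<phi>_def zX)
  have \<theta>p: "\<theta> permutes ?S"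
  proof (rule permI)
    show "inj_on \<theta> ?S"
    proof (rule inj_onI)
      fix s t assume st: "s \<in> ?S" "t \<in> ?S" "\<theta> s = \<theta> t"
      then have e: "snd s = snd t" "inv' (z (fst s)) (snd s) = inv' (z (fst t)) (snd s)" unfolding \<theta>_def by auto
      have X: "fst s \<in> X" "fst t \<in> X" "snd s \<in> X" using st by auto
      have "z (fst s) (inv' (z (fst s)) (snd s)) = z (fst t) (inv' (z (fst s)) (snd s))"
        using inv_apply(2)[OF zG[OF X(1)]] inv_apply(2)[OF zG[OF X(2)]] e(2) by metis
      then have "fst s = fst t" using uniq[OF X(1,2) izX[OF X(1,3)]] by blast
      then show "s = t" using e(1) by (simp add: prod_eq_iff)
    qed
  qed (auto simp: \<theta>_def izX)
  have \<psi>p: "\<psi> permutes ?S"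
  proof (rule permI)
    show "inj_on \<psi> ?S"
    proof (rule inj_onI)
      fix s t assume st: "s \<in> ?S" "t \<in> ?S" "\<psi> s = \<psi> t"
      then have e: "snd s = snd t" "z (fst s) (snd s) = z (fst t) (snd s)" unfolding \<psi>_def by auto
      then have "fst s = fst t" using uniq[of "fst s" "fst t" "snd s"] st by auto
      then show "s = t" using e(1) by (simp add: prod_eq_iff)
    qed
  qed (auto simp: \<psi>_def zX)
  have swp: "sw permutes ?S"
    by (rule permI) (auto simp: sw_def intro!: inj_onI)
  have "sign \<phi> = 1"
    by (rule sign_fibred[OF \<phi>p, of fst])
      (auto simp: \<phi>_def zX mem_X conj_fam_apply[OF zc])
  moreover have inv_eq: "inv' (z (g i)) (g k) = g (inv' (z i) k)" if "g \<in> G" "i \<in> X" for g i k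
  proof -
    have "z (g i) (g (inv' (z i) k)) = g k" using conj_fam_apply[OF zc that, of "inv' (z i) k"] zG[OF that(2)] by simp
    then show ?thesis using inv_apply(1)[OF zG[OF mem_X[OF that]], of "g (inv' (z i) k)"] by simp
  qed
  then have "sign \<theta> = 1"
    by (intro sign_fibred[OF \<theta>p, of snd]) (auto simp: \<theta>_def izX mem_X)
  moreover have "sign \<psi> = 1"
    by (rule sign_fibred[OF \<psi>p, of snd])
      (auto simp: \<psi>_def zX mem_X conj_fam_apply[OF zc])
  moreover have "sw \<circ> (\<theta> \<circ> \<phi>) = \<psi>"
    by (rule ext) (auto simp: sw_def \<theta>_def \<phi>_def \<psi>_def zX izX zG)
  moreover have pp: "permutation \<phi>" "permutation \<theta>" "permutation sw"
    using \<phi>p \<theta>p swp finS permutation_permutes by blast+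
  ultimately have "sign sw = 1"
    using sign_compose[OF pp(3) permutation_compose[OF pp(2,1)]] sign_compose[OF pp(2,1)] by simp
  moreover have "sign sw = (- 1) ^ (p * (2 * p - 1))"
  proof (rule sign_involution[OF finS swp])
    show "sw (sw s) = s" for s unfolding sw_def by auto
    have "{s \<in> ?S. sw s \<noteq> s} = ?S - (\<lambda>x. (x, x)) ` X" unfolding sw_def by auto
    moreover have "card ((\<lambda>x. (x, x)) ` X) = 2 * p" using cardX by (subst card_image) (auto intro: inj_onI)
    ultimately have "card {s \<in> ?S. sw s \<noteq> s} = card ?S - 2 * p"
      using finX card_Diff_subset[of "(\<lambda>x. (x, x)) ` X" ?S] by auto
    also have "\<dots> = 2 * (p * (2 * p - 1))"
      using cardX by (simp add: card_cartesian_product diff_mult_distrib2 algebra_simps)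
    finally show "card {s \<in> ?S. sw s \<noteq> s} = 2 * (p * (2 * p - 1))" .
  qed
  moreover have "odd (p * (2 * p - 1))" using p prime_odd_nat[OF p(1)] by simp
  ultimately show False by simp
qed

end

section \<open>The off-diagonal trace\<close>

locale deg2p_crossless = deg2p_cyclic +
  fixes z :: "'a \<Rightarrow> 'a \<Rightarrow> 'a"
  assumes z: "fixing_fam z" and nontrivial: "\<exists>i\<in>X. z i \<noteq> id"
    and crossless: "j \<in> X \<Longrightarrow> k \<in> X \<Longrightarrow> \<not> cross j k"
begin

abbreviation "M \<equiv> cmat z"

definition c :: int where "c = tr M 1"
definition f :: int where "f = M o0 o0"
definition nu :: int where "nu = 2 * f + (int p - 1) * c - 2 * int p"

lemma zc: "conj_fam z" using z unfolding fixing_fam_def by blast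
lemma zi: "i \<in> X \<Longrightarrow> z i i = i" using z unfolding fixing_fam_def by blast
lemma zG: "i \<in> X \<Longrightarrow> z i \<in> G" using conj_fam_mem[OF zc] .
lemma zX: "i \<in> X \<Longrightarrow> j \<in> X \<Longrightarrow> z i j \<in> X" using mem_X[OF zG] .
lemma gM: "ginv M" by (rule ginv_cmat[OF zc])

lemma one_not_dvd: "\<not> int p dvd 1" using p(2) by (simp add: zdvd1_eq)

lemma zne: assumes "i \<in> X" shows "z i \<noteq> id"
proof
  assume e: "z i = id"
  obtain i0 where i0: "i0 \<in> X" "z i0 \<noteq> id" using nontrivial by blast
  obtain g where g: "g \<in> G" "g i = i0" using transitive[OF assms i0(1)] by blast
  have "z i0 \<circ> g = g" using conj_fam_comp[OF zc g(1) assms] e g(2) by simp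
  then have "z i0 \<circ> (g \<circ> inv' g) = g \<circ> inv' g" by (simp add: comp_assoc[symmetric])
  then show False using i0(2) g(1) by simp
qed

text \<open>A single class would make every \<open>z i\<close> trivial. A class of size two can be
  moved into one orbit of \<open>a\<close>, where some power \<open>a ^^ k\<close> takes one member
  to the other; applying it again gives a third member unless \<open>p\<close> divides
  \<open>2 * k\<close>.\<close>

lemma z_inj: assumes "i \<in> X" "j \<in> X" "z i = z j" shows "i = j"
proof -
  define R where "R i j \<longleftrightarrow> z i = z j" for i j
  have Rg: "R (g i) (g j)" if g: "g \<in> G" and ij: "i \<in> X" "j \<in> X" "R i j" for g i j
  proof -
    have "z (g i) (g k) = z (g j) (g k)" for k
      using conj_fam_apply[OF zc g ij(1), of k] conj_fam_apply[OF zc g ij(2), of k] ij(3) unfolding R_def by simp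
    then have "z (g i) k = z (g j) k" for k using inv_apply(2)[OF g] by metis
    then show ?thesis unfolding R_def by blast
  qed
  have "(\<forall>j\<in>X. card {k \<in> X. R j k} = 1) \<or> (\<forall>j\<in>X. card {k \<in> X. R j k} = 2) \<or> (\<forall>j\<in>X. \<forall>k\<in>X. R j k)"
  proof (rule class_card)
    show "R (g i) (g j)" if "g \<in> G" "i \<in> X" "j \<in> X" "R i j" for g i j by (rule Rg[OF that])
  qed (simp_all add: R_def)
  then show ?thesis
  proof (elim disjE)
    assume "\<forall>j\<in>X. card {k \<in> X. R j k} = 1"
    then obtain w where "{k \<in> X. R i k} = {w}" using assms(1) by (meson card_1_singletonE)
    moreover have "i \<in> {k \<in> X. R i k}" "j \<in> {k \<in> X. R i k}" using assms unfolding R_def by auto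
    ultimately show ?thesis by (metis singletonD)
  next
    assume all: "\<forall>j\<in>X. \<forall>k\<in>X. R j k"
    have "z i k = k" if "k \<in> X" for k
      using all assms(1) that zi[OF that] unfolding R_def by metis
    then have "z i = id" using eq_id_iff[OF zG[OF assms(1)]] by blast
    then show ?thesis using zne[OF assms(1)] by blast
  next
    assume two: "\<forall>j\<in>X. card {k \<in> X. R j k} = 2"
    then obtain u v where uv: "{k \<in> X. R o0 k} = {u, v}" "u \<noteq> v" using o(1) by (meson card_2_iff)
    moreover have "o0 \<in> {k \<in> X. R o0 k}" using o(1) unfolding R_def by blast
    ultimately obtain w where w: "{k \<in> X. R o0 k} = {o0, w}" "w \<noteq> o0" by (cases "u = o0") auto
    then have wX: "w \<in> X" "R o0 w" by auto
    obtain g where g: "g \<in> G" "side (g o0) = side (g w)" using crossless[OF o(1) wX(1)] unfolding cross_def by blast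
    define b where "b = side (g o0)"
    obtain b1 x where x: "g o0 = pt b1 x" using pt_cases[OF mem_X[OF g(1) o(1)]] by blast
    obtain b2 y where y: "g w = pt b2 y" using pt_cases[OF mem_X[OF g(1) wX(1)]] by blast
    have bb: "b2 = b1" using g(2) unfolding x y side_pt by simp
    define k where "k = nat ((y - x) mod int p)"
    have ak: "(a ^^ k) (pt b1 x) = pt b1 y"
    proof -
      have "(a ^^ k) (pt b1 x) = pt b1 (x + (y - x) mod int p)" unfolding a_pt k_def using p_pos by simp
      also have "\<dots> = pt b1 y" by (rule pt_mod) (simp add: mod_add_right_eq)
      finally show ?thesis .
    qed
    have xy: "pt b1 x \<noteq> pt b1 y" using inj_G[OF g(1), of o0 w] w(2) unfolding x y bb by simp
    have R1: "R (pt b1 x) (pt b1 y)" using Rg[OF g(1) o(1) wX] unfolding x y bb .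
    have R2: "R (pt b1 y) ((a ^^ k) (pt b1 y))"
      using Rg[OF a_mem[of k] pt_mem pt_mem R1] unfolding ak .
    let ?u = "(a ^^ k) (pt b1 y)"
    have "{pt b1 x, pt b1 y, ?u} \<subseteq> {l \<in> X. R (pt b1 x) l}"
      using R1 R2 pt_mem mem_X[OF a_mem pt_mem] unfolding R_def by auto
    then have "card {pt b1 x, pt b1 y, ?u} \<le> card {l \<in> X. R (pt b1 x) l}"
      by (rule card_mono[rotated]) (simp add: finX)
    then have "card {pt b1 x, pt b1 y, ?u} \<le> 2" using two[rule_format, OF pt_mem[of b1 x]] by simp
    moreover have "?u \<noteq> pt b1 y" using inj_G[OF a_mem[of k], of "pt b1 y" "pt b1 x"] xy unfolding ak by simp
    ultimately have "?u = pt b1 x" using xy by (auto simp: card_insert_if split: if_splits)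
    then have "(a ^^ (k + k)) (pt b1 x) = pt b1 x" unfolding funpow_add comp_apply ak by simp
    then have "p dvd k + k" using a_pow_eq_iff[OF pt_mem] by blast
    then have "p dvd 2 * k" by (simp add: mult_2)
    then have "p dvd k" using p prime_dvd_mult_iff[OF p(1)] primes_dvd_imp_eq[OF p(1) two_is_prime_nat] by auto
    then have "(a ^^ k) (pt b1 x) = pt b1 x" using a_pow_eq_iff[OF pt_mem] by blast
    then show ?thesis using ak xy by simp
  qed
qed

text \<open>\<open>z j\<close> fixes \<open>k\<close> exactly when \<open>z j\<close> and
  \<open>z k\<close> commute, because distinct indices have distinct \<open>z\<close>.\<close>

lemma fix_sym: assumes "j \<in> X" "k \<in> X" "z j k = k" shows "z k j = j"
proof -
  have "z k \<circ> z j = z j \<circ> z k" using conj_fam_comp[OF zc zG[OF assms(1)] assms(2)] assms(3) by simp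
  also have "z k \<circ> z j = z (z k j) \<circ> z k" using conj_fam_comp[OF zc zG[OF assms(2)] assms(1)] .
  finally have "z (z k j) (z k l) = z j (z k l)" for l by (metis comp_apply)
  then have "z (z k j) = z j" using inv_apply(2)[OF zG[OF assms(2)]] by (metis ext)
  then show ?thesis using z_inj zX assms by blast
qed

lemma Mjj: "j \<in> X \<Longrightarrow> M j j = f"
  unfolding f_def by (rule ginv_diag[OF gM _ o(1)])

lemma card_fixed: "j \<in> X \<Longrightarrow> int (card {k \<in> X. z j k = k}) = f"
proof -
  assume j: "j \<in> X"
  have "{k \<in> X. z j k = k} = {i \<in> X. z i j = j}" using fix_sym j by blast
  then show ?thesis using Mjj[OF j] unfolding cmat_def by simp
qed

lemma M_nonneg: "M j k \<ge> 0" unfolding cmat_def by simp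

lemma row: "j \<in> X \<Longrightarrow> (\<Sum>k\<in>X. M j k) = 2 * int p"
  using cmat_row_sum[OF zc] cardX by simp

lemma col: "k \<in> X \<Longrightarrow> (\<Sum>j\<in>X. M j k) = 2 * int p"
  using cmat_col_sum[OF zc] cardX by simp

lemma trM: "\<not> int p dvd x \<Longrightarrow> blk M False False x + blk M True True x = c"
  using trace_cmat(1)[OF z] unfolding tr_def c_def .

lemma in_block:
  assumes "j \<in> X" "k \<in> X" "j \<noteq> k"
  obtains b x where "\<not> int p dvd x" "\<And>A. ginv A \<Longrightarrow> A j k = blk A b b x"
  using not_cross_in_block[OF crossless[OF assms(1,2)] assms] by blast

text \<open>The entry occurs in a diagonal block away from \<open>0\<close>, where the two
  nonnegative blocks add up to \<open>c\<close>.\<close>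

lemma M_le: assumes "j \<in> X" "k \<in> X" "j \<noteq> k" shows "M j k \<le> c"
proof -
  obtain b x where bx: "\<not> int p dvd x" "\<And>A. ginv A \<Longrightarrow> A j k = blk A b b x"
    using in_block[OF assms] by metis
  have "blk M b b x \<le> blk M False False x + blk M True True x"
    unfolding blk_def using M_nonneg by (cases b) auto
  then show ?thesis using bx(2)[OF gM] trM[OF bx(1)] by simp
qed

lemma identity:
  assumes "j \<in> X" "k \<in> X"
  shows "2 * mmul X M M j k = 2 * (2 * f - c) * M j k
    - (if j = k then 2 * nu * int p * (2 - c) else 0) + (2 * int p - nu) * c"
  using quadratic_identity[OF z assms] unfolding f_def c_def nu_def by simp

lemma f_pos: "f \<ge> 1"
proof -
  have "o0 \<in> {k \<in> X. z o0 k = k}" using o(1) zi by blast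
  then have "card {k \<in> X. z o0 k = k} > 0" using finX by (auto simp: card_gt_0_iff)
  then show ?thesis using card_fixed[OF o(1)] by linarith
qed

lemma c_nonneg: "c \<ge> 0"
  using trM[OF one_not_dvd] M_nonneg unfolding blk_def by (metis add_nonneg_nonneg)

lemma c_nonzero: "c \<noteq> 0"
proof
  assume c0: "c = 0"
  have "z o0 k = k" if k: "k \<in> X" for k
  proof (rule ccontr)
    assume a: "z o0 k \<noteq> k"
    have "M k (z o0 k) \<le> 0" using M_le[OF k zX[OF o(1) k]] a c0 by simp
    then have "card {i \<in> X. z i k = z o0 k} = 0" unfolding cmat_def by simp
    then have "{i \<in> X. z i k = z o0 k} = {}" using finX by simp
    then show False using o(1) by blast
  qed
  then show False using zne[OF o(1)] eq_id_iff[OF zG[OF o(1)]] by blast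
qed

text \<open>Off-diagonal entries are at most \<open>c\<close>, which bounds the diagonal of the
  square of \<open>M\<close> by \<open>f * f + c * (2 * p - f)\<close>. Compared with the quadratic
  identity, this bounds \<open>nu * (2 * p * e - c)\<close> linearly in \<open>p\<close>, where
  \<open>e = c - 2\<close>. For positive \<open>e\<close> that product grows quadratically in
  \<open>p\<close>.\<close>

lemma c_le_2: "c \<le> 2"
proof (rule ccontr)
  assume "\<not> c \<le> 2"
  define e where "e = c - 2"
  have e: "e \<ge> 1" "c = e + 2" using \<open>\<not> c \<le> 2\<close> unfolding e_def by auto
  define P where "P = int p"
  have P: "P \<ge> 6" unfolding P_def using p(2) by simp
  have "mmul X M M o0 o0 = M o0 o0 * M o0 o0 + (\<Sum>k\<in>X - {o0}. M o0 k * M k o0)"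
    unfolding mmul_def by (rule sum.remove[OF finX o(1)])
  also have "(\<Sum>k\<in>X - {o0}. M o0 k * M k o0) \<le> (\<Sum>k\<in>X - {o0}. c * M k o0)"
    using M_le[OF o(1)] M_nonneg by (intro sum_mono mult_right_mono) auto
  also have "(\<Sum>k\<in>X - {o0}. c * M k o0) = c * (2 * P - f)"
    using sum.remove[OF finX o(1), of "\<lambda>k. M k o0"] col[OF o(1)] Mjj[OF o(1)]
    by (simp add: sum_distrib_left[symmetric] P_def)
  finally have "mmul X M M o0 o0 \<le> f * f + c * (2 * P - f)" unfolding Mjj[OF o(1)] by simp
  moreover have "2 * mmul X M M o0 o0 = 2 * (2 * f - c) * f - 2 * nu * P * (2 - c) + (2 * P - nu) * c"
    using identity[OF o(1) o(1)] unfolding Mjj[OF o(1)] P_def by simp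
  ultimately have "2 * (2 * f - c) * f - 2 * nu * P * (2 - c) + (2 * P - nu) * c \<le> 2 * (f * f) + 2 * (c * (2 * P - f))"
    by linarith
  then have 1: "2 * (f * f) + nu * (2 * P * e - c) \<le> 2 * c * P" unfolding e(2) by (simp add: algebra_simps)
  have "nu \<ge> (P - 1) * e"
  proof -
    have "nu = 2 * f - 2 + (P - 1) * e" unfolding nu_def e(2) P_def by (simp add: algebra_simps)
    then show ?thesis using f_pos by simp
  qed
  moreover have 2: "2 * P * e - c \<ge> (2 * P - 3) * e" unfolding e(2) using e(1) by (simp add: algebra_simps)
  moreover have "(2 * P - 3) * e \<ge> 0" "(P - 1) * e \<ge> 0" using P e(1) by auto
  ultimately have "((P - 1) * e) * ((2 * P - 3) * e) \<le> nu * (2 * P * e - c)" by (intro mult_mono) auto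
  then have "((P - 1) * e) * ((2 * P - 3) * e) \<le> 2 * c * P" using 1 by (smt (verit) zero_le_square)
  also have "\<dots> \<le> 6 * P * e"
  proof -
    have "P * 2 \<le> P * (2 * e)" using P e(1) by (intro mult_left_mono) auto
    then show ?thesis unfolding e(2) by (simp add: algebra_simps)
  qed
  finally have "e * (((P - 1) * (2 * P - 3)) * e) \<le> e * (6 * P)" by (simp add: algebra_simps)
  then have 3: "((P - 1) * (2 * P - 3)) * e \<le> 6 * P" using e(1) by simp
  have "(P - 1) * (2 * P - 3) * 1 \<le> ((P - 1) * (2 * P - 3)) * e" using P e(1) by (intro mult_left_mono) auto
  then have "(P - 1) * (2 * P - 3) \<le> 6 * P" using 3 by simp
  moreover have "(P - 1) * (2 * P - 3) \<ge> 5 * (2 * P - 3)" using P by (intro mult_right_mono) auto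
  moreover have "5 * (2 * P - 3) > 6 * P" using P by presburger
  ultimately show False by linarith
qed

end

section \<open>Trace one\<close>

text \<open>The possible intersections of the nine points of an affine plane of order three with a subspace;
  only ten of its twelve lines are used.\<close>

lemma affine_plane_count:
  fixes e j k a1 a2 a3 b1 b2 b3 :: bool
  defines "cl \<equiv> \<lambda>u v w. (u \<and> v \<longrightarrow> w) \<and> (u \<and> w \<longrightarrow> v) \<and> (v \<and> w \<longrightarrow> u)"
  assumes line: "cl e j k" "cl e a1 b1" "cl e a2 b2" "cl e a3 b3" "cl j a1 b2" "cl j a2 b3" "cl j a3 b1"
      "cl k a1 b3" "cl k a2 b1" "cl k a3 b2"
    and n: "n = of_bool e + of_bool j + of_bool k + of_bool a1 + of_bool a2 + of_bool a3
      + of_bool b1 + of_bool b2 + (of_bool b3 :: int)"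
  shows "(n - 3) * (n - 9) \<ge> 0"
proof -
  note l = line[unfolded cl_def]
  \<comment> \<open>Unless all nine points occur, at most three do.\<close>
  have small: ?thesis if "n \<le> 3" using that by (intro mult_nonpos_nonpos) auto
  consider "e" "j" "k" | "e" "\<not> j" "\<not> k" | "\<not> e" "j" "\<not> k" | "\<not> e" "\<not> j" "k" | "\<not> e" "\<not> j" "\<not> k"
    using l(1) by blast
  then show ?thesis
  proof cases
    case 1
    then have "b1 = a1" "b2 = a1" "b3 = a1" "a2 = a1" "a3 = a1"
      using l(2)[unfolded 1] l(3)[unfolded 1] l(4)[unfolded 1] l(5)[unfolded 1] l(8)[unfolded 1] by argo+
    then show ?thesis unfolding n using 1 by (cases a1) simp_all
  next
    case 2
    have e0: "b1 = a1" using l(2) 2 by argo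
    have e1: "b2 = a2" using l(3) 2 by argo
    have e2: "b3 = a3" using l(4) 2 by argo
    have d0: "\<not> (a1 \<and> a2)" using l(5) 2 e0 e1 e2 by argo
    have d1: "\<not> (a1 \<and> a3)" using l(8) 2 e0 e1 e2 by argo
    have d2: "\<not> (a2 \<and> a3)" using l(6) 2 e0 e1 e2 by argo
    have "n \<le> 3" unfolding n e0 e1 e2 using 2 d0 d1 d2 by (cases a1; cases a2; cases a3) simp_all
    then show ?thesis by (rule small)
  next
    case 3
    have e0: "b1 = a3" using l(7) 3 by argo
    have e1: "b2 = a1" using l(5) 3 by argo
    have e2: "b3 = a2" using l(6) 3 by argo
    have d0: "\<not> (a1 \<and> a2)" using l(8) 3 e0 e1 e2 by argo
    have d1: "\<not> (a1 \<and> a3)" using l(2) 3 e0 e1 e2 by argo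
    have d2: "\<not> (a2 \<and> a3)" using l(9) 3 e0 e1 e2 by argo
    have "n \<le> 3" unfolding n e0 e1 e2 using 3 d0 d1 d2 by (cases a1; cases a2; cases a3) simp_all
    then show ?thesis by (rule small)
  next
    case 4
    have e0: "b1 = a2" using l(9) 4 by argo
    have e1: "b2 = a3" using l(10) 4 by argo
    have e2: "b3 = a1" using l(8) 4 by argo
    have d0: "\<not> (a1 \<and> a2)" using l(2) 4 e0 e1 e2 by argo
    have d1: "\<not> (a1 \<and> a3)" using l(5) 4 e0 e1 e2 by argo
    have d2: "\<not> (a2 \<and> a3)" using l(3) 4 e0 e1 e2 by argo
    have "n \<le> 3" unfolding n e0 e1 e2 using 4 d0 d1 d2 by (cases a1; cases a2; cases a3) simp_all
    then show ?thesis by (rule small)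
  next
    case 5
    \<comment> \<open>Each \<open>a\<close> and each \<open>b\<close> lie on a line with one of
      \<open>e\<close>, \<open>j\<close>, \<open>k\<close>, so they cannot both occur.\<close>
    have a: "a1 \<Longrightarrow> \<not> b1 \<and> \<not> b2 \<and> \<not> b3" "a2 \<Longrightarrow> \<not> b1 \<and> \<not> b2 \<and> \<not> b3" "a3 \<Longrightarrow> \<not> b1 \<and> \<not> b2 \<and> \<not> b3"
      using l(2,5,8) 5 apply argo
      using l(9,3,6) 5 apply argo
      using l(7,10,4) 5 apply argo
      done
    consider "\<not> a1" "\<not> a2" "\<not> a3" | "\<not> b1" "\<not> b2" "\<not> b3" using a by blast
    then have "n \<le> 3" unfolding n using 5 by cases (simp_all add: of_bool_def)
    then show ?thesis by (rule small)
  qed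
qed

section \<open>Commuting indices\<close>

context deg2p_crossless
begin

definition Fx :: "'a \<Rightarrow> 'a set"
  where "Fx j = {k \<in> X. z j k = k}"

lemma finFx: "finite (Fx j)" unfolding Fx_def using finX by simp

lemma Fx_sub: "Fx j \<subseteq> X" unfolding Fx_def by blast

lemma Fx_sym: "j \<in> X \<Longrightarrow> k \<in> X \<Longrightarrow> k \<in> Fx j \<longleftrightarrow> j \<in> Fx k"
  unfolding Fx_def using fix_sym by blast

lemma Fx_self: "j \<in> X \<Longrightarrow> j \<in> Fx j"
  unfolding Fx_def using zi by blast

lemma Fx_g: "g \<in> G \<Longrightarrow> j \<in> X \<Longrightarrow> k \<in> X \<Longrightarrow> g k \<in> Fx (g j) \<longleftrightarrow> k \<in> Fx j"
  unfolding Fx_def using mem_X conj_fam_apply[OF zc, of g j k] inj_G by auto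

text \<open>\<open>z j\<close> fixes both \<open>j\<close> and \<open>k\<close>, so it permutes the
  indices \<open>i\<close> with \<open>z i j = k\<close>. If there is only one, \<open>z j\<close>
  fixes it, and then \<open>z i\<close> fixes \<open>j\<close> by \<open>fix_sym\<close>.\<close>

lemma M_ne_1:
  assumes jk: "j \<in> X" "k \<in> X" "k \<noteq> j" "k \<in> Fx j"
  shows "M j k \<noteq> 1"
proof
  assume "M j k = 1"
  then have "card {i \<in> X. z i j = k} = 1" unfolding cmat_def by simp
  then obtain i where i: "{i \<in> X. z i j = k} = {i}" by (rule card_1_singletonE)
  then have iX: "i \<in> X" "z i j = k" by auto
  have "z (z j i) j = z j (z i j)"
    using conj_fam_apply[OF zc zG[OF jk(1)] iX(1), of j] zi[OF jk(1)] by simp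
  then have "z (z j i) j = k" using iX jk(4) unfolding Fx_def by simp
  then have "z j i \<in> {i \<in> X. z i j = k}" using zX[OF jk(1) iX(1)] by simp
  then have "z j i = i" using i by simp
  then have "z i j = j" using fix_sym[OF jk(1) iX(1)] by blast
  then show False using iX jk(3) by simp
qed

end

section \<open>The strongly regular graph of commuting pairs\<close>

locale deg2p_strongly_regular = deg2p_crossless +
  assumes c1: "c = 1"
begin

text \<open>Off the diagonal \<open>M\<close> is at most \<open>1\<close> and vanishes on commuting
  pairs, so it is bounded by the indicator of the non-commuting pairs. Both have the same row sum
  \<open>2 * p - f\<close>.\<close>

lemma M_eq: assumes "j \<in> X" "k \<in> X"
  shows "M j k = (if j = k then f else if k \<in> Fx j then 0 else 1)"
proof -
  have le: "M j k \<le> 1" if "k \<in> X - {j}" for k using M_le[OF assms(1)] that c1 by auto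
  have zero: "M j k = 0" if k: "k \<in> X" "k \<noteq> j" "k \<in> Fx j" for k
    using le[of k] M_nonneg[of j k] M_ne_1[OF assms(1) k] k by simp
  have "(\<Sum>k\<in>X - {j}. (if k \<in> Fx j then 0 else 1) - M j k) = 0"
  proof -
    have "(\<Sum>k\<in>X - {j}. M j k) = 2 * int p - f"
      using sum.remove[OF finX assms(1), of "M j"] row[OF assms(1)] Mjj[OF assms(1)] by simp
    moreover have "(\<Sum>k\<in>X - {j}. if k \<in> Fx j then 0 else 1) = int (card (X - Fx j))"
    proof -
      have "(X - {j}) \<inter> - Fx j = X - Fx j" using Fx_self[OF assms(1)] by blast
      then show ?thesis using finX by (simp add: sum.If_cases)
    qed
    moreover have "int (card (X - Fx j)) = 2 * int p - f"
      using card_Diff_subset[OF finFx Fx_sub, of j] card_mono[OF finX Fx_sub, of j] cardX card_fixed[OF assms(1)]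
      unfolding Fx_def[symmetric] by (simp add: of_nat_diff)
    ultimately show ?thesis by (simp add: sum_subtractf)
  qed
  moreover have "0 \<le> (if k \<in> Fx j then 0 else 1) - M j k" if "k \<in> X - {j}" for k
    using le[OF that] zero[of k] that by auto
  ultimately have "\<forall>k\<in>X - {j}. (if k \<in> Fx j then 0 else 1) - M j k = 0"
    using finX by (subst (asm) sum_nonneg_eq_0_iff) auto
  then show ?thesis using Mjj[OF assms(1)] assms(2) by auto
qed

definition s :: int where "s = int p - f"

lemma card_Fx: "j \<in> X \<Longrightarrow> int (card (Fx j)) = f"
  using card_fixed unfolding Fx_def .

text \<open>The quadratic identity for \<open>M = J - D + f * I\<close>, with \<open>J\<close> the
  all-one matrix, \<open>I\<close> the identity and \<open>D\<close> the matrix of commuting pairs,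
  whose square counts the common elements.\<close>

lemma inter_eq: assumes jk: "j \<in> X" "k \<in> X"
  shows "2 * int (card (Fx j \<inter> Fx k)) =
    (if j = k then (2 * f - 1) * f * 2 - 2 * (2 * f - 1 - int p) * int p + int p - 2 * f + 1 + int p * 2 - (4 * int p - 4 * f + 2 * f * f)
     else 2 * of_bool (k \<in> Fx j) + 2 * f - 1 - int p)"
proof -
  define d where "d u v = (of_bool (v \<in> Fx u) :: int)" for u v
  have dsym: "d u v = d v u" if "u \<in> X" "v \<in> X" for u v unfolding d_def using Fx_sym[OF that] by simp
  have dsum: "(\<Sum>l\<in>X. d u l) = f" if "u \<in> X" for u
  proof -
    have "X \<inter> Fx u = Fx u" using Fx_sub by blast
    then have "(\<Sum>l\<in>X. d u l) = int (card (Fx u))"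
      unfolding d_def using finX by (simp add: of_bool_def sum.If_cases Int_def[symmetric] Collect_mem_eq)
    then show ?thesis using card_Fx[OF that] by simp
  qed
  have Md: "M u v = 1 - d u v + (if u = v then f else 0)" if "u \<in> X" "v \<in> X" for u v
    unfolding M_eq[OF that] d_def using Fx_self[OF that(1)] by auto
  have DD: "(\<Sum>l\<in>X. d j l * d l k) = int (card (Fx j \<inter> Fx k))"
  proof -
    have "(\<Sum>l\<in>X. d j l * d l k) = (\<Sum>l\<in>X. if l \<in> Fx j \<inter> Fx k then 1 else 0)"
      using dsym jk by (intro sum.cong refl) (auto simp: d_def Fx_sym)
    moreover have "X \<inter> (Fx j \<inter> Fx k) = Fx j \<inter> Fx k" using Fx_sub by blast
    ultimately show ?thesis using finX by (simp add: sum.If_cases Int_def[symmetric] Collect_mem_eq)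
  qed
  have "mmul X M M j k = (\<Sum>l\<in>X. (1 - d j l + (if j = l then f else 0)) * (1 - d l k + (if l = k then f else 0)))"
    unfolding mmul_def using Md jk by (intro sum.cong) auto
  also have "\<dots> = (\<Sum>l\<in>X. 1 - d j l - d l k + d j l * d l k + (if j = l then f * (1 - d l k) else 0)
      + (if l = k then f * (1 - d j l) else 0) + (if j = l then if l = k then f * f else 0 else 0))"
    by (intro sum.cong) (auto simp: algebra_simps)
  also have "\<dots> = 2 * int p - f - f + (\<Sum>l\<in>X. d j l * d l k) + f * (1 - d j k) + f * (1 - d j k) + (if j = k then f * f else 0)"
    using finX jk cardX dsum[OF jk(1)] dsum[OF jk(2)] sum.cong[OF refl dsym[OF _ jk(2)], of X]
    by (simp add: sum.distrib sum_subtractf)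
  finally have "mmul X M M j k = 2 * int p - f - f + int (card (Fx j \<inter> Fx k)) + f * (1 - d j k) + f * (1 - d j k) + (if j = k then f * f else 0)"
    unfolding DD .
  then show ?thesis
    using identity[OF jk] Md[OF jk] Fx_self[OF jk(1)] unfolding c1 nu_def d_def by (auto simp: algebra_simps)
qed

text \<open>Obtained from the diagonal of the identity. The first equation says that
  \<open>2 * p\<close> is the square of \<open>2 * s + 1\<close> plus one, the shape known from
  Wielandt's theorem on groups of degree \<open>2 * p\<close>.\<close>

lemma parameters: "int p = 2 * s\<^sup>2 + 2 * s + 1" "f = 2 * s\<^sup>2 + s + 1"
proof -
  have "2 * f = (2 * f - 1) * f * 2 - 2 * (2 * f - 1 - int p) * int p + int p - 2 * f + 1 + int p * 2 - (4 * int p - 4 * f + 2 * f * f)"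
    using inter_eq[OF o(1) o(1)] card_Fx[OF o(1)] by simp
  moreover have f: "f = int p - s" unfolding s_def by simp
  ultimately show 1: "int p = 2 * s\<^sup>2 + 2 * s + 1" unfolding f by (simp add: algebra_simps power2_eq_square)
  show "f = 2 * s\<^sup>2 + s + 1" unfolding f 1 by simp
qed

lemma card_inter: assumes "j \<in> X" "k \<in> X" "j \<noteq> k"
  shows "int (card (Fx j \<inter> Fx k)) = s\<^sup>2 + of_bool (k \<in> Fx j)"
  using inter_eq[OF assms(1,2)] assms(3) parameters by simp

definition nc :: "'a \<Rightarrow> 'a \<Rightarrow> bool"
  where "nc j k \<longleftrightarrow> j \<in> X \<and> k \<in> X \<and> k \<notin> Fx j"

lemma nc_sym: "nc j k \<longleftrightarrow> nc k j" unfolding nc_def using Fx_sym by blast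

lemma nc_g: "g \<in> G \<Longrightarrow> nc (g j) (g k) \<longleftrightarrow> nc j k" unfolding nc_def using Fx_g mem_X_iff by blast

lemma ncD: "nc j k \<Longrightarrow> j \<in> X" "nc j k \<Longrightarrow> k \<in> X" "nc j k \<Longrightarrow> j \<noteq> k" "nc j k \<Longrightarrow> z j k \<noteq> k"
  unfolding nc_def using Fx_self unfolding Fx_def by blast+

lemma card_inter_nc: "nc j k \<Longrightarrow> int (card (Fx j \<inter> Fx k)) = s\<^sup>2"
  using card_inter[of j k] ncD[of j k] unfolding nc_def by simp

text \<open>If \<open>w\<close> commuted with \<open>j\<close>, then \<open>j\<close>,
  \<open>w\<close> and the common part would be \<open>s^2 + 2\<close> elements of a set of size
  \<open>s^2 + 1\<close>. So all pairwise intersections have size \<open>s^2\<close>, and they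
  coincide.\<close>

lemma common_third:
  assumes ej: "nc e j" and w: "nc e w" "Fx e \<inter> Fx j \<subseteq> Fx w" "w \<noteq> j"
  shows "nc j w" "Fx j \<inter> Fx w = Fx e \<inter> Fx j" "Fx e \<inter> Fx w = Fx e \<inter> Fx j"
proof -
  let ?C = "Fx e \<inter> Fx j"
  have X: "e \<in> X" "j \<in> X" "w \<in> X" using ncD ej w by blast+
  have finC: "finite ?C" using finFx by blast
  show njw: "nc j w"
  proof (rule ccontr)
    assume "\<not> nc j w"
    then have jw: "w \<in> Fx j" unfolding nc_def using X by blast
    have "insert j (insert w ?C) \<subseteq> Fx j \<inter> Fx w" using w(2) jw Fx_self Fx_sym X by blast
    then have "card (insert j (insert w ?C)) \<le> card (Fx j \<inter> Fx w)" using finFx by (intro card_mono) auto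
    moreover have "w \<notin> ?C" "j \<notin> insert w ?C" using ej w unfolding nc_def by auto
    then have "card (insert j (insert w ?C)) = card ?C + 2" using finC by simp
    moreover have "int (card ?C) = s\<^sup>2" by (rule card_inter_nc[OF ej])
    moreover have "int (card (Fx j \<inter> Fx w)) = s\<^sup>2 + 1" using card_inter[OF X(2,3)] w(3) jw by simp
    ultimately show False by linarith
  qed
  show "Fx j \<inter> Fx w = ?C"
    using card_inter_nc[OF njw] card_inter_nc[OF ej] w(2) finFx by (intro card_subset_eq[symmetric]) auto
  show "Fx e \<inter> Fx w = ?C"
    using card_inter_nc[OF w(1)] card_inter_nc[OF ej] w(2) finFx by (intro card_subset_eq[symmetric]) auto
qed

lemma Fx_image: "e \<in> X \<Longrightarrow> j \<in> X \<Longrightarrow> Fx e \<inter> Fx j \<subseteq> Fx (z e j)"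
proof
  fix d assume ej: "e \<in> X" "j \<in> X" and d: "d \<in> Fx e \<inter> Fx j"
  have dX: "d \<in> X" "z e d = d" using d unfolding Fx_def by auto
  have "d \<in> Fx j" using d by blast
  then have "z e d \<in> Fx (z e j)" using Fx_g[OF zG[OF ej(1)] ej(2) dX(1)] by blast
  then show "d \<in> Fx (z e j)" using dX by simp
qed

lemma nc_image: assumes "nc e j" shows "nc e (z e j)"
proof -
  have X: "e \<in> X" "j \<in> X" using ncD assms by blast+
  have "nc (z e e) (z e j)" using nc_g[OF zG[OF X(1)]] assms by blast
  then show ?thesis using zi[OF X(1)] by simp
qed

lemma card_diff: "nc j k \<Longrightarrow> int (card (Fx j - Fx j \<inter> Fx k)) = s\<^sup>2 + s + 1"
  "nc j k \<Longrightarrow> int (card (Fx k - Fx j \<inter> Fx k)) = s\<^sup>2 + s + 1"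
proof -
  have *: "int (card (Fx u - Fx j \<inter> Fx k)) = s\<^sup>2 + s + 1" if "nc j k" "u \<in> X" "Fx j \<inter> Fx k \<subseteq> Fx u" for u
    using card_Diff_subset[OF _ that(3)] card_mono[OF finFx that(3)] finFx card_inter_nc[OF that(1)] card_Fx[OF that(2)]
      parameters(2) by (simp add: of_nat_diff)
  show "nc j k \<Longrightarrow> int (card (Fx j - Fx j \<inter> Fx k)) = s\<^sup>2 + s + 1"
    "nc j k \<Longrightarrow> int (card (Fx k - Fx j \<inter> Fx k)) = s\<^sup>2 + s + 1"
    using *[of j] *[of k] ncD by blast+
qed

text \<open>The three sets form a sunflower with a kernel of size \<open>s^2\<close> and petals of
  size \<open>s^2 + s + 1\<close>.\<close>

lemma union3:
  assumes ej: "nc e j"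
  shows "int (card (Fx e \<union> Fx j \<union> Fx (z e j))) = 4 * s\<^sup>2 + 3 * s + 3"
    and "nc j (z e j)"
proof -
  let ?k = "z e j"
  let ?C = "Fx e \<inter> Fx j"
  have X: "e \<in> X" "j \<in> X" using ncD ej by blast+
  have ek: "nc e ?k" by (rule nc_image[OF ej])
  have kj: "?k \<noteq> j" using ncD(4)[OF ej] .
  note k = common_third[OF ej ek Fx_image[OF X] kj]
  show "nc j ?k" by (rule k(1))
  have e: "Fx e \<union> Fx j \<union> Fx ?k = ?C \<union> ((Fx e - ?C) \<union> ((Fx j - ?C) \<union> (Fx ?k - ?C)))"
    using Fx_image[OF X] by blast
  have fin: "finite ?C" "finite (Fx u - ?C)" for u using finFx by blast+
  have d: "(Fx j - ?C) \<inter> (Fx ?k - ?C) = {}" "(Fx e - ?C) \<inter> ((Fx j - ?C) \<union> (Fx ?k - ?C)) = {}"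
    "?C \<inter> ((Fx e - ?C) \<union> ((Fx j - ?C) \<union> (Fx ?k - ?C))) = {}"
    using k(2,3) by blast+
  have "card (Fx e \<union> Fx j \<union> Fx ?k) = card ?C + (card (Fx e - ?C) + (card (Fx j - ?C) + card (Fx ?k - ?C)))"
    unfolding e using fin d by (simp only: card_Un_disjoint finite_Un simp_thms)
  moreover have "int (card (Fx ?k - ?C)) = s\<^sup>2 + s + 1" using card_diff(2)[OF k(1)] unfolding k(2) .
  ultimately show "int (card (Fx e \<union> Fx j \<union> Fx ?k)) = 4 * s\<^sup>2 + 3 * s + 3"
    using card_inter_nc[OF ej] card_diff[OF ej] by simp
qed

text \<open>A fourth petal does not fit: three sets already cover \<open>4 * s^2 + 3 * s + 3\<close>
  of the \<open>4 * s^2 + 4 * s + 2\<close> points.\<close>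

lemma only_third:
  assumes ej: "nc e j" and w: "nc e w" "Fx e \<inter> Fx j \<subseteq> Fx w"
  shows "w = j \<or> w = z e j"
proof (rule ccontr)
  assume a: "\<not> ?thesis"
  let ?k = "z e j"
  let ?C = "Fx e \<inter> Fx j"
  have X: "e \<in> X" "j \<in> X" "w \<in> X" using ncD ej w by blast+
  have ek: "nc e ?k" by (rule nc_image[OF ej])
  have kj: "?k \<noteq> j" using ncD(4)[OF ej] .
  note k = common_third[OF ej ek Fx_image[OF X(1,2)] kj]
  have wj: "w \<noteq> j" "w \<noteq> ?k" using a by auto
  note w1 = common_third[OF ej w wj(1)]
  have "Fx e \<inter> Fx ?k \<subseteq> Fx w" using k(3) w(2) by blast
  note w2 = common_third[OF ek w(1) this wj(2)]
  let ?U = "Fx e \<union> Fx j \<union> Fx ?k"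
  have "Fx w - ?C \<subseteq> X - ?U"
  proof
    fix y assume y: "y \<in> Fx w - ?C"
    then have "y \<notin> Fx e" using w1(3) by (metis DiffD1 DiffD2 IntI)
    moreover have "y \<notin> Fx j" using y w1(2) by (metis DiffD1 DiffD2 IntI)
    moreover have "y \<notin> Fx ?k" using y w2(2) k(3) by (metis DiffD1 DiffD2 IntI)
    moreover have "y \<in> X" using y Fx_sub[of w] by auto
    ultimately show "y \<in> X - ?U" by simp
  qed
  then have "card (Fx w - ?C) \<le> card (X - ?U)" using finX by (intro card_mono) auto
  moreover have "int (card (X - ?U)) = 2 * int p - int (card ?U)"
  proof -
    have "?U \<subseteq> X" using Fx_sub by blast
    then show ?thesis using card_Diff_subset[of ?U X] card_mono[OF finX, of ?U] finFx cardX by (simp add: of_nat_diff)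
  qed
  moreover have "int (card (Fx w - ?C)) = s\<^sup>2 + s + 1" using card_diff(2)[OF w1(1)] unfolding w1(2) .
  ultimately have "s\<^sup>2 + s + 1 \<le> 2 * int p - (4 * s\<^sup>2 + 3 * s + 3)" using union3(1)[OF ej] by linarith
  then have "s\<^sup>2 + 2 \<le> 0" unfolding parameters(1) by (simp add: algebra_simps)
  then show False using zero_le_power2[of s] by linarith
qed

text \<open>\<open>z e\<close> fixes the kernel of the sunflower, so iterating it on
  \<open>y\<close> stays among the two petals other than that of \<open>e\<close>.\<close>

lemma involutive: assumes "e \<in> X" "y \<in> X" shows "z e (z e y) = y"
proof (cases "nc e y")
  case True
  have n1: "nc e (z e y)" by (rule nc_image[OF True])
  have n2: "nc e (z e (z e y))" by (rule nc_image[OF n1])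
  have "Fx e \<inter> Fx y \<subseteq> Fx e \<inter> Fx (z e y)" using Fx_image[OF assms] by blast
  also have "\<dots> \<subseteq> Fx (z e (z e y))" using Fx_image[OF assms(1) zX[OF assms]] .
  finally have "z e (z e y) = y \<or> z e (z e y) = z e y" using only_third[OF True n2] by blast
  then show ?thesis using ncD(4)[OF n1] by blast
next
  case False
  then show ?thesis using assms unfolding nc_def Fx_def by simp
qed

text \<open>With \<open>involutive\<close>, the triple \<open>e\<close>, \<open>j\<close>,
  \<open>z e j\<close> becomes a line determined by any two of its points; the \<open>z e\<close>
  behave like a class of \<open>3\<close>-transpositions.\<close>

lemma third_sym: assumes "nc e j" shows "z j e = z e j"
proof -
  have X: "e \<in> X" "j \<in> X" using ncD assms by blast+
  have je: "nc j e" using assms nc_sym by blast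
  have "nc e (z j e)" using union3(2)[OF je] .
  moreover have "Fx e \<inter> Fx j \<subseteq> Fx (z j e)" using Fx_image[OF X(2,1)] by blast
  ultimately have "z j e = j \<or> z j e = z e j" by (rule only_third[OF assms])
  moreover have "z j e \<noteq> j" using inj_G[OF zG[OF X(2)], of e j] zi[OF X(2)] ncD(3)[OF assms] by simp
  ultimately show ?thesis by blast
qed

text \<open>Read with \<open>Fx_sym\<close>: the points commuting with \<open>y\<close> form a
  subspace, containing a line as soon as they contain two of its points.\<close>

lemma line_Fx:
  assumes ej: "nc e j" and y: "y \<in> X"
  shows "(y \<in> Fx e \<and> y \<in> Fx j \<longrightarrow> y \<in> Fx (z e j)) \<and> (y \<in> Fx e \<and> y \<in> Fx (z e j) \<longrightarrow> y \<in> Fx j)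
    \<and> (y \<in> Fx j \<and> y \<in> Fx (z e j) \<longrightarrow> y \<in> Fx e)"
proof -
  have X: "e \<in> X" "j \<in> X" using ncD ej by blast+
  have "Fx e \<inter> Fx (z e j) \<subseteq> Fx j" using Fx_image[OF X(1) zX[OF X]] involutive[OF X] by simp
  moreover have "Fx j \<inter> Fx (z e j) \<subseteq> Fx e"
    using Fx_image[OF X(2) zX[OF X(2,1)]] involutive[OF X(2,1)] third_sym[OF ej] by simp
  ultimately show ?thesis using Fx_image[OF X] by blast
qed

lemma nc_exists: obtains k where "nc o0 k"
proof -
  obtain k where "k \<in> X" "z o0 k \<noteq> k" using zne[OF o(1)] eq_id_iff[OF zG[OF o(1)]] by blast
  then have "nc o0 k" unfolding nc_def Fx_def using o(1) by blast
  then show thesis by (rule that)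
qed

text \<open>The sunflower has to fit into \<open>X\<close>, which gives \<open>s \<ge> 1\<close>,
  and \<open>s = 1\<close> means \<open>p = 5\<close>.\<close>

lemma s_ge_2: "s \<ge> 2"
proof -
  obtain k where "nc o0 k" by (rule nc_exists)
  then have u: "int (card (Fx o0 \<union> Fx k \<union> Fx (z o0 k))) = 4 * s\<^sup>2 + 3 * s + 3" by (rule union3(1))
  have "Fx o0 \<union> Fx k \<union> Fx (z o0 k) \<subseteq> X" using Fx_sub by blast
  then have "card (Fx o0 \<union> Fx k \<union> Fx (z o0 k)) \<le> 2 * p" using card_mono[OF finX] cardX by metis
  then have "s \<ge> 1" using u parameters(1) by linarith
  moreover have "s \<noteq> 1" using parameters(1) p(2) by auto
  ultimately show ?thesis by linarith
qed

section \<open>An affine plane of order three\<close>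

definition line :: "'a \<Rightarrow> 'a \<Rightarrow> 'a \<Rightarrow> bool"
  where "line e j k \<longleftrightarrow> nc e j \<and> k = z e j"

definition off :: "'a \<Rightarrow> 'a \<Rightarrow> 'a \<Rightarrow> 'a \<Rightarrow> bool"
  where "off e j k x \<longleftrightarrow> nc e x \<and> nc j x \<and> nc k x"

lemma line_perm: assumes "line e j k" shows "line j e k" "line e k j"
proof -
  have n: "nc e j" "k = z e j" using assms unfolding line_def by auto
  show "line j e k" unfolding line_def using n nc_sym third_sym[OF n(1)] by auto
  show "line e k j" unfolding line_def n(2)
    using nc_image[OF n(1)] involutive[of e j] ncD[OF n(1)] by simp
qed

lemma off_perm: "off e j k x \<Longrightarrow> off j e k x" "off e j k x \<Longrightarrow> off e k j x"
  unfolding off_def by auto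

lemma off_image: assumes "line e j k" "off e j k x" shows "off e j k (z e x)"
proof -
  have n: "nc e j" "k = z e j" "nc e x" "nc j x" "nc k x" using assms unfolding line_def off_def by auto
  have eG: "z e \<in> G" using zG ncD(1)[OF n(1)] .
  have "z e k = j" using line_perm(2)[OF assms(1)] unfolding line_def by simp
  then have "nc j (z e x)" using nc_g[OF eG, of k x] n(5) by simp
  moreover have "nc k (z e x)" using nc_g[OF eG, of j x] n by simp
  ultimately show ?thesis unfolding off_def using nc_image[OF n(3)] by blast
qed

lemma line_comp: assumes "line e j k" "y \<in> X" shows "z e (z j y) = z k (z e y)"
  using conj_fam_apply[OF zc zG, of e j y] ncD assms unfolding line_def by auto

text \<open>If \<open>t = z e (z j x)\<close> commuted with \<open>x\<close>, then applying
  \<open>z x\<close> to it would give \<open>t = z (z e x) j\<close>, so that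
  \<open>z j t = z e x\<close>. But \<open>z j t\<close> is also \<open>z k x\<close>, and
  \<open>z x\<close> would send \<open>e\<close> and \<open>k\<close> to the same point.\<close>

lemma nc_rotate: assumes l: "line e j k" and x: "off e j k x" shows "nc x (z e (z j x))"
proof (rule ccontr)
  assume a: "\<not> ?thesis"
  have n: "nc e j" "k = z e j" "nc e x" "nc j x" "nc k x" using l x unfolding line_def off_def by auto
  have X: "e \<in> X" "j \<in> X" "x \<in> X" "k \<in> X" using ncD n by blast+
  have ek: "nc e k" using line_perm(2)[OF l] unfolding line_def by blast
  define t where "t = z e (z j x)"
  have "t \<in> Fx x" using a X zX unfolding nc_def t_def by blast
  then have "t = z x (z e (z j x))" unfolding Fx_def t_def by simp
  also have "\<dots> = z (z x e) (z x (z j x))" using conj_fam_apply[OF zc zG[OF X(3)] X(1)] .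
  also have "z x e = z e x" by (rule third_sym[OF n(3)])
  also have "z x (z j x) = j" using third_sym[OF n(4)] involutive[OF X(3,2)] by simp
  finally have t: "t = z (z e x) j" .
  have "off e j k (z e x)" by (rule off_image[OF l x])
  then have "nc j (z e x)" unfolding off_def by blast
  then have "z j (z e x) = t" using third_sym nc_sym t by metis
  then have "z j t = z e x" using involutive[OF X(2) zX[OF X(1,3)]] by metis
  moreover have "z j t = z k x"
    using line_comp[OF line_perm(1)[OF l], of "z j x"] zX[OF X(2,3)] involutive[OF X(2,3)] unfolding t_def by simp
  ultimately have "z x k = z x e" using third_sym[OF n(3)] third_sym[OF n(5)] by simp
  then have "k = e" using inj_G[OF zG[OF X(3)]] by simp
  then show False using ncD(3)[OF ek] by simp
qed

theorem contradiction: False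
proof -
  obtain j where ej: "nc o0 j" by (rule nc_exists)
  define e where "e = o0"
  define k where "k = z e j"
  have l: "line e j k" unfolding line_def k_def e_def using ej by blast
  have ej: "nc e j" using ej unfolding e_def .
  note l' = l line_perm(1)[OF l] line_perm(2)[OF l] line_perm(1)[OF line_perm(2)[OF l]]
    line_perm(2)[OF line_perm(1)[OF l]] line_perm(2)[OF line_perm(1)[OF line_perm(2)[OF l]]]
  have X: "e \<in> X" "j \<in> X" "k \<in> X" using ncD l' unfolding line_def by blast+
  let ?U = "Fx e \<union> Fx j \<union> Fx k"
  have "int (card ?U) = 4 * s\<^sup>2 + 3 * s + 3" unfolding k_def by (rule union3(1)[OF ej])
  \<comment> \<open>This is where \<open>s \<ge> 2\<close> leaves room for a point \<open>x\<close>
    that commutes with none of \<open>e\<close>, \<open>j\<close>, \<open>k\<close>.\<close>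
  also have "\<dots> < 2 * int p" unfolding parameters(1) using s_ge_2 by simp
  finally have "card ?U < card X" using cardX by simp
  then have "\<not> X \<subseteq> ?U" using card_mono[of ?U X] finFx by fastforce
  then obtain x where x: "x \<in> X" "x \<notin> Fx e" "x \<notin> Fx j" "x \<notin> Fx k" by blast
  then have off1: "off e j k x" unfolding off_def nc_def using X by blast
  have offe: "off e j k (z e y)" and offj: "off e j k (z j y)" and offk: "off e j k (z k y)"
    if y: "off e j k y" for y
  proof -
    show "off e j k (z e y)" by (rule off_image[OF l y])
    show "off e j k (z j y)" using off_image[OF l'(2) off_perm(1)[OF y]] off_perm by blast
    have "line k e j" using l'(4) .
    then show "off e j k (z k y)"
      using off_image[of k e j y] off_perm(1)[of k e j "z k y"] off_perm(2)[of e k j "z k y"]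
        off_perm(2)[of e j k y] off_perm(1)[of e k j y] y by blast
  qed
  have offX: "y \<in> X" if "off e j k y" for y using that ncD unfolding off_def by blast
  \<comment> \<open>\<open>z e\<close>, \<open>z j\<close>, \<open>z k\<close> are the reflections
    of a symmetric group on three letters: \<open>x\<close>, \<open>a2\<close>, \<open>a3\<close>
    are the images of \<open>x\<close> under its rotations, \<open>b1\<close>, \<open>b2\<close>,
    \<open>b3\<close> those under its reflections.\<close>
  define a2 where "a2 = z e (z j x)"
  define a3 where "a3 = z j (z e x)"
  define b1 where "b1 = z e x"
  define b2 where "b2 = z j x"
  define b3 where "b3 = z k x"
  have off2: "off e j k a2" unfolding a2_def by (intro offe offj off1)
  have off3: "off e j k a3" unfolding a3_def by (intro offe offj off1)
  have offb: "off e j k b1" "off e j k b2" "off e j k b3"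
    unfolding b1_def b2_def b3_def by (intro offe offj offk off1)+
  have a2': "a2 = z k b1" "a2 = z j b3"
    unfolding a2_def b1_def b3_def using line_comp[OF l x(1)] line_comp[OF l'(5) x(1)] by simp_all
  have a3': "a3 = z e b3" "a3 = z k b2"
    unfolding a3_def b2_def b3_def using line_comp[OF l'(3) x(1)] line_comp[OF l'(2) x(1)] by simp_all
  have zz: "z i (z i y) = y" if "i \<in> X" "off e j k y" for i y using involutive[OF that(1) offX[OF that(2)]] .
  have b1': "z k a2 = b1" "z j a3 = b1" unfolding a2'(1) a3_def b1_def using zz X off1 offe by simp_all
  have b2': "z e a2 = b2" "z k a3 = b2" unfolding a3'(2) a2_def b2_def using zz X off1 offj by simp_all
  have b3': "z j a2 = b3" "z e a3 = b3" unfolding a2'(2) a3'(1) using zz X offb by simp_all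
  have base: "nc i y" if "off e j k y" "i = e \<or> i = j \<or> i = k" for i y using that unfolding off_def by blast
  have step: "nc y (z i y)" if "off e j k y" "i = e \<or> i = j \<or> i = k" for i y
    using union3(2)[OF base[OF that]] .
  have L: "nc e j" "nc e k" "nc j k" using l' unfolding line_def by blast+
  have aa: "nc x a2" "nc x a3" "nc a2 a3"
  proof -
    show "nc x a2" unfolding a2_def by (rule nc_rotate[OF l off1])
    show "nc x a3" unfolding a3_def by (rule nc_rotate[OF l'(2) off_perm(1)[OF off1]])
    show "nc a2 a3" using nc_rotate[OF l off2] unfolding b3' a3'(1) .
  qed
  have ab: "nc x b1" "nc x b2" "nc x b3" "nc a2 b1" "nc a2 b2" "nc a2 b3" "nc a3 b1" "nc a3 b2" "nc a3 b3"
    using step[OF off1] step[OF off2] step[OF off3] b1' b2' b3' unfolding b1_def b2_def b3_def by metis+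
  have bb: "nc b1 b2" "nc b1 b3" "nc b2 b3"
    using nc_g[OF zG[OF X(1)], of x a2] nc_g[OF zG[OF X(1)], of x a3] nc_g[OF zG[OF X(1)], of a2 a3] aa b2' b3'
    unfolding b1_def by simp_all
  define vs where "vs = [e, j, k, x, a2, a3, b1, b2, b3]"
  have pw: "sorted_wrt nc vs"
    unfolding vs_def using L aa ab bb base[OF off1] base[OF off2] base[OF off3] base[OF offb(1)] base[OF offb(2)] base[OF offb(3)]
    by simp
  have vsX: "set vs \<subseteq> X" unfolding vs_def using X offX off1 off2 off3 offb by simp
  have ncI: "nc (vs ! m) (vs ! n)" if "m < 9" "n < 9" "m \<noteq> n" for m n
  proof (cases "m < n")
    case True
    then show ?thesis using sorted_wrt_nth_less[OF pw True] that unfolding vs_def by simp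
  next
    case False
    then have "n < m" using that by simp
    then show ?thesis using sorted_wrt_nth_less[OF pw, of n m] that nc_sym unfolding vs_def by simp
  qed
  have vX: "vs ! m \<in> X" if "m < 9" for m 
  proof -
    have "length vs = 9" unfolding vs_def by simp
    then have "vs ! m \<in> set vs" using that by (intro nth_mem) simp
    then show ?thesis using vsX by (rule subsetD[rotated])
  qed
  \<comment> \<open>The number of the nine points that commute with \<open>y\<close>. Its first two
    moments over \<open>X\<close> are known, since the nine points are pairwise
    non-commuting.\<close>
  define K where "K y = (\<Sum>m<9. of_bool (y \<in> Fx (vs ! m)) :: int)" for y
  have Kpos: "(K y - 3) * (K y - 9) \<ge> 0" if y: "y \<in> X" for y
  proof -
    have lin: "(y \<in> Fx i \<and> y \<in> Fx u \<longrightarrow> y \<in> Fx w) \<and> (y \<in> Fx i \<and> y \<in> Fx w \<longrightarrow> y \<in> Fx u) \<and> (y \<in> Fx u \<and> y \<in> Fx w \<longrightarrow> y \<in> Fx i)"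
      if "off e j k u" "i = e \<or> i = j \<or> i = k" "z i u = w" for i u w
      using line_Fx[OF base[OF that(1,2)] y] unfolding that(3) .
    show ?thesis
    proof (rule affine_plane_count)
    show "K y = of_bool (y \<in> Fx e) + of_bool (y \<in> Fx j) + of_bool (y \<in> Fx k) + of_bool (y \<in> Fx x)
      + of_bool (y \<in> Fx a2) + of_bool (y \<in> Fx a3) + of_bool (y \<in> Fx b1) + of_bool (y \<in> Fx b2) + of_bool (y \<in> Fx b3)"
      unfolding K_def vs_def by (simp add: eval_nat_numeral)
  qed (rule line_Fx[OF ej y, folded k_def] lin[OF off1 _ b1_def[symmetric]] lin[OF off1 _ b2_def[symmetric]]
      lin[OF off1 _ b3_def[symmetric]] lin[OF off2 _ b1'(1)] lin[OF off2 _ b2'(1)] lin[OF off2 _ b3'(1)]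
      lin[OF off3 _ b1'(2)] lin[OF off3 _ b2'(2)] lin[OF off3 _ b3'(2)], simp?)+
  qed
  have card_sum: "(\<Sum>y\<in>X. of_bool (y \<in> A)) = int (card A)" if "A \<subseteq> X" for A
  proof -
    have "X \<inter> A = A" using that by blast
    then show ?thesis using finX by (simp add: of_bool_def sum.If_cases)
  qed
  have S1: "(\<Sum>y\<in>X. K y) = 9 * f"
  proof -
    have "(\<Sum>y\<in>X. K y) = (\<Sum>m<9. int (card (Fx (vs ! m))))"
      unfolding K_def by (subst sum.swap) (simp add: card_sum[OF Fx_sub])
    also have "\<dots> = (\<Sum>m<(9::nat). f)" using card_Fx[OF vX] by (intro sum.cong) auto
    finally show ?thesis by simp
  qed
  have S2: "(\<Sum>y\<in>X. K y * K y) = 9 * f + 72 * s\<^sup>2"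
  proof -
    have "(\<Sum>y\<in>X. K y * K y) = (\<Sum>y\<in>X. \<Sum>m<9. \<Sum>n<9. of_bool (y \<in> Fx (vs ! m) \<inter> Fx (vs ! n)))"
      unfolding K_def sum_product by (simp only: of_bool_conj Int_iff)
    also have "\<dots> = (\<Sum>m<9. \<Sum>y\<in>X. \<Sum>n<9. of_bool (y \<in> Fx (vs ! m) \<inter> Fx (vs ! n)))" by (rule sum.swap)
    also have "\<dots> = (\<Sum>m<9. \<Sum>n<9. \<Sum>y\<in>X. of_bool (y \<in> Fx (vs ! m) \<inter> Fx (vs ! n)))"
      by (intro sum.cong refl) (rule sum.swap)
    also have "\<dots> = (\<Sum>m<9. \<Sum>n<9. int (card (Fx (vs ! m) \<inter> Fx (vs ! n))))"
      using Fx_sub by (intro sum.cong refl card_sum) blast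
    also have "\<dots> = (\<Sum>m<(9::nat). \<Sum>n<(9::nat). if n = m then f else s\<^sup>2)"
    proof (intro sum.cong refl)
      fix m n :: nat assume mn: "m \<in> {..<9}" "n \<in> {..<9}"
      show "int (card (Fx (vs ! m) \<inter> Fx (vs ! n))) = (if n = m then f else s\<^sup>2)"
        using card_Fx[OF vX, of m] card_inter_nc[OF ncI, of m n] mn by auto
    qed
    also have "\<dots> = (\<Sum>m<(9::nat). \<Sum>n<(9::nat). (if n = m then f - s\<^sup>2 else 0) + s\<^sup>2)"
      by (intro sum.cong) auto
    also have "\<dots> = (\<Sum>m<(9::nat). f - s\<^sup>2 + 9 * s\<^sup>2)"
      by (intro sum.cong refl) (simp add: sum.distrib)
    finally show ?thesis by simp
  qed
  \<comment> \<open>Every summand is nonnegative by the affine plane, while the two moments make the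
    sum negative.\<close>
  have "0 \<le> (\<Sum>y\<in>X. (K y - 3) * (K y - 9))" using Kpos by (rule sum_nonneg)
  also have "\<dots> = (\<Sum>y\<in>X. K y * K y) - 12 * (\<Sum>y\<in>X. K y) + 27 * (2 * int p)"
  proof -
    have "(K y - 3) * (K y - 9) = K y * K y - 12 * K y + 27" for y by (simp add: algebra_simps)
    then show ?thesis using cardX by (simp add: sum.distrib sum_subtractf sum_distrib_left[symmetric])
  qed
  also have "\<dots> = - 18 * s\<^sup>2 + 9 * s - 45" unfolding S1 S2 parameters by (simp add: algebra_simps)
  finally have "18 * s\<^sup>2 \<le> 9 * s" by simp
  moreover have "s * 2 \<le> s * s" using s_ge_2 by (intro mult_left_mono) auto
  ultimately show False using s_ge_2 by (simp add: power2_eq_square)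
qed

end

section \<open>Trace two\<close>

text \<open>\<open>P\<close> and \<open>Q\<close> stand for the first rows of the two diagonal
  blocks of the matrix of commuting pairs. The three ones of \<open>P\<close> are at
  \<open>0\<close>, \<open>x\<close>, \<open>- x\<close>, and evaluating the vanishing product at
  \<open>x\<close> leaves \<open>Q (2 * x) - 1\<close>. So doubling leads from the support of one
  block to that of the other.\<close>

lemma doubling_pattern:
  fixes P Q :: "int \<Rightarrow> int"
  assumes p: "prime p" "p > 5" and per: "periodic p P" "periodic p Q"
    and P01: "\<And>x. P x = 0 \<or> P x = 1" and Psym: "\<And>x. P (- x) = P x" and P0: "P 0 = 1" and Q0: "Q 0 = 1"
    and Psum: "(\<Sum>x\<in>{0..<int p}. P x) = 3"
    and disj: "\<And>x. \<not> int p dvd x \<Longrightarrow> P x = 1 \<Longrightarrow> Q x = 0"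
    and conv0: "\<And>x. \<not> int p dvd x \<Longrightarrow>
      conv p (\<lambda>x. P x - (if int p dvd x then 2 else 0)) (\<lambda>x. Q x - (if int p dvd x then 2 else 0)) x = 0"
    and x: "\<not> int p dvd x" "P x = 1"
  shows "Q (2 * x) = 1" and "P y = 1 \<Longrightarrow> int p dvd y \<or> int p dvd y - x \<or> int p dvd y + x"
proof -
  let ?I = "{0..<int p}"
  have p0: "int p > 0" using p by simp
  have pP: "prime (int p)" using p(1) by simp
  have p2: "\<not> int p dvd 2" using p(2) by (auto dest: zdvd_imp_le)
  then have x2: "\<not> int p dvd 2 * x" using x(1) pP prime_dvd_mult_iff by blast
  define A where "A = {0, x mod int p, (- x) mod int p}"
  have AI: "A \<subseteq> ?I" unfolding A_def using p0 by auto
  have ne: "x mod int p \<noteq> 0" "(- x) mod int p \<noteq> 0" "x mod int p \<noteq> (- x) mod int p"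
  proof -
    show "x mod int p \<noteq> 0" using x(1) by (simp add: dvd_eq_mod_eq_0)
    show "(- x) mod int p \<noteq> 0" using x(1) by (metis dvd_eq_mod_eq_0 dvd_minus_iff)
    show "x mod int p \<noteq> (- x) mod int p" using x2 by (simp add: mod_eq_dvd_iff)
  qed
  have PA: "P y = 1" if "y \<in> A" for y
    using that P0 x(2) Psym per(1) unfolding A_def periodic_def by auto
  have cA: "card A = 3" unfolding A_def using ne by simp
  have "(\<Sum>y\<in>?I. P y) = (\<Sum>y\<in>?I - A. P y) + (\<Sum>y\<in>A. P y)" by (rule sum.subset_diff[OF AI]) simp
  moreover have "(\<Sum>y\<in>A. P y) = 3" using PA cA by simp
  ultimately have "(\<Sum>y\<in>?I - A. P y) = 0" using Psum by simp
  moreover have "P y \<ge> 0" for y using P01[of y] by auto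
  ultimately have PnA: "P y = 0" if "y \<in> ?I - A" for y
    using that by (subst (asm) sum_nonneg_eq_0_iff) auto
  show "int p dvd y \<or> int p dvd y - x \<or> int p dvd y + x" if "P y = 1" for y
  proof -
    have "P (y mod int p) = 1" using that per(1) unfolding periodic_def by simp
    then have "y mod int p \<in> A" using PnA[of "y mod int p"] p0 by auto
    then have "y mod int p = 0 \<or> y mod int p = x mod int p \<or> y mod int p = (- x) mod int p" unfolding A_def by blast
    then show ?thesis by (auto simp: mod_eq_dvd_iff dvd_eq_mod_eq_0)
  qed
  define P' where "P' y = P y - (if int p dvd y then 2 else 0)" for y
  define Q' where "Q' y = Q y - (if int p dvd y then 2 else 0)" for y
  have "0 = (\<Sum>y\<in>?I. P' y * Q' (x - y))"
    using conv0[OF x(1)] unfolding conv_def P'_def Q'_def by simp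
  also have "\<dots> = (\<Sum>y\<in>A. P' y * Q' (x - y))"
  proof (rule sum.mono_neutral_right[OF _ AI])
    show "\<forall>i\<in>?I - A. P' i * Q' (x - i) = 0"
    proof
      fix i assume i: "i \<in> ?I - A"
      then have "\<not> int p dvd i" using zdvd_imp_le[of "int p" i] unfolding A_def by auto
      then show "P' i * Q' (x - i) = 0" unfolding P'_def using PnA[OF i] by simp
    qed
  qed simp
  also have "\<dots> = P' 0 * Q' x + (P' (x mod int p) * Q' (x - x mod int p) + P' ((- x) mod int p) * Q' (x - (- x) mod int p))"
    unfolding A_def using ne by simp
  also have "P' 0 = - 1" unfolding P'_def using P0 by simp
  also have "Q' x = 0" unfolding Q'_def using x disj by simp
  also have "P' (x mod int p) = 1" unfolding P'_def using x per(1) by (simp add: periodic_def dvd_mod_iff)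
  also have "P' ((- x) mod int p) = 1"
    unfolding P'_def using x per(1) Psym by (simp add: periodic_def dvd_mod_iff)
  also have "Q' (x - x mod int p) = - 1"
  proof -
    have d: "int p dvd x - x mod int p" by (simp add: mod_eq_dvd_iff[symmetric])
    then have "Q (x - x mod int p) = Q 0" by (intro periodic_cong[OF per(2)]) (simp add: dvd_eq_mod_eq_0)
    then show ?thesis unfolding Q'_def using Q0 d by simp
  qed
  also have "Q' (x - (- x) mod int p) = Q (2 * x)"
  proof -
    have e: "(x - (- x) mod int p) mod int p = (2 * x) mod int p" by (simp add: mod_diff_right_eq)
    then have "\<not> int p dvd x - (- x) mod int p" using x2 by (metis dvd_eq_mod_eq_0)
    then show ?thesis unfolding Q'_def using periodic_cong[OF per(2) e] by simp
  qed
  finally show "Q (2 * x) = 1" by simp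
qed

locale deg2p_conference = deg2p_crossless +
  assumes c2: "c = 2"
begin

definition u :: int where "u = f - 1"

text \<open>For \<open>c = 2\<close> the second root of the quadratic polynomial is
  \<open>0\<close>, so subtracting the all-one matrix leaves a multiple of an idempotent.\<close>

definition Y :: "'a \<Rightarrow> 'a \<Rightarrow> int" where "Y j k = M j k - 1"

lemma gY: "ginv Y" using gM unfolding ginv_def Y_def by simp

lemma Y_row: "j \<in> X \<Longrightarrow> (\<Sum>k\<in>X. Y j k) = 0"
  unfolding Y_def using row cardX by (simp add: sum_subtractf)

lemma Y_sq: assumes "j \<in> X" "k \<in> X" shows "mmul X Y Y j k = 2 * u * Y j k"
proof -
  have "mmul X Y Y j k = (\<Sum>l\<in>X. M j l * M l k - M j l - M l k + 1)"
    unfolding mmul_def Y_def by (simp add: algebra_simps)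
  also have "\<dots> = mmul X M M j k - 2 * int p"
    using row[OF assms(1)] col[OF assms(2)] cardX by (simp add: mmul_def sum.distrib sum_subtractf)
  finally have "2 * mmul X Y Y j k = 2 * mmul X M M j k - 4 * int p" by simp
  also have "\<dots> = 4 * u * M j k + 2 * (2 * int p - 2 * u) - 4 * int p"
    unfolding identity[OF assms] unfolding c2 nu_def u_def by (simp add: algebra_simps)
  finally show ?thesis unfolding Y_def by (simp add: algebra_simps)
qed

lemma line_sums: assumes A: "ginv A" and jk: "j \<in> X" "k \<in> X"
  shows "(\<Sum>l\<in>X. A j l) = (\<Sum>l\<in>X. A l k)"
proof -
  have r: "(\<Sum>l\<in>X. A j l) = (\<Sum>l\<in>X. A i l)" and c: "(\<Sum>l\<in>X. A l j) = (\<Sum>l\<in>X. A l i)"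
    if "i \<in> X" "j \<in> X" for i j
  proof -
    obtain g where g: "g \<in> G" "g i = j" using transitive \<open>i \<in> X\<close> \<open>j \<in> X\<close> by blast
    have "(\<Sum>l\<in>X. A j l) = (\<Sum>l\<in>X. A (g i) (g l))" unfolding g(2) by (rule sum_reindex_G[OF g(1), symmetric])
    also have "\<dots> = (\<Sum>l\<in>X. A i l)" using ginvD[OF A g(1) \<open>i \<in> X\<close>] by (intro sum.cong) auto
    finally show "(\<Sum>l\<in>X. A j l) = (\<Sum>l\<in>X. A i l)" .
    have "(\<Sum>l\<in>X. A l j) = (\<Sum>l\<in>X. A (g l) (g i))" unfolding g(2) by (rule sum_reindex_G[OF g(1), symmetric])
    also have "\<dots> = (\<Sum>l\<in>X. A l i)" using ginvD[OF A g(1) _ \<open>i \<in> X\<close>] by (intro sum.cong) auto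
    finally show "(\<Sum>l\<in>X. A l j) = (\<Sum>l\<in>X. A l i)" .
  qed
  have "int (card X) * (\<Sum>l\<in>X. A j l) = (\<Sum>i\<in>X. \<Sum>l\<in>X. A j l)" by simp
  also have "\<dots> = (\<Sum>i\<in>X. \<Sum>l\<in>X. A i l)" by (intro sum.cong refl r jk(1))
  also have "\<dots> = (\<Sum>l\<in>X. \<Sum>i\<in>X. A i l)" by (rule sum.swap)
  also have "\<dots> = (\<Sum>l\<in>X. \<Sum>i\<in>X. A i k)" by (intro sum.cong refl c jk(2))
  also have "\<dots> = int (card X) * (\<Sum>l\<in>X. A l k)" by simp
  finally show ?thesis using cardX p_pos by simp
qed

lemma Y_commute: assumes A: "ginv A" and jk: "j \<in> X" "k \<in> X"
  shows "mmul X Y A j k = mmul X A Y j k"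
proof -
  have "mmul X Y A j k = mmul X M A j k - (\<Sum>l\<in>X. A l k)"
    unfolding mmul_def Y_def by (simp add: algebra_simps sum_subtractf)
  also have "\<dots> = mmul X A M j k - (\<Sum>l\<in>X. A j l)"
    using cmat_commute[OF zc A jk] line_sums[OF A jk] by simp
  also have "\<dots> = mmul X A Y j k"
    unfolding mmul_def Y_def by (simp add: algebra_simps sum_subtractf)
  finally show ?thesis .
qed

text \<open>\<^term>\<open>Y\<close> is normal and \<^term>\<open>Y\<close> squared is a real multiple of \<^term>\<open>Y\<close>, hence it is symmetric,
  and it vanishes if the multiple is zero.\<close>

lemma Y_gram: assumes "j \<in> X" "k \<in> X" shows "(\<Sum>l\<in>X. Y l j * Y l k) = 2 * u * Y j k"
proof -
  define W where "W j k = (\<Sum>l\<in>X. Y l j * Y l k)" for j k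
  have gT: "ginv (\<lambda>j k. Y k j)" using gY unfolding ginv_def by simp
  have Wn: "W j k = (\<Sum>l\<in>X. Y j l * Y k l)" if "j \<in> X" "k \<in> X" for j k
    using Y_commute[OF gT that] unfolding W_def mmul_def by simp
  have sq: "(\<Sum>l\<in>X. Y j l * Y l k) = 2 * u * Y j k" if "j \<in> X" "k \<in> X" for j k
    using Y_sq[OF that] unfolding mmul_def .
  have h1: "(\<Sum>l\<in>X. Y l j * W l k) = 2 * u * W j k" if "j \<in> X" "k \<in> X" for j k
  proof -
    have "(\<Sum>l\<in>X. Y l j * W l k) = (\<Sum>l\<in>X. \<Sum>m\<in>X. Y m l * Y l j * Y m k)"
      unfolding W_def by (simp add: sum_distrib_left algebra_simps)
    also have "\<dots> = (\<Sum>m\<in>X. (\<Sum>l\<in>X. Y m l * Y l j) * Y m k)"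
      by (subst sum.swap) (simp add: sum_distrib_right)
    also have "\<dots> = (\<Sum>m\<in>X. 2 * u * Y m j * Y m k)" using sq that by (intro sum.cong) auto
    finally show ?thesis unfolding W_def by (simp add: sum_distrib_left mult.assoc)
  qed
  have h2: "(\<Sum>l\<in>X. Y m l * W l k) = 2 * u * W m k" if "m \<in> X" "k \<in> X" for m k
  proof -
    have "(\<Sum>l\<in>X. Y m l * W l k) = (\<Sum>l\<in>X. \<Sum>n\<in>X. Y m l * Y l n * Y k n)"
      using Wn that by (intro sum.cong) (auto simp: sum_distrib_left mult.assoc)
    also have "\<dots> = (\<Sum>n\<in>X. (\<Sum>l\<in>X. Y m l * Y l n) * Y k n)"
      by (subst sum.swap) (simp add: sum_distrib_right)
    also have "\<dots> = (\<Sum>n\<in>X. 2 * u * Y m n * Y k n)" using sq that by (intro sum.cong) auto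
    finally show ?thesis using Wn[OF that] by (simp add: sum_distrib_left mult.assoc)
  qed
  have h3: "(\<Sum>l\<in>X. W l j * W l k) = 4 * u * u * W j k" if "j \<in> X" "k \<in> X" for j k
  proof -
    have "(\<Sum>l\<in>X. W l j * W l k) = (\<Sum>l\<in>X. \<Sum>m\<in>X. Y m j * (Y m l * W l k))"
      unfolding W_def[of _ j] sum_distrib_right by (intro sum.cong refl) (simp add: mult_ac)
    also have "\<dots> = (\<Sum>m\<in>X. Y m j * (\<Sum>l\<in>X. Y m l * W l k))"
      by (subst sum.swap) (simp add: sum_distrib_left)
    also have "\<dots> = (\<Sum>m\<in>X. Y m j * (2 * u * W m k))" using h2 that by (intro sum.cong) auto
    also have "\<dots> = 2 * u * (\<Sum>m\<in>X. Y m j * W m k)" by (simp add: sum_distrib_left algebra_simps)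
    finally show ?thesis unfolding h1[OF that] by simp
  qed
  have k: "k \<in> X" by fact
  \<comment> \<open>The spectral argument as a vanishing sum of squares over a column; normality has
    entered through \<open>Wn\<close>.\<close>
  have "(\<Sum>l\<in>X. (2 * u * Y l k - W l k)\<^sup>2)
      = 4 * u * u * (\<Sum>l\<in>X. Y l k * Y l k) - 4 * u * (\<Sum>l\<in>X. Y l k * W l k) + (\<Sum>l\<in>X. W l k * W l k)"
    by (simp add: power2_eq_square algebra_simps sum.distrib sum_subtractf sum_distrib_left)
  also have "\<dots> = 0" unfolding h1[OF k k] h3[OF k k] W_def[of k k, symmetric] by simp
  finally have "\<forall>l\<in>X. (2 * u * Y l k - W l k)\<^sup>2 = 0"
    using finX by (subst (asm) sum_nonneg_eq_0_iff) auto
  then show ?thesis using assms(1) unfolding W_def by simp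
qed

text \<open>For \<open>u = 0\<close> the matrix \<open>Y\<close> vanishes, so all entries of
  \<open>M\<close> are \<open>1\<close> and the family is a Latin square.\<close>

lemma u_pos: "u > 0"
proof (rule ccontr)
  assume "\<not> u > 0"
  then have u0: "u = 0" using f_pos unfolding u_def by simp
  have "Y l k = 0" if "l \<in> X" "k \<in> X" for l k
  proof -
    have "(\<Sum>l\<in>X. Y l k * Y l k) = 0" using Y_gram[OF that(2,2)] u0 by simp
    then have "\<forall>l\<in>X. Y l k * Y l k = 0" using finX by (subst (asm) sum_nonneg_eq_0_iff) auto
    then show ?thesis using that by simp
  qed
  then have "M l k = 1" if "l \<in> X" "k \<in> X" for l k using that unfolding Y_def by fastforce
  then show False using no_latin_family[OF z] by blast
qed

lemma Y_sym: assumes "j \<in> X" "k \<in> X" shows "Y j k = Y k j"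
proof -
  have "2 * u * Y j k = 2 * u * Y k j"
    using Y_gram[OF assms] Y_gram[OF assms(2,1)] by (simp add: mult.commute)
  then show ?thesis using u_pos by simp
qed

lemma Y_diag: "j \<in> X \<Longrightarrow> Y j j = u" unfolding Y_def u_def using Mjj by simp

abbreviation "y \<equiv> blk Y"

lemma y_trace: "y False False x + y True True x = (if int p dvd x then 2 * u else 0)"
proof (cases "int p dvd x")
  case True
  then show ?thesis using tr_0[OF gY True] Y_diag[OF o(1)] unfolding tr_def by simp
next
  case False
  then show ?thesis using trM[OF False] c2 unfolding blk_def Y_def by simp
qed

lemma per: "periodic p (blk A b d)" by (rule periodic_blk)

lemma conv_comm: "conv p (blk A b d) (blk B b' d') x = conv p (blk B b' d') (blk A b d) x"
  by (rule conv_commute[OF p_pos per per])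

lemma y_trace_conv: "conv p (y False False) (blk A b d) x + conv p (y True True) (blk A b d) x = 2 * u * blk A b d x"
proof -
  have "conv p (y False False) (blk A b d) x + conv p (y True True) (blk A b d) x
      = conv p (\<lambda>x. y False False x + y True True x) (blk A b d) x" by (rule conv_add_left[symmetric])
  also have "\<dots> = conv p (\<lambda>x. 2 * u * (if int p dvd x then 1 else 0) + 0) (blk A b d) x"
    by (rule conv_cong) (simp_all add: y_trace)
  also have "\<dots> = 2 * u * blk A b d x" unfolding conv_delta_const_left[OF p_pos per] by simp
  finally show ?thesis .
qed

text \<open>Over the group ring, \<open>Y\<close> is \<open>2 * u\<close> times an idempotent of
  trace one, and a matrix absorbed by such an idempotent on both sides is its own trace times the
  idempotent. The four entries are checked using commutativity of the group ring.\<close>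

lemma rank_one:
  assumes Q: "ginv Q" and YQ: "\<And>j k. j \<in> X \<Longrightarrow> k \<in> X \<Longrightarrow> mmul X Y Q j k = 2 * u * Q j k"
    and QY: "\<And>j k. j \<in> X \<Longrightarrow> k \<in> X \<Longrightarrow> mmul X Q Y j k = 2 * u * Q j k"
  shows "2 * u * blk Q b d x = conv p (tr Q) (y b d) x"
proof -
  let ?q = "blk Q"
  have yq: "conv p (y b False) (?q False d) x + conv p (y b True) (?q True d) x = 2 * u * ?q b d x" for b d x
    using blk_mmul[OF gY Q, of b d x] YQ[OF pt_mem pt_mem] unfolding blk_def by simp
  have qy: "conv p (?q b False) (y False d) x + conv p (?q b True) (y True d) x = 2 * u * ?q b d x" for b d x
    using blk_mmul[OF Q gY, of b d x] QY[OF pt_mem pt_mem] unfolding blk_def by simp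
  have t: "conv p (tr Q) (y b d) x = conv p (?q False False) (y b d) x + conv p (?q True True) (y b d) x"
    unfolding tr_def[abs_def] by (rule conv_add_left)
  note tc = y_trace_conv[of Q]
  show ?thesis
  proof (cases b; cases d)
    assume [simp]: "b" "d"
    have "b = True" "d = True" by auto
    then show ?thesis unfolding t
      using qy[of True True x] yq[of False False x] tc[of False False x]
        conv_comm[of Q False False Y True True x] conv_comm[of Y False True Q True False x] by simp
  next
    assume "b" "\<not> d"
    then have "b = True" "d = False" by auto
    then show ?thesis unfolding t
      using qy[of True False x] yq[of True False x] tc[of True False x]
        conv_comm[of Q False False Y True False x] conv_comm[of Q True False Y False False x] by simp
  next
    assume "\<not> b" "d"
    then have "b = False" "d = True" by auto
    then show ?thesis unfolding t
      using qy[of False True x] yq[of False True x] tc[of False True x]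
        conv_comm[of Q True True Y False True x] conv_comm[of Q False True Y True True x] by simp
  next
    assume "\<not> b" "\<not> d"
    then have "b = False" "d = False" by auto
    then show ?thesis unfolding t
      using qy[of False False x] yq[of True True x] tc[of True True x]
        conv_comm[of Q True True Y False False x] conv_comm[of Y True False Q False True x] by simp
  qed
qed

section \<open>A common eigenvector of the invariant matrices\<close>

definition vec :: "'a \<Rightarrow> int" where "vec j = (if side j then - 1 else 1)"

definition bsum :: "('a \<Rightarrow> 'a \<Rightarrow> int) \<Rightarrow> bool \<Rightarrow> bool \<Rightarrow> int"
  where "bsum A b d = (\<Sum>x\<in>{0..<int p}. blk A b d x)"

lemma bsum_row: "ginv A \<Longrightarrow> (\<Sum>k\<in>X. A (pt b 0) k) = bsum A b False + bsum A b True"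
  unfolding sum_X bsum_def blk_def ..

lemma bsum_col: assumes A: "ginv A" shows "(\<Sum>k\<in>X. A k (pt d 0)) = bsum A False d + bsum A True d"
proof -
  have "(\<Sum>x\<in>{0..<int p}. A (pt b x) (pt d 0)) = bsum A b d" for b
    unfolding bsum_def blk_shift[OF A] by (rule sum_reflect[OF p_pos per])
  then show ?thesis unfolding sum_X by simp
qed

lemma bsum_eq: assumes A: "ginv A" shows "bsum A True True = bsum A False False" "bsum A True False = bsum A False True"
proof -
  have e: "bsum A b False + bsum A b True = bsum A False d + bsum A True d" for b d
    using line_sums[OF A pt_mem pt_mem, of b 0 d 0] unfolding bsum_row[OF A] bsum_col[OF A] .
  show "bsum A True True = bsum A False False" "bsum A True False = bsum A False True"
    using e[of False False] e[of True True] e[of False True] e[of True False] by linarith+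
qed

lemma vec_eigen: assumes A: "ginv A" and j: "j \<in> X"
  shows "(\<Sum>k\<in>X. A j k * vec k) = (bsum A False False - bsum A False True) * vec j"
proof -
  obtain b s where s: "j = pt b s" using pt_cases[OF j] by blast
  have v: "vec (pt d x) = (if d then - 1 else 1)" for d x unfolding vec_def side_pt ..
  have "(\<Sum>k\<in>X. A j k * vec k) = (\<Sum>x\<in>{0..<int p}. blk A b False (x - s)) - (\<Sum>x\<in>{0..<int p}. blk A b True (x - s))"
    unfolding sum_X s blk_shift[OF A] v by (simp add: sum_negf)
  also have "\<dots> = bsum A b False - bsum A b True" unfolding bsum_def sum_shift[OF p_pos per] ..
  finally show ?thesis unfolding s v using bsum_eq[OF A] by (cases b) auto
qed

lemma Y_bsum: "bsum Y False False - bsum Y False True = 2 * u"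
proof -
  have "bsum Y False False + bsum Y True True = (\<Sum>x\<in>{0..<int p}. if int p dvd x then 2 * u else 0)"
    unfolding bsum_def y_trace[symmetric] by (rule sum.distrib[symmetric])
  also have "\<dots> = (\<Sum>x\<in>{0..<int p}. if x = 0 then 2 * u else 0)"
    by (intro sum.cong refl) (auto dest: zdvd_imp_le)
  also have "\<dots> = 2 * u" using p_pos by simp
  finally have "bsum Y False False = u" using bsum_eq[OF gY] by simp
  moreover have "bsum Y False False + bsum Y False True = 0"
    using Y_row[OF pt_mem] bsum_row[OF gY, of False] by simp
  ultimately show ?thesis by simp
qed

text \<open>This expresses that the eigenspace of \<^term>\<open>Y\<close> is irreducible over the rationals.\<close>

lemma scalar:
  assumes Q: "ginv Q" and YQ: "\<And>j k. j \<in> X \<Longrightarrow> k \<in> X \<Longrightarrow> mmul X Y Q j k = 2 * u * Q j k"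
    and QY: "\<And>j k. j \<in> X \<Longrightarrow> k \<in> X \<Longrightarrow> mmul X Q Y j k = 2 * u * Q j k"
    and jk: "j \<in> X" "k \<in> X"
  shows "2 * u * Q j k = (bsum Q False False - bsum Q False True) * Y j k"
proof -
  let ?I = "{0..<int p}"
  define ka where "ka = bsum Q False False - bsum Q False True"
  define S where "S = {j \<in> X. side j}"
  have S: "S \<subseteq> X" "pt True 0 \<in> S" "pt False 0 \<notin> S" unfolding S_def using pt_mem side_pt by auto
  then have "S \<noteq> {}" "S \<noteq> X" using pt_mem by blast+
  \<comment> \<open>Such a \<open>g\<close> turns \<open>vec\<close> into a vector \<open>n\<close>
    that is not constant on both orbits of \<open>a\<close>, yet belongs to the same eigenvalue of
    every invariant matrix.\<close>
  then obtain g where g: "g \<in> G" "g ` S \<noteq> S" "g ` S \<noteq> X - S" using no_split[OF S(1)] by blast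
  define n where "n j = vec (g j)" for j
  have An: "(\<Sum>k\<in>X. A j k * n k) = (bsum A False False - bsum A False True) * n j"
    if A: "ginv A" and j: "j \<in> X" for A j
  proof -
    have "(\<Sum>k\<in>X. A j k * n k) = (\<Sum>k\<in>X. A (g j) (g k) * vec (g k))"
      unfolding n_def using ginvD[OF A g(1) j] by (intro sum.cong) auto
    also have "\<dots> = (\<Sum>k\<in>X. A (g j) k * vec k)" by (rule sum_reindex_G[OF g(1)])
    finally show ?thesis unfolding vec_eigen[OF A mem_X[OF g(1) j]] n_def .
  qed
  \<comment> \<open>The sign of \<open>x\<close> turns the action of a matrix on \<open>n\<close>
    into a product in the group ring.\<close>
  define m where "m d x = n (pt d (- x))" for d x
  have perm: "periodic p (m d)" for d
    unfolding m_def by (rule periodicI) (metis mod_minus_cong pt_mod)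
  have conv_m: "conv p (blk A b False) (m False) x + conv p (blk A b True) (m True) x
      = (bsum A False False - bsum A False True) * m b x" if A: "ginv A" for A b x
  proof -
    have "(\<Sum>s\<in>?I. A (pt b (- x)) (pt d s) * n (pt d s)) = conv p (blk A b d) (m d) x" for d
    proof -
      have "(\<Sum>s\<in>?I. A (pt b (- x)) (pt d s) * n (pt d s)) = (\<Sum>s\<in>?I. blk A b d (s - (- x)) * m d (x - (s - (- x))))"
        unfolding blk_shift[OF A] m_def by simp
      also have "\<dots> = conv p (blk A b d) (m d) x"
        unfolding conv_def by (rule sum_shift[OF p_pos periodic_times[OF per periodic_sub[OF perm]]])
      finally show ?thesis .
    qed
    then show ?thesis using An[OF A pt_mem[of b "- x"]] unfolding sum_X m_def[symmetric] by simp
  qed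
  have perq: "periodic p (tr Q)" using per unfolding tr_def[abs_def] periodic_def by simp
  have qm: "conv p (tr Q) (m b) x = ka * m b x" for b x
  proof -
    have "2 * u * (conv p (blk Q b False) (m False) x + conv p (blk Q b True) (m True) x)
        = conv p (\<lambda>x. 2 * u * blk Q b False x) (m False) x + conv p (\<lambda>x. 2 * u * blk Q b True x) (m True) x"
      unfolding conv_scale_left by (simp add: distrib_left)
    also have "\<dots> = conv p (conv p (tr Q) (y b False)) (m False) x + conv p (conv p (tr Q) (y b True)) (m True) x"
      by (intro arg_cong2[of _ _ _ _ "(+)"] conv_cong refl rank_one[OF Q YQ QY])
    also have "\<dots> = conv p (tr Q) (conv p (y b False) (m False)) x + conv p (tr Q) (conv p (y b True) (m True)) x"
      unfolding conv_assoc[OF p_pos perq per perm] ..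
    also have "\<dots> = conv p (tr Q) (\<lambda>x. 2 * u * m b x) x"
      unfolding conv_add_right[symmetric] conv_m[OF gY] Y_bsum ..
    also have "\<dots> = 2 * u * conv p (tr Q) (m b) x" by (rule conv_scale_right)
    finally have "2 * u * (ka * m b x) = 2 * u * conv p (tr Q) (m b) x"
      unfolding conv_m[OF Q] ka_def .
    then show ?thesis using u_pos by simp
  qed
  obtain b s t where bst: "m b s \<noteq> m b t"
  proof (rule ccontr)
    assume "\<not> thesis"
    then have "m b s = m b t" for b s t using that by blast
    then have "n (pt b s) = n (pt b t)" for b s t unfolding m_def by (metis minus_minus)
    then have "side (g (pt b s)) = side (g (pt b t))" for b s t
      unfolding n_def vec_def by (metis one_neq_neg_one)
    then have cst: "side (g (pt b s)) = side (g (pt b 0))" for b s by blast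
    have eqv: "side (g j) = (if side j then side (g (pt True 0)) else side (g (pt False 0)))" if jX: "j \<in> X" for j
    proof -
      obtain b s where "j = pt b s" using pt_cases[OF jX] by blast
      then show ?thesis using cst[of b s] side_pt[of b s] by (cases b) auto
    qed
    have mem: "j \<in> g ` S \<longleftrightarrow> j \<in> X \<and> side (inv' g j)" for j
    proof
      assume "j \<in> g ` S"
      then obtain k where "k \<in> X" "side k" "j = g k" unfolding S_def by blast
      then show "j \<in> X \<and> side (inv' g j)" using g(1) mem_X by simp
    next
      assume a: "j \<in> X \<and> side (inv' g j)"
      then have "inv' g j \<in> S" unfolding S_def using mem_X[OF inv_mem[OF g(1)]] by blast
      moreover have "j = g (inv' g j)" using g(1) by simp
      ultimately show "j \<in> g ` S" by blast
    qed
    have e2: "side j = (if side (inv' g j) then side (g (pt True 0)) else side (g (pt False 0)))" if "j \<in> X" for j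
      using eqv[OF mem_X[OF inv_mem[OF g(1)] that]] g(1) by simp
    have ne: "side (g (pt True 0)) \<noteq> side (g (pt False 0))"
      using e2[OF pt_mem, of True 0] e2[OF pt_mem, of False 0] side_pt by (auto split: if_splits)
    show False
    proof (cases "side (g (pt True 0))")
      case True
      then have "j \<in> g ` S \<longleftrightarrow> j \<in> S" for j
        unfolding mem using e2[of j] ne by (auto simp: S_def split: if_splits)
      then have "g ` S = S" by blast
      then show False using g(2) by blast
    next
      case False
      then have "j \<in> g ` S \<longleftrightarrow> j \<in> X - S" for j
        unfolding mem using e2[of j] ne by (auto simp: S_def split: if_splits)
      then have "g ` S = X - S" by blast
      then show False using g(3) by blast
    qed
  qed
  \<comment> \<open>\<open>w\<close> is annihilated by the nonconstant \<open>m b\<close>, hence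
    constant; its coefficients sum to zero because the row sums of \<open>Q\<close> vanish. So
    \<open>tr Q\<close> is \<open>ka\<close> times the unit.\<close>
  define w where "w x = tr Q x - ka * (if int p dvd x then 1 else 0)" for x
  have perw: "periodic p w" using perq unfolding w_def periodic_def by (simp add: dvd_mod_iff)
  have "conv p w (m b) x = 0" for x
  proof -
    have "conv p w (m b) x = conv p (tr Q) (m b) x - conv p (\<lambda>x. ka * (if int p dvd x then 1 else 0) + 0) (m b) x"
      unfolding w_def conv_diff_left by simp
    then show ?thesis unfolding conv_delta_const_left[OF p_pos perm] qm by simp
  qed
  then have "conv p (m b) w x = 0" for x using conv_commute[OF p_pos perm perw] by simp
  then have wc: "w x = w 0" for x using conv_zero_imp_constant[OF p(1) perw perm _ bst] by blast
  have sumw: "(\<Sum>x\<in>?I. w x) = 0"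
  proof -
    have "(\<Sum>x\<in>?I. ka * (if int p dvd x then 1 else 0)) = (\<Sum>x\<in>?I. if x = 0 then ka else 0)"
      by (intro sum.cong refl) (auto dest: zdvd_imp_le)
    also have "\<dots> = ka" using p_pos by simp
    finally have "(\<Sum>x\<in>?I. w x) = (\<Sum>x\<in>?I. tr Q x) - ka" unfolding w_def by (simp add: sum_subtractf)
    also have "(\<Sum>x\<in>?I. tr Q x) = bsum Q False False + bsum Q True True" unfolding tr_def bsum_def by (rule sum.distrib)
    also have "\<dots> = 2 * bsum Q False False" using bsum_eq[OF Q] by simp
    finally have 1: "(\<Sum>x\<in>?I. w x) = 2 * bsum Q False False - ka" .
    have "2 * u * (\<Sum>k\<in>X. Q (pt False 0) k) = (\<Sum>k\<in>X. mmul X Q Y (pt False 0) k)"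
      using QY[OF pt_mem] by (simp add: sum_distrib_left)
    also have "\<dots> = (\<Sum>l\<in>X. Q (pt False 0) l * (\<Sum>k\<in>X. Y l k))"
      unfolding mmul_def by (subst sum.swap) (simp add: sum_distrib_left)
    also have "\<dots> = 0" using Y_row by simp
    finally have "bsum Q False False + bsum Q False True = 0" using u_pos unfolding bsum_row[OF Q] by simp
    then show ?thesis unfolding 1 ka_def by simp
  qed
  then have "int p * w 0 = 0"
  proof -
    have "(\<Sum>x\<in>?I. w x) = (\<Sum>x\<in>?I. w 0)" using wc by (intro sum.cong) auto
    then show ?thesis using sumw by simp
  qed
  then have "w x = 0" for x using wc p_pos by simp
  then have trQ: "tr Q x = ka * (if int p dvd x then 1 else 0) + 0" for x unfolding w_def by simp
  have blkQ: "2 * u * blk Q b d x = ka * y b d x" for b d x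
  proof -
    have "2 * u * blk Q b d x = conv p (tr Q) (y b d) x" by (rule rank_one[OF Q YQ QY])
    also have "\<dots> = conv p (\<lambda>x. ka * (if int p dvd x then 1 else 0) + 0) (y b d) x" by (rule conv_cong) (simp_all add: trQ)
    finally show ?thesis unfolding conv_delta_const_left[OF p_pos per] by simp
  qed
  have "(\<lambda>j k. 2 * u * Q j k) j k = (\<lambda>j k. ka * Y j k) j k"
  proof (rule blk_eqI[OF _ _ _ jk])
    show "ginv (\<lambda>j k. 2 * u * Q j k)" using Q unfolding ginv_def by simp
    show "ginv (\<lambda>j k. ka * Y j k)" using gY unfolding ginv_def by simp
    show "blk (\<lambda>j k. 2 * u * Q j k) b d x = blk (\<lambda>j k. ka * Y j k) b d x" for b d x
      using blkQ[of b d x] unfolding blk_def .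
  qed
  then show ?thesis unfolding ka_def .
qed

end

lemma sum_eq_member_imp_zero:
  fixes f :: "'b \<Rightarrow> int"
  assumes "finite S" "\<And>x. f x \<ge> 0" "a \<in> S" "sum f S = f a" "b \<in> S" "b \<noteq> a"
  shows "f b = 0"
proof -
  have "sum f (S - {a}) = 0" using sum.remove[OF assms(1,3), of f] assms(4) by simp
  then have "\<forall>x\<in>S - {a}. f x = 0" using assms(1,2) by (subst (asm) sum_nonneg_eq_0_iff) auto
  then show ?thesis using assms(5,6) by blast
qed

text \<open>Multiplication by the adjugate: if the row \<open>(n, m)\<close> annihilates a
  \<open>2\<close> by \<open>2\<close> matrix over the group ring, its determinant annihilates
  \<open>n\<close>.\<close>

lemma conv_det_annihilated:
  assumes p: "p > 0" and per: "periodic p n" "periodic p m" "periodic p a" "periodic p b" "periodic p c" "periodic p d"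
    and ac: "\<And>x. conv p n a x + conv p m c x = 0" and bd: "\<And>x. conv p n b x + conv p m d x = 0"
  shows "conv p n (\<lambda>x. conv p a d x - conv p b c x) x = 0"
proof -
  have na: "conv p n a = (\<lambda>x. - 1 * conv p m c x)" using ac by (simp add: fun_eq_iff add_eq_0_iff)
  have nb: "conv p n b = (\<lambda>x. - 1 * conv p m d x)" using bd by (simp add: fun_eq_iff add_eq_0_iff)
  have cd: "conv p c d = conv p d c" by (rule ext) (rule conv_commute[OF p per(5,6)])
  have "conv p n (\<lambda>x. conv p a d x - conv p b c x) x = conv p n (conv p a d) x - conv p n (conv p b c) x"
    unfolding conv_def[of p n] by (simp add: right_diff_distrib sum_subtractf)
  also have "\<dots> = conv p (conv p n a) d x - conv p (conv p n b) c x"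
    unfolding conv_assoc[OF p per(1,3,6)] conv_assoc[OF p per(1,4,5)] ..
  also have "\<dots> = - 1 * conv p (conv p m c) d x - - 1 * conv p (conv p m d) c x"
    unfolding na nb conv_scale_left ..
  also have "\<dots> = 0"
    unfolding conv_assoc[OF p per(2,5,6)] conv_assoc[OF p per(2,6,5)] cd by simp
  finally show ?thesis .
qed

section \<open>The matrix of commuting pairs\<close>

context deg2p_conference
begin

text \<open>The eigenvalue of \<open>A\<close> on \<open>vec\<close>, by
  \<open>vec_eigen\<close>.\<close>

definition lam :: "('a \<Rightarrow> 'a \<Rightarrow> int) \<Rightarrow> int"
  where "lam A = bsum A False False - bsum A False True"

text \<open>\<open>Y\<close> absorbs its product with \<open>A\<close> on both sides, so
  \<open>scalar\<close> applies; the factor is found by evaluating at \<open>vec\<close>.\<close>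

lemma Y_times: assumes A: "ginv A" and jk: "j \<in> X" "k \<in> X"
  shows "mmul X Y A j k = lam A * Y j k"
proof -
  define Q where "Q = mmul X Y A"
  have gQ: "ginv Q" unfolding Q_def by (rule ginv_mmul[OF gY A])
  have YQ: "mmul X Y Q j k = 2 * u * Q j k" if "j \<in> X" "k \<in> X" for j k
  proof -
    have "mmul X Y Q j k = (\<Sum>l\<in>X. mmul X Y Y j l * A l k)"
      unfolding Q_def mmul_assoc[symmetric] by (simp only: mmul_def[of X "mmul X Y Y"])
    also have "\<dots> = (\<Sum>l\<in>X. 2 * u * Y j l * A l k)" using Y_sq that by (intro sum.cong) auto
    finally show ?thesis unfolding Q_def mmul_def[of X Y A] by (simp add: sum_distrib_left mult.assoc)
  qed
  have QY: "mmul X Q Y j k = 2 * u * Q j k" if "j \<in> X" "k \<in> X" for j k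
    using Y_commute[OF gQ that] YQ[OF that] by simp
  have v: "vec (pt False 0) = 1" unfolding vec_def side_pt by simp
  have "lam Q = (\<Sum>k\<in>X. Q (pt False 0) k * vec k)"
    using vec_eigen[OF gQ pt_mem, of False 0] v unfolding lam_def by simp
  also have "\<dots> = (\<Sum>k\<in>X. \<Sum>l\<in>X. Y (pt False 0) l * (A l k * vec k))"
    unfolding Q_def mmul_def by (simp add: sum_distrib_right mult.assoc)
  also have "\<dots> = (\<Sum>l\<in>X. Y (pt False 0) l * (\<Sum>k\<in>X. A l k * vec k))"
    by (subst sum.swap) (simp add: sum_distrib_left)
  also have "\<dots> = (\<Sum>l\<in>X. lam A * (Y (pt False 0) l * vec l))"
    using vec_eigen[OF A] unfolding lam_def by (intro sum.cong) auto
  also have "\<dots> = lam A * (2 * u)"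
    using vec_eigen[OF gY pt_mem, of False 0] v Y_bsum by (simp add: sum_distrib_left[symmetric])
  finally have "2 * u * Q j k = lam A * (2 * u) * Y j k"
    using scalar[OF gQ YQ QY jk] unfolding lam_def[of Q, symmetric] by simp
  then show ?thesis using u_pos unfolding Q_def by simp
qed

definition K :: "'a \<Rightarrow> 'a \<Rightarrow> int" where "K j k = of_bool (k \<in> Fx j)"

abbreviation "kap \<equiv> lam K"

lemma Y_times_diag: assumes A: "ginv A" and A_sym: "\<And>j k. j \<in> X \<Longrightarrow> k \<in> X \<Longrightarrow> A j k = A k j"
  shows "(\<Sum>l\<in>X. Y o0 l * A o0 l) = lam A * u"
proof -
  have "(\<Sum>l\<in>X. Y o0 l * A o0 l) = mmul X Y A o0 o0"
    unfolding mmul_def using A_sym[OF o(1)] by (intro sum.cong) auto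
  then show ?thesis using Y_times[OF A o(1) o(1)] Y_diag[OF o(1)] by simp
qed

lemma gK: "ginv K" unfolding ginv_def K_def using Fx_g by simp

lemma K_sym: "j \<in> X \<Longrightarrow> k \<in> X \<Longrightarrow> K j k = K k j" unfolding K_def using Fx_sym by simp

lemma K_row: assumes "j \<in> X" shows "(\<Sum>k\<in>X. K j k) = f"
proof -
  have "X \<inter> Fx j = Fx j" using Fx_sub by blast
  then have "(\<Sum>k\<in>X. K j k) = int (card (Fx j))"
    unfolding K_def using finX by (simp add: of_bool_def sum.If_cases Int_def[symmetric] Collect_mem_eq)
  then show ?thesis using card_fixed[OF assms] unfolding Fx_def by simp
qed

text \<open>\<open>L\<close> marks the commuting pairs with entry \<open>2\<close>; the entry
  \<open>1\<close> is impossible there. The diagonals of the products of \<open>Y\<close> with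
  \<open>L\<close> and with \<open>K\<close> give \<open>kap = 2 * lam L\<close> and the row sum
  \<open>lam L * u\<close> of \<open>L\<close>. This row sum lies between \<open>0\<close> and
  \<open>u\<close>, so \<open>L\<close> marks none or all of the commuting pairs off the
  diagonal.\<close>

lemma M_commuting:
  shows "kap = 0 \<or> kap = 2" and "j \<in> X \<Longrightarrow> k \<in> X \<Longrightarrow> k \<noteq> j \<Longrightarrow> k \<in> Fx j \<Longrightarrow> M j k = kap"
proof -
  define L where "L j k = (of_bool (k \<noteq> j \<and> k \<in> Fx j \<and> M j k = 2) :: int)" for j k
  have gL: "ginv L"
    unfolding ginv_def
  proof (intro ballI)
    fix g j k assume g: "g \<in> G" "j \<in> X" "k \<in> X"
    then show "L (g j) (g k) = L j k"
      unfolding L_def using Fx_g[OF g] ginvD[OF gM g] inj_G[OF g(1)] by simp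
  qed
  have M_sym: "M j k = M k j" if "j \<in> X" "k \<in> X" for j k using Y_sym[OF that] unfolding Y_def by simp
  have L_sym: "L j k = L k j" if "j \<in> X" "k \<in> X" for j k
    unfolding L_def using Fx_sym[OF that] M_sym[OF that] by auto
  have M02: "M j k = 0 \<or> M j k = 2" if jk: "j \<in> X" "k \<in> X" "k \<noteq> j" "k \<in> Fx j" for j k
    using M_le[of j k] M_nonneg[of j k] M_ne_1[OF jk] jk c2 by auto
  define del where "del = (\<Sum>l\<in>X. L o0 l)"
  have L01: "0 \<le> L j k" "L j k \<le> K j k" for j k unfolding L_def K_def by auto
  have u1: "f = u + 1" unfolding u_def by simp
  have "(\<Sum>l\<in>X. Y o0 l * L o0 l) = del"
    unfolding del_def L_def Y_def by (intro sum.cong) auto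
  then have delL: "del = lam L * u" using Y_times_diag[OF gL L_sym] by simp
  have "(\<Sum>l\<in>X. Y o0 l * K o0 l) = (\<Sum>l\<in>X. 2 * L o0 l - K o0 l + (if o0 = l then u + 1 else 0))"
  proof (intro sum.cong refl)
    fix l assume l: "l \<in> X"
    show "Y o0 l * K o0 l = 2 * L o0 l - K o0 l + (if o0 = l then u + 1 else 0)"
      using M02[OF o(1) l] Y_diag[OF o(1)] Fx_self[OF o(1)] unfolding L_def K_def
      by (cases "l = o0"; cases "l \<in> Fx o0") (auto simp: Y_def)
  qed
  also have "\<dots> = 2 * del - f + (u + 1)"
    using finX o(1) K_row[OF o(1)] by (simp add: sum.distrib sum_subtractf sum_distrib_left[symmetric] del_def)
  finally have "kap * u = 2 * lam L * u" using Y_times_diag[OF gK K_sym] delL u1 by simp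
  then have kL: "kap = 2 * lam L" using u_pos by simp
  have "del \<ge> 0" unfolding del_def using L01 by (intro sum_nonneg) auto
  then have L0: "lam L \<ge> 0" using delL u_pos by (simp add: zero_le_mult_iff)
  have KL: "(\<Sum>l\<in>X. K o0 l - L o0 l) = f - del" unfolding del_def sum_subtractf K_row[OF o(1)] ..
  have KL1: "K o0 o0 - L o0 o0 = 1" using Fx_self[OF o(1)] unfolding K_def L_def by simp
  have "K o0 o0 - L o0 o0 \<le> (\<Sum>l\<in>X. K o0 l - L o0 l)"
    using L01 finX o(1) by (intro member_le_sum) auto
  then have "lam L * u \<le> 1 * u" using KL KL1 u1 delL by simp
  then have L1: "lam L \<le> 1" using u_pos by simp
  then show kap: "kap = 0 \<or> kap = 2" using L0 kL by auto
  have at_o0: "M o0 k = kap" if k: "k \<in> X" "k \<noteq> o0" "k \<in> Fx o0" for k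
  proof (cases "kap = 0")
    case True
    then have "del = 0" using kL delL by simp
    then have "L o0 k = 0" unfolding del_def using L01 finX k by (subst (asm) sum_nonneg_eq_0_iff) auto
    then show ?thesis using M02[OF o(1) k] k True unfolding L_def by auto
  next
    case False
    then have "kap = 2" "del = u" using kap kL delL by auto
    moreover have "K o0 k - L o0 k = 0"
      by (rule sum_eq_member_imp_zero[of X "\<lambda>k. K o0 k - L o0 k" o0])
        (use finX o(1) k KL KL1 u1 \<open>del = u\<close> L01 in auto)
    ultimately show ?thesis using k unfolding L_def K_def by (auto split: if_splits)
  qed
  show "M j k = kap" if jk: "j \<in> X" "k \<in> X" "k \<noteq> j" "k \<in> Fx j" for j k
  proof -
    obtain g where g: "g \<in> G" "g j = o0" using transitive[OF jk(1) o(1)] by blast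
    have "M j k = M o0 (g k)" using ginvD[OF gM g(1) jk(1,2)] g(2) by simp
    moreover have "g k \<in> Fx o0" using Fx_g[OF g(1) jk(1,2)] jk(4) g(2) by simp
    moreover have "g k \<noteq> o0" using inj_G[OF g(1)] jk(3) g(2) by metis
    ultimately show ?thesis using at_o0[of "g k"] mem_X[OF g(1) jk(2)] by simp
  qed
qed

abbreviation "ky \<equiv> blk K"

lemma ky_01: "ky b d x = 0 \<or> ky b d x = 1" unfolding blk_def K_def by auto

lemma ky_nonneg: "ky b d x \<ge> 0" using ky_01[of b d x] by auto

lemma ky_minus: "ky b d (- x) = ky d b x"
proof -
  have "ky b d (- x) = K (pt b x) (pt d 0)" using blk_shift[OF gK, of b x d 0] by simp
  then show ?thesis using K_sym[OF pt_mem pt_mem] unfolding blk_def by simp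
qed

lemma ky_zero: assumes "int p dvd x" shows "ky b b x = 1"
proof -
  have "pt b x = pt b 0" using assms by (intro pt_mod) auto
  then show ?thesis unfolding blk_def K_def using Fx_self[OF pt_mem] by simp
qed

lemma pt_ne_0: "\<not> int p dvd x \<Longrightarrow> pt b x \<noteq> pt b 0"
  unfolding pt_inj by auto

text \<open>Otherwise the trace of \<open>M\<close> at \<open>x\<close> would be
  \<open>2 * kap\<close>, but it is \<open>2\<close>, and \<open>kap\<close> is \<open>0\<close> or
  \<open>2\<close>.\<close>

lemma ky_disjoint: assumes x: "\<not> int p dvd x" shows "ky False False x = 0 \<or> ky True True x = 0"
proof (rule ccontr)
  assume "\<not> ?thesis"
  then have "pt b x \<in> Fx (pt b 0)" for b by (cases b) (auto simp: blk_def K_def)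
  then have "blk M b b x = kap" for b
    unfolding blk_def using M_commuting(2)[OF pt_mem pt_mem pt_ne_0[OF x]] by blast
  then have "2 * kap = 2" using trM[OF x] c2 by simp
  then show False using M_commuting(1) by auto
qed

definition E :: "'a \<Rightarrow> 'a \<Rightarrow> int" where "E j k = K j k - (if j = k then kap else 0)"

abbreviation "ey \<equiv> blk E"

lemma gE: "ginv E" unfolding ginv_def E_def using ginvD[OF gK] inj_G by auto

lemma ey_eq: "ey b d x = ky b d x - (if b = d \<and> int p dvd x then kap else 0)"
  using blk_id[of kap b d x] unfolding blk_def E_def by simp

lemma Y_E: "conv p (y b False) (ey False d) x + conv p (y b True) (ey True d) x = 0"
proof -
  have "mmul X Y E j k = 0" if "j \<in> X" "k \<in> X" for j k
  proof -
    have "mmul X Y E j k = mmul X Y K j k - (\<Sum>l\<in>X. if l = k then kap * Y j l else 0)"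
      unfolding mmul_def E_def sum_subtractf[symmetric] by (intro sum.cong) (auto simp: algebra_simps)
    then show ?thesis using Y_times[OF gK that] finX that(2) by simp
  qed
  then show ?thesis using blk_mmul[OF gY gE, of b d x] pt_mem unfolding blk_def by simp
qed

text \<open>Since \<open>Y\<close> annihilates \<open>E\<close>, both diagonal entries of
  \<open>Y\<close> annihilate the determinant of \<open>E\<close>, and their sum is the nonzero
  scalar \<open>2 * u\<close>.\<close>

lemma det_E: "conv p (ey False False) (ey True True) x = conv p (ey False True) (ey True False) x"
proof -
  define D where "D x = conv p (ey False False) (ey True True) x - conv p (ey False True) (ey True False) x" for x
  have perD: "periodic p D" unfolding D_def using periodic_conv[OF per] unfolding periodic_def by simp
  have 1: "conv p (y False False) D x = 0" for x
    unfolding D_def by (rule conv_det_annihilated[OF p_pos per per per per per per Y_E Y_E])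
  have D2: "D = (\<lambda>x. conv p (ey True True) (ey False False) x - conv p (ey True False) (ey False True) x)"
    unfolding D_def using conv_comm[of E _ _ E] by (intro ext) simp
  have 2: "conv p (y True True) D x = 0" for x
    unfolding D2
  proof (rule conv_det_annihilated[OF p_pos per per per per per per])
    show "conv p (y True True) (ey True True) x + conv p (y True False) (ey False True) x = 0" for x
      using Y_E[of True True x] by simp
    show "conv p (y True True) (ey True False) x + conv p (y True False) (ey False False) x = 0" for x
      using Y_E[of True False x] by simp
  qed
  have "0 = conv p (\<lambda>x. y False False x + y True True x) D x" unfolding conv_add_left 1 2 by simp
  also have "\<dots> = conv p (\<lambda>x. 2 * u * (if int p dvd x then 1 else 0) + 0) D x"
    by (rule conv_cong) (simp_all add: y_trace)
  also have "\<dots> = 2 * u * D x" unfolding conv_delta_const_left[OF p_pos perD] by simp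
  finally show ?thesis using u_pos unfolding D_def by simp
qed

text \<open>The coefficient of \<open>det_E\<close> at \<open>0\<close>. As \<open>K\<close> is
  symmetric with entries \<open>0\<close> and \<open>1\<close>, one side counts the ones of the
  off-diagonal block; on the other only the square of \<open>1 - kap\<close> survives by
  \<open>ky_disjoint\<close>, and that is \<open>1\<close>.\<close>

lemma bsum_K: "bsum K False True = 1" "bsum K b b = kap + 1"
proof -
  let ?I = "{0..<int p}"
  have "bsum K False True = (\<Sum>y\<in>?I. ey False True y * ey True False (0 - y))"
    unfolding bsum_def ey_eq using ky_minus[of True False] ky_01[of False True] by (intro sum.cong refl) auto
  also have "\<dots> = (\<Sum>y\<in>?I. ey False False y * ey True True (0 - y))"
    using det_E[of 0] unfolding conv_def by simp
  also have "\<dots> = (\<Sum>y\<in>?I. if y = 0 then 1 else 0)"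
  proof (intro sum.cong refl)
    fix y assume y: "y \<in> ?I"
    show "ey False False y * ey True True (0 - y) = (if y = 0 then 1 else 0)"
    proof (cases "y = 0")
      case True
      then show ?thesis unfolding ey_eq using ky_zero[of 0] M_commuting(1) by auto
    next
      case False
      then have "\<not> int p dvd y" using y by (auto dest: zdvd_imp_le)
      then show ?thesis unfolding ey_eq using ky_disjoint[of y] ky_minus[of True True y] False by auto
    qed
  qed
  finally show 1: "bsum K False True = 1" using p_pos by simp
  show "bsum K b b = kap + 1" using 1 bsum_eq(1)[OF gK] unfolding lam_def by (cases b) auto
qed

lemma ky_FT_unique:
  assumes "ky False True x = 1" "ky False True x' = 1" shows "int p dvd x - x'"
proof -
  have p0: "int p > 0" using p_pos by simp
  have m: "ky False True (x mod int p) = 1" "ky False True (x' mod int p) = 1"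
    using assms per[of K False True] unfolding periodic_def by auto
  have "x' mod int p = x mod int p"
  proof (rule ccontr)
    assume "x' mod int p \<noteq> x mod int p"
    then have "ky False True (x' mod int p) = 0"
      by (intro sum_eq_member_imp_zero[of "{0..<int p}" "ky False True" "x mod int p"])
        (use m(1) bsum_K(1) ky_nonneg p0 in \<open>auto simp: bsum_def\<close>)
    then show False using m(2) by simp
  qed
  then show ?thesis by (metis mod_eq_dvd_iff)
qed

text \<open>For \<open>kap = 0\<close> a diagonal block of \<open>K\<close> has its only one at
  \<open>0\<close>, yet the one of the off-diagonal block can be moved to a nonzero place of a
  diagonal block. For \<open>kap = 2\<close> doubling twice returns to the first block, so
  \<open>4 * x\<close> is \<open>0\<close>, \<open>x\<close> or \<open>- x\<close> modulo
  \<open>p\<close>.\<close>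

theorem contradiction: False
proof (cases "kap = 0")
  case True
  let ?I = "{0..<int p}"
  have p0: "int p > 0" using p_pos by simp
  have "(\<Sum>y\<in>?I. ky False True y) \<noteq> 0" using bsum_K(1) unfolding bsum_def by simp
  then obtain y where y: "ky False True y \<noteq> 0" by (meson sum.neutral)
  obtain b x where bx: "\<not> int p dvd x" "\<And>A. ginv A \<Longrightarrow> A (pt False 0) (pt True y) = blk A b b x"
    using in_block[OF pt_mem pt_mem pt_ne, of 0 y] by metis
  have "ky b b (x mod int p) = 0"
    by (rule sum_eq_member_imp_zero[of ?I "ky b b" 0])
      (use bx(1) bsum_K(2)[of b] ky_nonneg ky_zero[of 0 b] True p0 in \<open>auto simp: bsum_def dvd_eq_mod_eq_0\<close>)
  then have "ky b b x = 0" using per[of K b b] unfolding periodic_def by simp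
  then show False using y bx(2)[OF gK] unfolding blk_def by simp
next
  case False
  then have k2: "kap = 2" using M_commuting(1) by blast
  let ?I = "{0..<int p}"
  have sum3: "(\<Sum>x\<in>?I. ky b b x) = 3" for b using bsum_K(2)[of b] k2 unfolding bsum_def by simp
  \<comment> \<open>With a single one in the off-diagonal block, this product is supported at
    \<open>0\<close>.\<close>
  have FT0: "conv p (ey False True) (ey True False) x = 0" if x: "\<not> int p dvd x" for x
    unfolding conv_def
  proof (rule sum.neutral, intro ballI)
    fix v assume "v \<in> ?I"
    have "\<not> (ky False True v = 1 \<and> ky False True (v - x) = 1)"
      using ky_FT_unique[of v "v - x"] x by auto
    moreover have "ky True False (x - v) = ky False True (v - x)" using ky_minus[of True False "v - x"] by simp
    ultimately show "ey False True v * ey True False (x - v) = 0"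
      unfolding ey_eq using ky_01[of False True v] ky_01[of False True "v - x"] by auto
  qed
  have conv0: "conv p (\<lambda>x. ky b b x - (if int p dvd x then 2 else 0))
      (\<lambda>x. ky (\<not> b) (\<not> b) x - (if int p dvd x then 2 else 0)) x = 0" if x: "\<not> int p dvd x" for b x
  proof -
    have e: "(\<lambda>x. ky b b x - (if int p dvd x then 2 else 0)) = ey b b" for b
      unfolding ey_eq k2 by (simp add: fun_eq_iff)
    show ?thesis unfolding e using det_E[of x] FT0[OF x] conv_comm[of E True True E False False x] by (cases b) auto
  qed
  have sym: "ky b b (- x) = ky b b x" for b x by (rule ky_minus)
  have disj: "ky (\<not> b) (\<not> b) x = 0" if "\<not> int p dvd x" "ky b b x = 1" for b x
    using ky_disjoint[OF that(1)] that(2) by (cases b) auto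
  have z0: "ky b b 0 = 1" for b using ky_zero[of 0] by simp
  obtain x where x: "\<not> int p dvd x" "ky False False x = 1"
  proof (rule ccontr)
    assume a: "\<not> thesis"
    have "(\<Sum>v\<in>?I. ky False False v) = (\<Sum>v\<in>?I. if v = 0 then 1 else 0)"
    proof (intro sum.cong refl)
      fix v assume v: "v \<in> ?I"
      show "ky False False v = (if v = 0 then 1 else 0)"
      proof (cases "v = 0")
        case False
        then have "\<not> int p dvd v" using v by (auto dest: zdvd_imp_le)
        then have "ky False False v \<noteq> 1" using a that by blast
        then show ?thesis using ky_01[of False False v] False by simp
      qed (simp add: z0)
    qed
    then show False using sum3[of False] p_pos by simp
  qed
  have pP: "prime (int p)" using p(1) by simp
  have nd: "\<not> int p dvd m * x" if "0 < m" "m \<le> 5" for m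
  proof -
    have "\<not> int p dvd m" using that p(2) by (auto dest: zdvd_imp_le)
    then show ?thesis using x(1) pP prime_dvd_mult_iff by blast
  qed
  note pat = doubling_pattern[OF p per per ky_01 sym z0 z0 sum3 disj conv0]
  have "ky (\<not> False) (\<not> False) (2 * x) = 1"
    by (rule pat(1)) (use x in auto)
  then have "ky (\<not> True) (\<not> True) (2 * (2 * x)) = 1"
    by (intro pat(1)[of True "2 * x"]) (use nd[of 2] in auto)
  then have 4: "ky False False (4 * x) = 1" by simp
  have "int p dvd 4 * x \<or> int p dvd 4 * x - x \<or> int p dvd 4 * x + x"
    by (rule pat(2)[OF _ _ _ x 4])
  then have "int p dvd 4 * x \<or> int p dvd 3 * x \<or> int p dvd 5 * x" by (simp add: algebra_simps)
  then show False using nd[of 4] nd[of 3] nd[of 5] by simp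
qed

end

section \<open>Subgroups of the symmetric group\<close>

context perm_group
begin

lemma closed_inv:
  assumes "H \<subseteq> G" "id \<in> H" and comp: "\<And>g h. g \<in> H \<Longrightarrow> h \<in> H \<Longrightarrow> g \<circ> h \<in> H" and h: "h \<in> H"
  shows "inv' h \<in> H"
proof -
  obtain n where n: "n > 0" "h ^^ n = id" using finite_order[of h] assms(1) h by blast
  have "h ^^ m \<in> H" for m using assms(2) comp h by (induction m) simp_all
  moreover have "inv' h = h ^^ (n - 1)"
  proof (rule inv_equality)
    show "(h ^^ (n - 1)) (h x) = x" for x
      using n by (metis Suc_diff_1 comp_apply funpow_Suc_right id_apply)
    show "h ((h ^^ (n - 1)) x) = x" for x
      using n by (metis Suc_diff_1 comp_apply funpow.simps(2) id_apply)
  qed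
  ultimately show ?thesis by simp
qed

text \<open>The conjugate of \<open>w\<close> by \<open>g\<close> depends only on
  \<open>g x\<close>: two elements taking \<open>x\<close> to the same point differ by an element of
  the stabilizer, which commutes with \<open>w\<close>.\<close>

lemma central_fixing_fam:
  assumes tr: "\<And>y. y \<in> X \<Longrightarrow> \<exists>g\<in>G. g x = y" and x: "x \<in> X" and w: "w \<in> G" "w x = x"
    and central: "\<And>h. h \<in> G \<Longrightarrow> h x = x \<Longrightarrow> w \<circ> h = h \<circ> w"
  obtains z where "fixing_fam z" "\<And>g. g \<in> G \<Longrightarrow> z (g x) = g \<circ> w \<circ> inv' g"
proof -
  define z where "z i = (let g = SOME g. g \<in> G \<and> g x = i in g \<circ> w \<circ> inv' g)" for i
  have z_eq: "z (g x) = g \<circ> w \<circ> inv' g" if g: "g \<in> G" for g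
  proof -
    define k where "k = (SOME k. k \<in> G \<and> k x = g x)"
    have k: "k \<in> G \<and> k x = g x" unfolding k_def by (rule someI[of _ g]) (use g in simp)
    have "(inv' g \<circ> k) x = x" using k g by simp
    then have c: "w \<circ> (inv' g \<circ> k) = (inv' g \<circ> k) \<circ> w"
      using central[OF comp_mem[OF inv_mem[OF g]]] k by blast
    have "z (g x) = k \<circ> w \<circ> inv' k" unfolding z_def k_def[symmetric] by simp
    also have "\<dots> = g \<circ> ((inv' g \<circ> k) \<circ> w) \<circ> inv' k" using g by (simp add: fun_eq_iff)
    also have "\<dots> = g \<circ> w \<circ> inv' g" unfolding c[symmetric] using g k by (simp add: fun_eq_iff)
    finally show ?thesis .
  qed
  have z_app: "z (g x) (g j) = g (w j)" if "g \<in> G" for g j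
    using z_eq[OF that] that by simp
  have "fixing_fam z"
    unfolding fixing_fam_def conj_fam_def
  proof (intro conjI ballI)
    fix i assume i: "i \<in> X"
    obtain k where k: "k \<in> G" "k x = i" using tr[OF i] by blast
    show "z i \<in> G" using z_eq[OF k(1)] k comp_mem inv_mem w(1) by simp
    show "z i i = i" using z_app[OF k(1), of x] k(2) w(2) by simp
    fix g assume g: "g \<in> G"
    have "g (z i j) = z (g i) (g j)" for j
    proof -
      have "z i j = k (w (inv' k j))" using z_app[OF k(1), of "inv' k j"] k by simp
      moreover have "z (g i) (g j) = g (k (w (inv' k j)))"
        using z_app[OF comp_mem[OF g k(1)], of "inv' k j"] k by simp
      ultimately show ?thesis by simp
    qed
    then show "g \<circ> z i = z (g i) \<circ> g" by (simp add: fun_eq_iff)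
  qed
  then show thesis using that z_eq by blast
qed

end

text \<open>Generation enters twice: it provides a nontrivial family, as otherwise \<open>G\<close>
  would be trivial, and it is used in the case of blocks of size two.\<close>

lemma (in deg2p) not_generated:
  assumes generated: "\<And>H. H \<subseteq> G \<Longrightarrow> id \<in> H \<Longrightarrow> (\<And>g h. g \<in> H \<Longrightarrow> h \<in> H \<Longrightarrow> g \<circ> h \<in> H)
    \<Longrightarrow> (\<And>z i. fixing_fam z \<Longrightarrow> i \<in> X \<Longrightarrow> z i \<in> H) \<Longrightarrow> H = G"
  shows False
proof -
  obtain x where x: "x \<in> X" using cardX p_pos by fastforce
  have "\<exists>z i. fixing_fam z \<and> i \<in> X \<and> z i \<noteq> id"
  proof (rule ccontr)
    assume "\<nexists>z i. fixing_fam z \<and> i \<in> X \<and> z i \<noteq> id"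
    then have "{id} = G" using id_mem by (intro generated) auto
    then have "X \<subseteq> {x}" using transitive[OF x] by fastforce
    then have "card X \<le> 1" using card_mono[of "{x}" X] by simp
    then show False using cardX p(2) by simp
  qed
  then obtain z i0 where z: "fixing_fam z" "i0 \<in> X" "z i0 \<noteq> id" by blast
  obtain a where a: "a \<in> G" "a \<noteq> id" "a ^^ p = id" using order_p_exists by blast
  have ax: "a j \<noteq> j" if "j \<in> X" for j
    using no_fixed_point_order_p[OF z a(1,3) that] a(2) by blast
  have "card ((\<lambda>k. (a ^^ k) x) ` {..<p}) < card X"
    using card_image_le[of "{..<p}" "\<lambda>k. (a ^^ k) x"] cardX p_pos by simp
  then have "\<not> X \<subseteq> (\<lambda>k. (a ^^ k) x) ` {..<p}" using card_mono[of "(\<lambda>k. (a ^^ k) x) ` {..<p}" X] by force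
  then obtain y where y: "y \<in> X" "y \<notin> (\<lambda>k. (a ^^ k) x) ` {..<p}" by blast
  have axy: "(a ^^ k) x \<noteq> y" for k
    using y(2) funpow_p_mod[OF a(3), of k] p_pos by (metis imageI lessThan_iff mod_less_divisor)
  interpret deg2p_cyclic X G p a x y
    by unfold_locales (use a ax x y axy in auto)
  show False
  proof (rule cross_dichotomy)
    assume nc: "\<And>j k. j \<in> X \<Longrightarrow> k \<in> X \<Longrightarrow> \<not> cross j k"
    interpret deg2p_crossless X G p a x y z
      by unfold_locales (use z nc in auto)
    have "c = 1 \<or> c = 2" using c_nonneg c_nonzero c_le_2 by linarith
    then show False
    proof
      assume "c = 1"
      then interpret deg2p_strongly_regular X G p a x y z by unfold_locales
      show False by (rule contradiction)
    next
      assume "c = 2"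
      then interpret deg2p_conference X G p a x y z by unfold_locales
      show False by (rule contradiction)
    qed
  next
    fix r assume r: "r permutes X" "\<And>j. r (r j) = j" "\<And>j. j \<in> X \<Longrightarrow> r j \<noteq> j"
      "\<And>g j. g \<in> G \<Longrightarrow> g (r j) = r (g j)" "\<And>j k. j \<in> X \<Longrightarrow> k \<in> X \<Longrightarrow> cross j k \<longleftrightarrow> k = r j"
    interpret deg2p_generated X G p a x y by unfold_locales (rule generated)
    interpret deg2p_blocks X G p a x y r by unfold_locales (use r in auto)
    show False by (rule contradiction)
  qed
qed

text \<open>Each element keeps or reverses membership in \<open>S\<close>, and so does its inverse,
  so the reversals in a commutator cancel.\<close>

lemma (in perm_group) commutator_preserves:
  assumes split: "\<And>g. g \<in> G \<Longrightarrow> g ` S = S \<or> g ` S = X - S" and "S \<subseteq> X"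
    and gh: "g \<in> G" "h \<in> G" and j: "j \<in> X"
  shows "(g \<circ> h \<circ> inv' g \<circ> inv' h) j \<in> S \<longleftrightarrow> j \<in> S"
proof -
  have par: "(\<forall>j\<in>X. g j \<in> S \<longleftrightarrow> j \<in> S) \<or> (\<forall>j\<in>X. g j \<in> S \<longleftrightarrow> j \<notin> S)" if g: "g \<in> G" for g
  proof -
    have im: "g j \<in> g ` S \<longleftrightarrow> j \<in> S" for j using inj_G[OF g] by (auto simp: image_iff)
    have "g j \<in> S \<longleftrightarrow> j \<in> S" if "g ` S = S" for j using im[of j] unfolding that .
    moreover have "g j \<in> S \<longleftrightarrow> j \<notin> S" if "g ` S = X - S" "j \<in> X" for j
      using im[of j] mem_X[OF g that(2)] unfolding that(1) by blast
    ultimately show ?thesis using split[OF g] by blast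
  qed
  have X: "inv' h j \<in> X" "inv' g (inv' h j) \<in> X" "h (inv' g (inv' h j)) \<in> X"
    using j gh mem_X inv_mem by simp_all
  have "g (inv' g (inv' h j)) = inv' h j" "h (inv' h j) = j" using gh by simp_all
  then show ?thesis using par[OF gh(1)] par[OF gh(2)] X j by (metis comp_apply)
qed

theorem theorem10p1:
  fixes p :: nat
  assumes "prime p" and "p > 5"
  shows "\<not> (\<exists>G. subgroup G (sym_group (2 * p))
    \<and> transitive_on G {1..2 * p}
    \<and> transitive_on (derived (sym_group (2 * p)) G) {1..2 * p}
    \<and> normal_closure (sym_group (2 * p)) G
        (center (sym_group (2 * p)) (point_stabilizer (sym_group (2 * p)) G 1)) = G)"
proof
  let ?S = "sym_group (2 * p)" and ?X = "{1..2 * p}"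
  assume "\<exists>G. subgroup G ?S \<and> transitive_on G ?X \<and> transitive_on (derived ?S G) ?X
    \<and> normal_closure ?S G (center ?S (point_stabilizer ?S G 1)) = G"
  then obtain G :: "(nat \<Rightarrow> nat) set" where G: "subgroup G ?S" and tr: "transitive_on G ?X"
    and dtr: "transitive_on (derived ?S G) ?X"
    and nc: "normal_closure ?S G (center ?S (point_stabilizer ?S G 1)) = G" by blast
  have perm: "g permutes ?X" if "g \<in> G" for g
    using subgroup.mem_carrier[OF G that] unfolding sym_group_carrier .
  have inv_eq: "inv\<^bsub>?S\<^esub> g = inv' g" if "g \<in> G" for g
    using sym_group_inv_equality[OF subgroup.mem_carrier[OF G that]] .
  interpret perm_group ?X G
  proof
    show "id \<in> G" using subgroup.one_closed[OF G] unfolding sym_group_one .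
    show "g \<circ> h \<in> G" if "g \<in> G" "h \<in> G" for g h
      using subgroup.m_closed[OF G that] unfolding sym_group_mult .
    show "inv' g \<in> G" if "g \<in> G" for g
      using subgroup.m_inv_closed[OF G that] unfolding inv_eq[OF that] .
  qed (simp_all only: perm finite_atLeastAtMost)
  have trans: "\<exists>g\<in>G. g x = y" if "x \<in> ?X" "y \<in> ?X" for x y
    using tr that unfolding transitive_on_def by blast
  have one: "1 \<in> ?X" using assms(2) by simp
  interpret deg2p ?X G p
  proof
    \<comment> \<open>The derived subgroup preserves such a set \<open>S\<close>, so it cannot be
      transitive.\<close>
    fix S assume S: "S \<subseteq> ?X" "S \<noteq> {}" "S \<noteq> ?X" and split: "\<And>g. g \<in> G \<Longrightarrow> g ` S = S \<or> g ` S = ?X - S"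
    have comm: "h \<in> G \<and> (\<forall>j\<in>?X. h j \<in> S \<longleftrightarrow> j \<in> S)" if h: "h \<in> derived_set ?S G" for h
    proof -
      obtain h1 h2 where h12: "h1 \<in> G" "h2 \<in> G"
        and "h = h1 \<otimes>\<^bsub>?S\<^esub> h2 \<otimes>\<^bsub>?S\<^esub> inv\<^bsub>?S\<^esub> h1 \<otimes>\<^bsub>?S\<^esub> inv\<^bsub>?S\<^esub> h2"
        using h by blast
      then have h: "h = h1 \<circ> h2 \<circ> inv' h1 \<circ> inv' h2" unfolding sym_group_mult using inv_eq by simp
      have "h \<in> G"
        unfolding h by (rule comp_mem[OF comp_mem[OF comp_mem[OF h12] inv_mem[OF h12(1)]] inv_mem[OF h12(2)]])
      moreover have "\<forall>j\<in>?X. h j \<in> S \<longleftrightarrow> j \<in> S"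
        unfolding h using commutator_preserves[OF split S(1) h12] by (rule ballI)
      ultimately show ?thesis by (rule conjI)
    qed
    have pres: "h \<in> G \<and> (\<forall>j\<in>?X. h j \<in> S \<longleftrightarrow> j \<in> S)" if "h \<in> derived ?S G" for h
      using that unfolding derived_def
    proof (induction rule: generate.induct)
      case one
      show ?case unfolding sym_group_one using id_mem by (metis id_apply)
    next
      case (eng h1 h2)
      show ?case
        unfolding sym_group_mult
      proof (intro conjI ballI)
        show "h1 \<circ> h2 \<in> G" using eng.IH comp_mem by blast
        show "(h1 \<circ> h2) j \<in> S \<longleftrightarrow> j \<in> S" if "j \<in> ?X" for j
          using eng.IH mem_X[of h2 j] that by (metis comp_apply)
      qed
    next
      case (incl h)
      then show ?case by (rule comm)
    next
      case (inv h)
      have h: "h \<in> G" "\<And>j. j \<in> ?X \<Longrightarrow> h j \<in> S \<longleftrightarrow> j \<in> S" using comm[OF inv] by auto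
      have "inv' h j \<in> S \<longleftrightarrow> j \<in> S" if "j \<in> ?X" for j
        using h(2)[OF mem_X[OF inv_mem[OF h(1)] that]] h(1) by simp
      then show ?case unfolding inv_eq[OF h(1)] using inv_mem[OF h(1)] by blast
    qed
    obtain x y where "x \<in> S" "y \<in> ?X" "y \<notin> S" using S by blast
    moreover obtain h where "h \<in> derived ?S G" "h x = y"
      using dtr calculation S(1) unfolding transitive_on_def by blast
    ultimately show False using pres S(1) by blast
  qed (use assms trans in auto)
  show False
  proof (rule not_generated)
    fix H assume H: "H \<subseteq> G" "id \<in> H" and comp: "\<And>g h. g \<in> H \<Longrightarrow> h \<in> H \<Longrightarrow> g \<circ> h \<in> H"
      and fam: "\<And>z i. fixing_fam z \<Longrightarrow> i \<in> ?X \<Longrightarrow> z i \<in> H"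
    \<comment> \<open>The generators of the normal closure are members \<open>z (g 1)\<close> of
      fixing families, hence lie in \<open>H\<close>.\<close>
    have conj: "g \<circ> w \<circ> inv' g \<in> H"
      if g: "g \<in> G" and w: "w \<in> center ?S (point_stabilizer ?S G 1)" for g w
    proof -
      have w: "w \<in> G" "w 1 = 1" "\<And>h. h \<in> G \<Longrightarrow> h 1 = 1 \<Longrightarrow> w \<circ> h = h \<circ> w"
        using w unfolding center_def point_stabilizer_def stabilizer_def by (auto simp: sym_group_mult)
      obtain z where "fixing_fam z" "\<And>g. g \<in> G \<Longrightarrow> z (g 1) = g \<circ> w \<circ> inv' g"
        using central_fixing_fam[OF trans[OF one] one w] by metis
      then show ?thesis using fam[of z "g 1"] mem_X[OF g one] g by simp
    qed
    have conj': "h \<in> H"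
      if h: "h \<in> {g \<otimes>\<^bsub>?S\<^esub> w \<otimes>\<^bsub>?S\<^esub> inv\<^bsub>?S\<^esub> g | g w. g \<in> G \<and> w \<in> center ?S (point_stabilizer ?S G 1)}" for h
    proof -
      obtain g w where gw: "g \<in> G" "w \<in> center ?S (point_stabilizer ?S G 1)"
        and "h = g \<otimes>\<^bsub>?S\<^esub> w \<otimes>\<^bsub>?S\<^esub> inv\<^bsub>?S\<^esub> g" using h by blast
      then have "h = g \<circ> w \<circ> inv' g" unfolding sym_group_mult inv_eq[OF gw(1)] by blast
      then show ?thesis using conj[OF gw] by (simp only:)
    qed
    have "h \<in> H" if "h \<in> normal_closure ?S G (center ?S (point_stabilizer ?S G 1))" for h
      using that unfolding normal_closure_def
    proof (induction rule: generate.induct)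
      case one
      then show ?case unfolding sym_group_one by (rule H(2))
    next
      case (eng h1 h2)
      then show ?case unfolding sym_group_mult using comp by blast
    next
      case (incl h)
      then show ?case by (rule conj')
    next
      case (inv h)
      have h: "h \<in> H" using inv by (rule conj')
      have "inv' h \<in> H" using closed_inv[OF H] comp h by blast
      moreover have "h \<in> G" using H(1) h by blast
      ultimately show ?case using inv_eq by simp
    qed
    then show "H = G" using H(1) nc by blast
  qed
qed

end
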